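(* Let $m,n \in \mathbb{N}$ (positive integers), let $Q \subseteq \mathbb{Z}^n$, let $\Psi : \mathbb{Z}^n \to [0,\infty)$, and let $\theta \in \mathbb{R}^m$. If $\sum_{q \in Q} \Psi(q)^m < \infty$, then $$\dim_F E(m,n,Q,\Psi,\theta) = \min\{2 s(Q,\Psi),\, mn\}.$$
   Context: $|\cdot|$ denotes the max norm. A point $x = (x_{11},\ldots,x_{1n},\ldots,x_{m1},\ldots,x_{mn}) \in \mathbb{R}^{mn}$ is identified with the $m\times n$ real matrix with entries $x_{ij}$, so that for $q \in \mathbb{Z}^n$, $xq \in \mathbb{R}^m$ is the vector with $i$-th coordinate $\sum_{j=1}^n x_{ij}q_j$. $E(m,n,Q,\Psi,\theta)$ is the set of all $x \in \mathbb{R}^{mn}$ such that $|xq - r - \theta| < \Psi(q)$ for infinitely many $(r,q) \in \mathbb{Z}^m \times Q$. $\Psi_*(q) = \Psi(q)|q|^{-1}$ for $q \neq 0$, and $$s(Q,\Psi) = \inf\Big\{ s \geq 0 : \sum_{q \in Q,\, q\neq 0} \Psi_*(q)^s < \infty \Big\}.$$ Fourier dimension: for $A \subseteq \mathbb{R}^d$, let $\mathcal{P}(A)$ be the set of Borel probability measures on $\mathbb{R}^d$ whose (closed) support is contained in $A$, and let $\widehat{\mu}(\xi) = \int e^{-2\pi i x\cdot \xi}\,d\mu(x)$. Then $$\dim_F A = \sup\{\beta \in [0,d] : \exists \mu \in \mathcal{P}(A) \text{ and } C>0 \text{ such that } |\widehat{\mu}(\xi)| \leq C|\xi|^{-\beta/2}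 \text{ for all } \xi \in \mathbb{R}^d,\ \xi \neq 0\},$$ with the supremum of the empty set taken to be $0$. *)

theory Defs
  imports "HOL-Probability.Probability"
begin

text \<open>Throughout, the max norm is the library's \<open>infnorm\<close>, and an \<open>m \<times> n\<close> matrix is an
  element of \<open>real^'n^'m\<close> (rows indexed by \<open>'m\<close>), so that \<open>infnorm\<close> and the inner product on
  matrices are taken entrywise.\<close>

definition real_vec :: "int^'k \<Rightarrow> real^'k" where
  "real_vec q = (\<chi> i. real_of_int (q $ i))"

definition E_set ::
    "(int^'n) set \<Rightarrow> (int^'n \<Rightarrow> real) \<Rightarrow> real^'m \<Rightarrow> (real^'n^'m) set" where
  "E_set Q \<Psi> \<theta> =
     {x. infinite {(r :: int^'m, q). q \<in> Q \<and> infnorm (x *v real_vec q - real_vec r - \<theta>) < \<Psi> q}}"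

definition Psi_star :: "(int^'n \<Rightarrow> real) \<Rightarrow> int^'n \<Rightarrow> real" where
  "Psi_star \<Psi> q = \<Psi> q / infnorm (real_vec q)"

text \<open>Two conventions are immaterial here. Since \<open>0 powr 0 = 0\<close>, the condition at \<open>s = 0\<close>
  counts only the \<open>q\<close> with \<open>\<Psi> q \<noteq> 0\<close>; the exponents \<open>s > 0\<close> alone determine the infimum, so
  the value given to \<open>0 ^ 0\<close> does not affect it. The infimum of the empty set is
  unspecified, but if \<open>\<Psi> \<ge> 0\<close> and \<open>\<Sum>q\<in>Q. \<Psi> q ^ m\<close> converges for some \<open>m \<ge> 1\<close>, the set contains
  \<open>m\<close>, because nonzero integer vectors have max norm at least \<open>1\<close>.\<close>

definition s_exponent :: "(int^'n) set \<Rightarrow> (int^'n \<Rightarrow> real) \<Rightarrow> real" where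
  "s_exponent Q \<Psi> =
     Inf {s. s \<ge> 0 \<and> (\<lambda>q. Psi_star \<Psi> q powr s) summable_on {q \<in> Q. q \<noteq> 0}}"

definition closed_support :: "'a::topological_space measure \<Rightarrow> 'a set" where
  "closed_support \<mu> = {x. \<forall>U. open U \<and> x \<in> U \<longrightarrow> emeasure \<mu> U > 0}"

definition prob_measures_on :: "'a::euclidean_space set \<Rightarrow> 'a measure set" where
  "prob_measures_on A = {\<mu>. prob_space \<mu> \<and> sets \<mu> = sets borel \<and> closed_support \<mu> \<subseteq> A}"

definition fourier_transform :: "'a::euclidean_space measure \<Rightarrow> 'a \<Rightarrow> complex" where
  "fourier_transform \<mu> \<xi> =
     (LINT x|\<mu>. exp (- 2 * complex_of_real pi * \<i> * complex_of_real (x \<bullet> \<xi>)))"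

definition fourier_exponents :: "'a::euclidean_space set \<Rightarrow> real set" where
  "fourier_exponents A =
     {\<beta>. 0 \<le> \<beta> \<and> \<beta> \<le> real DIM('a) \<and>
         (\<exists>\<mu> \<in> prob_measures_on A. \<exists>C > 0. \<forall>\<xi>. \<xi> \<noteq> 0 \<longrightarrow>
            cmod (fourier_transform \<mu> \<xi>) \<le> C * infnorm \<xi> powr (- \<beta> / 2))}"

definition fourier_dim :: "'a::euclidean_space set \<Rightarrow> real" where
  "fourier_dim A = (if fourier_exponents A = {} then 0 else Sup (fourier_exponents A))"

end

theory Submission
  imports Defs "HOL-Computational_Algebra.Primes"
begin

text \<open>Write \<open>k \<otimes> q\<close> for the rank one matrix \<open>(k\<^sub>i q\<^sub>j)\<close>, so that \<open>k \<bullet> (x q) = x \<bullet> (k \<otimes> q)\<close>.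

  Upper bound: a Fejer kernel majorant expresses the mass that \<open>\<mu>\<close> gives to the \<open>\<Psi>(q)\<close>-neighbourhood
  of the hyperplanes \<open>x q - \<theta> \<in> \<int>\<^sup>m\<close> through the values of its Fourier transform at \<open>k \<otimes> q\<close>. If the
  transform decays like \<open>\<bar>\<xi>\<bar>\<^sup>-\<^sup>t\<close>, then the mass is \<open>O(\<Psi>(q)\<^sup>m + \<Psi>\<^sub>*(q)\<^sup>t)\<close>, which is summable when
  \<open>t > s(Q, \<Psi>)\<close>, so by Borel-Cantelli \<open>\<mu>\<close> cannot live on the limsup set.

  Lower bound: for \<open>t < s(Q, \<Psi>)\<close> average smooth bumps around these neighbourhoods over finitely many
  \<open>q\<close> with weights proportional to \<open>\<Psi>\<^sub>*(q)\<^sup>t\<close>. The coefficient at \<open>k \<otimes> q\<close> is then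
  \<open>O(S\<^sup>-\<^sup>1 \<bar>k \<otimes> q\<bar>\<^sup>-\<^sup>t)\<close>, where \<open>S\<close> is the sum of the \<open>\<Psi>\<^sub>*(q)\<^sup>t\<close>, and by the divisor bound a lattice
  point \<open>l\<close> has \<open>O(\<bar>l\<bar>\<^sup>\<epsilon>)\<close> representations \<open>k \<otimes> q\<close>. As \<open>S\<close> can be made arbitrarily large, multiplying
  by such an average changes the Fourier transform of a given smooth measure by an arbitrarily small
  multiple of \<open>(1 + \<bar>\<xi>\<bar>)\<close> to the power \<open>\<epsilon> - t\<close>. A weak limit of iterated products is the required
  measure.\<close>

subsection \<open>Weak compactness on compact sets\<close>

text \<open>A single bump does not suffice for the lower bound: its coefficient at
  \<open>k \<otimes> q\<close> is only bounded by a multiple of Psi_*(q)^(-t) |k (x) q|^(-t), and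
  Psi_*(q)^(-t) may be huge. The weights Psi_*(q)^t cancel exactly this factor, and the divergence
  of their sum makes the remaining 1/S as small as desired. Two exponents t' < t appear throughout
  because the divisor bound costs a small power. Every stage must start from a transform with decay
  of order D >= t' + 2mn, so that t' powers can be passed on to \<open>\<xi>\<close> while 2mn
  remain to sum over the lattice. Two invariants are therefore carried along: decay of order D with
  a constant that may grow from stage to stage, and decay of order t' with a total error of at most
  1/2. Different stages use disjoint finite sets of q, so a point of the limiting support solves the
  inequality for infinitely many q. Convergence of the sum of Psi(q)^m takes care of the zero
  frequency of the majorant in the upper bound, and in both halves leaves only finitely many q with
  large Psi(q).\<close>

text \<open>The leading term has modulus 2/3^(i+1) and the tail behind it is at most 1/3^(i+1). Base
  3 with digits 0 and 2, as for the Cantor set, leaves this gap, so the distance of two codes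
  reveals their first disagreement.\<close>

lemma ternary_sum_lower_bound:
  fixes d :: "nat \<Rightarrow> real"
  assumes d: "\<And>j. \<bar>d j\<bar> \<le> 1" and z: "\<And>j. j < i \<Longrightarrow> d j = 0" and i: "\<bar>d i\<bar> = 1"
  shows "\<bar>\<Sum>j. 2 / 3 ^ Suc j * d j\<bar> \<ge> 1 / 3 ^ Suc i"
proof -
  let ?a = "\<lambda>j. 2 / 3 ^ Suc j * d j"
  have geo: "(\<lambda>j. 2 / 3 ^ Suc (j + Suc i)) sums (1 / 3 ^ Suc i :: real)"
  proof -
    have "(\<lambda>j. (2 / 3 ^ Suc (Suc i)) * (1/3::real) ^ j) sums ((2 / 3 ^ Suc (Suc i)) * (1 / (1 - 1/3)))"
      by (intro sums_mult geometric_sums) auto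
    then show ?thesis
      by (simp add: power_add power_one_over field_simps)
  qed
  have sm: "summable (\<lambda>j. norm (?a j))"
  proof (rule summable_comparison_test')
    show "summable (\<lambda>j. 2 * (1/3::real) ^ Suc j)"
      by (intro summable_mult) (auto simp: summable_Suc_iff)
    show "norm (norm (?a n)) \<le> 2 * (1/3::real) ^ Suc n" for n
      using d[of n] by (simp add: abs_mult power_one_over field_simps)
  qed
  have sa: "summable ?a" using sm by (rule summable_norm_cancel)
  have "suminf ?a = (\<Sum>j. ?a (j + Suc i)) + (\<Sum>j<Suc i. ?a j)"
    by (rule suminf_split_initial_segment[OF sa])
  also have "(\<Sum>j<Suc i. ?a j) = ?a i"
    using z by simp
  finally have eq: "suminf ?a = (\<Sum>j. ?a (j + Suc i)) + ?a i" .
  have "norm (\<Sum>j. ?a (j + Suc i)) \<le> (\<Sum>j. 2 / 3 ^ Suc (j + Suc i))"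
  proof (rule norm_suminf_le)
    show "norm (?a (n + Suc i)) \<le> 2 / 3 ^ Suc (n + Suc i)" for n
      using d[of "n + Suc i"] by (simp add: abs_mult field_simps)
  qed (use geo in \<open>simp add: sums_iff\<close>)
  also have "\<dots> = 1 / 3 ^ Suc i" using geo by (simp add: sums_iff)
  finally have t: "\<bar>\<Sum>j. ?a (j + Suc i)\<bar> \<le> 1 / 3 ^ Suc i" by simp
  have "\<bar>?a i\<bar> = 2 / 3 ^ Suc i" using i by (simp add: abs_mult)
  with eq t show ?thesis by linarith
qed

text \<open>A point is coded by its memberships in a countable basis, read as ternary digits. The
  code is only Borel, but its inverse on \<open>K\<close> is uniformly continuous: close codes agree
  on many basis sets, and by compactness finitely many small basis sets cover
  \<open>K\<close>.\<close>

lemma compact_code_in_unit_interval: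
  fixes K :: "'a::euclidean_space set"
  assumes K: "compact K"
  obtains \<sigma> :: "'a \<Rightarrow> real" and \<gamma> :: "real \<Rightarrow> 'a"
  where "\<sigma> \<in> borel_measurable borel" "\<And>x. \<sigma> x \<in> {0..1}" "continuous_on UNIV \<gamma>"
    "\<And>x. x \<in> K \<Longrightarrow> \<gamma> (\<sigma> x) = x"
proof -
  obtain B :: "'a set set" where B: "countable B" "topological_basis B"
    using ex_countable_basis by blast
  have "B \<noteq> {}" using B(2) unfolding topological_basis_def by (metis Union_empty empty_not_UNIV open_UNIV subset_empty)
  define b where "b = from_nat_into B"
  have bB: "range b = B" using B(1) \<open>B \<noteq> {}\<close> unfolding b_def by (simp add: range_from_nat_into)
  have opb: "open (b i)" for i using B(2) bB by (metis rangeI topological_basis_open)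
  define a where "a x j = 2 / 3 ^ Suc j * indicat_real (b j) x" for x j
  define \<sigma> where "\<sigma> x = (\<Sum>j. a x j)" for x
  have geo: "(\<lambda>j. 2 / 3 ^ Suc j) sums (1::real)"
  proof -
    have "(\<lambda>j. (2 / 3) * (1/3::real) ^ j) sums ((2 / 3) * (1 / (1 - 1/3)))"
      by (intro sums_mult geometric_sums) auto
    then show ?thesis by (simp add: power_one_over field_simps)
  qed
  have sa: "summable (a x)" for x
  proof (rule summable_comparison_test')
    show "summable (\<lambda>j. 2 / 3 ^ Suc j :: real)" using geo by (simp add: sums_iff)
    show "norm (a x n) \<le> 2 / 3 ^ Suc n" for n by (auto simp: a_def indicator_def)
  qed
  have \<sigma>01: "\<sigma> x \<in> {0..1}" for x
  proof -
    have "0 \<le> \<sigma> x" unfolding \<sigma>_def by (rule suminf_nonneg[OF sa]) (auto simp: a_def)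
    moreover have "\<sigma> x \<le> (\<Sum>j. 2 / 3 ^ Suc j)" unfolding \<sigma>_def
      by (rule suminf_le[OF _ sa]) (use geo in \<open>auto simp: a_def sums_iff indicator_def\<close>)
    ultimately show ?thesis using geo by (simp add: sums_iff)
  qed
  have [measurable]: "b j \<in> sets borel" for j using opb by simp
  have \<sigma>m: "\<sigma> \<in> borel_measurable borel"
    unfolding \<sigma>_def a_def by measurable
  have agree: "\<forall>i<n. x \<in> b i \<longleftrightarrow> y \<in> b i" if "\<bar>\<sigma> x - \<sigma> y\<bar> < 1 / 3 ^ n" for x y n
  proof (rule ccontr)
    assume "\<not> ?thesis"
    then have ex: "\<exists>i. i < n \<and> (x \<in> b i) \<noteq> (y \<in> b i)" by blast
    define i where "i = (LEAST i. i < n \<and> (x \<in> b i) \<noteq> (y \<in> b i))"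
    have i: "i < n" "(x \<in> b i) \<noteq> (y \<in> b i)" using LeastI_ex[OF ex] unfolding i_def by blast+
    have lt: "(x \<in> b j) = (y \<in> b j)" if "j < i" for j
      using not_less_Least[of j "\<lambda>i. i < n \<and> (x \<in> b i) \<noteq> (y \<in> b i)"] that i(1)
      unfolding i_def by auto
    define d where "d j = indicat_real (b j) x - indicat_real (b j) y" for j
    have "\<sigma> x - \<sigma> y = (\<Sum>j. a x j - a y j)"
      unfolding \<sigma>_def by (rule suminf_diff[OF sa sa])
    also have "\<dots> = (\<Sum>j. 2 / 3 ^ Suc j * d j)"
      by (rule suminf_cong) (simp add: a_def d_def field_simps)
    finally have e: "\<sigma> x - \<sigma> y = (\<Sum>j. 2 / 3 ^ Suc j * d j)" .
    have "\<bar>\<Sum>j. 2 / 3 ^ Suc j * d j\<bar> \<ge> 1 / 3 ^ Suc i"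
      by (rule ternary_sum_lower_bound) (use i lt in \<open>auto simp: d_def indicator_def\<close>)
    moreover have "(1::real) / 3 ^ Suc i \<ge> 1 / 3 ^ n"
      using i(1) by (intro divide_left_mono power_increasing) auto
    ultimately show False using that e by linarith
  qed
  have close: "\<exists>n. \<forall>x\<in>K. \<forall>y\<in>K. (\<forall>i<n. x \<in> b i \<longleftrightarrow> y \<in> b i) \<longrightarrow> dist x y < e" if "e > 0" for e
  proof -
    define I where "I = {i. \<exists>z. b i \<subseteq> ball z (e/2)}"
    have cov: "K \<subseteq> \<Union> (b ` I)"
    proof
      fix x assume "x \<in> K"
      obtain V where "V \<in> B" "x \<in> V" "V \<subseteq> ball x (e/2)"
        using topological_basisE[OF B(2), of "ball x (e/2)" x] \<open>e > 0\<close> by auto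
      then show "x \<in> \<Union> (b ` I)" using bB unfolding I_def by auto
    qed
    obtain J where J: "J \<subseteq> I" "finite J" "K \<subseteq> \<Union> (b ` J)"
      using compactE_image[OF K, of I b] cov opb by auto
    obtain n where n: "\<forall>i\<in>J. i < n" using J(2) finite_nat_set_iff_bounded by blast
    show ?thesis
    proof (intro exI[of _ n] ballI impI)
      fix x y assume xy: "x \<in> K" "y \<in> K" "\<forall>i<n. x \<in> b i \<longleftrightarrow> y \<in> b i"
      obtain i where i: "i \<in> J" "x \<in> b i" using J(3) xy by auto
      then have "y \<in> b i" using n xy by auto
      obtain z where "b i \<subseteq> ball z (e/2)" using i J(1) I_def by auto
      then have "dist z x < e/2" "dist z y < e/2" using i \<open>y \<in> b i\<close> by auto
      then show "dist x y < e" using dist_triangle_half_r by blast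
    qed
  qed
  have sep: "\<exists>\<delta>>0. \<forall>x\<in>K. \<forall>y\<in>K. \<bar>\<sigma> x - \<sigma> y\<bar> < \<delta> \<longrightarrow> dist x y < e" if "e > 0" for e
  proof -
    obtain n where n: "\<forall>x\<in>K. \<forall>y\<in>K. (\<forall>i<n. x \<in> b i \<longleftrightarrow> y \<in> b i) \<longrightarrow> dist x y < e" 
      using close[OF \<open>e > 0\<close>] by blast
    show ?thesis
      by (rule exI[of _ "1/3^n"]) (use n agree in auto)
  qed
  have inj: "inj_on \<sigma> K"
  proof (rule inj_onI)
    fix x y assume "x \<in> K" "y \<in> K" "\<sigma> x = \<sigma> y"
    then have "dist x y < e" if "e > 0" for e using sep[OF that] by auto
    then show "x = y" by (metis dist_pos_lt less_irrefl)
  qed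
  define g where "g = inv_into K \<sigma>"
  have g: "g (\<sigma> x) = x" if "x \<in> K" for x using inj that by (simp add: g_def)
  have "uniformly_continuous_on (\<sigma> ` K) g"
    unfolding uniformly_continuous_on_def
  proof (intro allI impI)
    fix e :: real assume "e > 0"
    obtain \<delta> where "\<delta> > 0" "\<forall>x\<in>K. \<forall>y\<in>K. \<bar>\<sigma> x - \<sigma> y\<bar> < \<delta> \<longrightarrow> dist x y < e"
      using sep[OF \<open>e > 0\<close>] by blast
    then show "\<exists>d>0. \<forall>x\<in>\<sigma> ` K. \<forall>x'\<in>\<sigma> ` K. dist x' x < d \<longrightarrow> dist (g x') (g x) < e"
      by (intro exI[of _ \<delta>]) (auto simp: g dist_real_def)
  qed
  \<comment> \<open>The set of codes need not be closed because \<open>\<sigma>\<close> is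
    discontinuous. Uniform continuity carries the inverse to the closure, where Tietze
    applies.\<close>
  then obtain h where h: "uniformly_continuous_on (closure (\<sigma> ` K)) h" "\<And>x. x \<in> \<sigma> ` K \<Longrightarrow> g x = h x"
    using uniformly_continuous_on_extension_on_closure by metis
  then have "continuous_on (closure (\<sigma> ` K)) h" using uniformly_continuous_imp_continuous by blast
  then obtain \<gamma> where \<gamma>: "continuous_on UNIV \<gamma>" "\<And>x. x \<in> closure (\<sigma> ` K) \<Longrightarrow> \<gamma> x = h x"
    using Tietze_unbounded[of "closure (\<sigma> ` K)" h UNIV] by auto
  have "\<gamma> (\<sigma> x) = x" if "x \<in> K" for x
    using \<gamma>(2)[of "\<sigma> x"] h(2)[of "\<sigma> x"] g[OF that] that closure_subset[of "\<sigma> ` K"] by auto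
  with \<sigma>m \<sigma>01 \<gamma>(1) that show thesis by blast
qed

text \<open>The images under \<open>\<sigma>\<close> live on [0,1] and are therefore tight; a weak
  limit on the line is pushed back by \<open>\<gamma>\<close>. Since \<open>\<gamma>\<close> is
  continuous, a test function f becomes the test function f o \<open>\<gamma>\<close>, and
  \<open>\<gamma> (\<sigma> x) = x\<close> on \<open>K\<close> identifies the integrals.\<close>

lemma weakly_convergent_subsequence_on_compact:
  fixes K :: "'a::euclidean_space set" and M :: "nat \<Rightarrow> 'a measure"
  assumes K: "compact K" and M: "\<And>k. prob_space (M k)" "\<And>k. sets (M k) = sets borel"
    and MK: "\<And>k. AE x in M k. x \<in> K"
  obtains r \<mu> where "strict_mono r" "prob_space \<mu>" "sets \<mu> = sets borel"
    "\<And>f :: 'a \<Rightarrow> complex. \<lbrakk>continuous_on UNIV f; bounded (range f)\<rbrakk> \<Longrightarrow>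
       (\<lambda>k. LINT x|M (r k). f x) \<longlonglongrightarrow> (LINT x|\<mu>. f x)"
proof -
  obtain \<sigma> \<gamma> where \<sigma>: "\<sigma> \<in> borel_measurable borel" "\<And>x. \<sigma> x \<in> {0..1::real}" 
    and \<gamma>: "continuous_on UNIV \<gamma>" "\<And>x. x \<in> K \<Longrightarrow> \<gamma> (\<sigma> x) = (x::'a)"
    using compact_code_in_unit_interval[OF K] by metis
  have \<sigma>M[measurable]: "\<sigma> \<in> M k \<rightarrow>\<^sub>M borel" for k using \<sigma>(1) M(2) measurable_cong_sets by blast
  have [measurable]: "\<gamma> \<in> borel \<rightarrow>\<^sub>M borel" using \<gamma>(1) borel_measurable_continuous_onI by blast
  define N where "N k = distr (M k) borel \<sigma>" for k
  have N: "real_distribution (N k)" for k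
    unfolding N_def using M(1) by (intro prob_space.real_distribution_distr) auto
  have "tight N"
    unfolding tight_def
  proof (intro conjI allI impI N)
    fix e :: real assume "e > 0"
    have "measure (N k) {-1<..1} = 1" for k
    proof -
      have "measure (N k) {-1<..1} = measure (M k) (\<sigma> -` {-1<..1} \<inter> space (M k))"
        unfolding N_def by (rule measure_distr) auto
      also have "\<sigma> -` {-1<..1} \<inter> space (M k) = space (M k)" using \<sigma>(2) by force
      finally show ?thesis using M(1) by (simp add: prob_space.prob_space)
    qed
    then show "\<exists>a b. a < b \<and> (\<forall>n. 1 - e < measure (N n) {a<..b})"
      using \<open>e > 0\<close> by (intro exI[of _ "-1"] exI[of _ 1]) auto
  qed
  then obtain r \<nu> where r: "strict_mono (r :: nat \<Rightarrow> nat)" "real_distribution \<nu>" "weak_conv_m (N \<circ> id \<circ> r) \<nu>"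
    using tight_imp_convergent_subsubsequence[of N id] strict_mono_id by blast
  define \<mu> where "\<mu> = distr \<nu> borel \<gamma>"
  interpret \<nu>: real_distribution \<nu> by fact
  have gm[measurable]: "\<gamma> \<in> \<nu> \<rightarrow>\<^sub>M borel" by simp
  show thesis
  proof (rule that[OF r(1)])
    show "prob_space \<mu>" unfolding \<mu>_def by (rule \<nu>.prob_space_distr) simp
    show "sets \<mu> = sets borel" unfolding \<mu>_def by simp
    fix f :: "'a \<Rightarrow> complex" assume f: "continuous_on UNIV f" "bounded (range f)"
    have [measurable]: "f \<in> borel_measurable borel" using f(1) borel_measurable_continuous_onI by blast
    obtain B where B: "\<And>x. norm (f x) \<le> B" using f(2) by (auto simp: bounded_iff)
    have c: "continuous_on UNIV (\<lambda>y. f (\<gamma> y))"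
      by (rule continuous_on_compose2[OF f(1) \<gamma>(1)]) auto
    have "(\<lambda>k. LINT y|(N \<circ> id \<circ> r) k. f (\<gamma> y)) \<longlonglongrightarrow> (LINT y|\<nu>. f (\<gamma> y))"
      using r N B c
      by (intro weak_conv_imp_integral_bdd_continuous_conv[where B=B])
         (auto simp: continuous_on_eq_continuous_at comp_def)
    moreover have [measurable]: "f \<in> borel_measurable (M k)" for k
      using \<open>f \<in> borel_measurable borel\<close> M(2) measurable_cong_sets by blast
    moreover have "(LINT y|(N \<circ> id \<circ> r) k. f (\<gamma> y)) = (LINT x|M (r k). f x)" for k
    proof -
      have "(LINT y|(N \<circ> id \<circ> r) k. f (\<gamma> y)) = (LINT x|M (r k). f (\<gamma> (\<sigma> x)))"
        unfolding N_def comp_def id_def by (rule integral_distr) auto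
      also have "\<dots> = (LINT x|M (r k). f x)"
        using MK[of "r k"]
        by (intro integral_cong_AE) (auto simp: \<gamma>(2) elim!: eventually_mono)
      finally show ?thesis .
    qed
    moreover have "(LINT y|\<nu>. f (\<gamma> y)) = (LINT x|\<mu>. f x)"
      unfolding \<mu>_def by (rule integral_distr[symmetric]) auto
    ultimately show "(\<lambda>k. LINT x|M (r k). f x) \<longlonglongrightarrow> (LINT x|\<mu>. f x)" by simp
  qed
qed

subsection \<open>Exponentials\<close>

definition e_of :: "real \<Rightarrow> complex" where
  "e_of t = cis (2 * pi * t)"

lemma e_of_add: "e_of (a + b) = e_of a * e_of b"
  by (simp add: e_of_def cis_mult distrib_left)

lemma e_of_diff: "e_of (a - b) = e_of a * e_of (- b)"
  using e_of_add[of a "- b"] by simp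

lemma e_of_0 [simp]: "e_of 0 = 1"
  by (simp add: e_of_def)

lemma norm_e_of [simp]: "norm (e_of t) = 1"
  by (simp add: e_of_def)

lemma cnj_e_of: "cnj (e_of t) = e_of (- t)"
  by (simp add: e_of_def cis_cnj)

lemma e_of_int [simp]: "e_of (of_int k) = 1"
  by (simp add: e_of_def)

lemma e_of_sum: "finite A \<Longrightarrow> e_of (sum f A) = (\<Prod>i\<in>A. e_of (f i))"
  by (induction A rule: finite_induct) (auto simp: e_of_add)

lemma e_of_of_nat_mult: "e_of (real j * y) = e_of y ^ j"
  by (simp add: e_of_def Complex.DeMoivre mult_ac)

lemma continuous_on_e_of [continuous_intros]: "continuous_on A f \<Longrightarrow> continuous_on A (\<lambda>x. e_of (f x))"
  unfolding e_of_def by (intro continuous_intros)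

lemma measurable_e_of [measurable]: "e_of \<in> borel_measurable borel"
  by (intro borel_measurable_continuous_onI continuous_intros)

subsection \<open>The Fejer kernel\<close>

definition fejer :: "nat \<Rightarrow> real \<Rightarrow> real" where
  "fejer N y = (norm (\<Sum>j<N. e_of (real j * y)))\<^sup>2 / real N"

lemma fejer_nonneg: "0 \<le> fejer N y"
  by (simp add: fejer_def)

text \<open>Passing from N to N + 1 adds the cross terms of the new exponential with the old ones,
  which supply the frequencies -N..-1 and 1..N, and its own square, which supplies 0. Every
  coefficient thus grows by one.\<close>

lemma norm_exponential_sum_square:
  "complex_of_real ((norm (\<Sum>j<N. e_of (real j * y)))\<^sup>2)
     = (\<Sum>k\<in>{- int N..int N}. complex_of_real (real N - \<bar>real_of_int k\<bar>) * e_of (real_of_int k * y))"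
proof (induction N)
  case 0
  then show ?case by simp
next
  case (Suc N)
  let ?S = "\<Sum>j<N. e_of (real j * y)"
  let ?E = "\<lambda>k. e_of (real_of_int k * y)"
  have neg: "?S * e_of (- (real N * y)) = sum ?E {- int N..<0}"
  proof -
    have "?S * e_of (- (real N * y)) = (\<Sum>j<N. ?E (int j - int N))"
      unfolding sum_distrib_right by (intro sum.cong refl) (simp add: left_diff_distrib flip: e_of_add)
    also have "\<dots> = sum ?E {- int N..<0}"
      by (rule sum.reindex_bij_witness[of _ "\<lambda>k. nat (k + int N)" "\<lambda>j. int j - int N"]) auto
    finally show ?thesis .
  qed
  have pos: "cnj ?S * e_of (real N * y) = sum ?E {0<..int N}"
  proof -
    have "cnj ?S * e_of (real N * y) = (\<Sum>j<N. ?E (int N - int j))"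
      unfolding sum_distrib_right cnj_sum cnj_e_of
      by (intro sum.cong refl) (simp add: left_diff_distrib flip: e_of_add)
    also have "\<dots> = sum ?E {0<..int N}"
      by (rule sum.reindex_bij_witness[of _ "\<lambda>k. nat (int N - k)" "\<lambda>j. int N - int j"]) auto
    finally show ?thesis .
  qed
  have split: "{- int N..int N} = {- int N..<0} \<union> {0} \<union> {0<..int N}" by auto
  have D: "sum ?E {- int N..int N} = sum ?E {- int N..<0} + 1 + sum ?E {0<..int N}"
    unfolding split by (subst sum.union_disjoint; auto)+
  have "complex_of_real ((norm (\<Sum>j<Suc N. e_of (real j * y)))\<^sup>2)
      = (?S + e_of (real N * y)) * cnj (?S + e_of (real N * y))"
    by (simp only: sum.lessThan_Suc complex_norm_square)
  also have "\<dots> = ?S * cnj ?S + ?S * e_of (- (real N * y)) + cnj ?S * e_of (real N * y)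
                 + e_of (real N * y) * e_of (- (real N * y))"
    by (simp add: cnj_e_of algebra_simps del: cnj_sum)
  also have "e_of (real N * y) * e_of (- (real N * y)) = 1"
    by (simp flip: e_of_add)
  also have "?S * cnj ?S = complex_of_real ((norm ?S)\<^sup>2)" by (simp only: complex_norm_square)
  also have "\<dots> + ?S * e_of (- (real N * y)) + cnj ?S * e_of (real N * y) + 1
      = (\<Sum>k\<in>{- int N..int N}. complex_of_real (real N - \<bar>real_of_int k\<bar>) * ?E k) + sum ?E {- int N..int N}"
    unfolding neg pos D Suc.IH by simp
  also have "\<dots> = (\<Sum>k\<in>{- int N..int N}. complex_of_real (real (Suc N) - \<bar>real_of_int k\<bar>) * ?E k)"
    by (simp add: sum.distrib[symmetric] algebra_simps)
  \<comment> \<open>The two new end frequencies enter with coefficient 0.\<close>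
  also have "\<dots> = (\<Sum>k\<in>{- int (Suc N)..int (Suc N)}. complex_of_real (real (Suc N) - \<bar>real_of_int k\<bar>) * ?E k)"
  proof (rule sum.mono_neutral_left)
    show "\<forall>i\<in>{- int (Suc N)..int (Suc N)} - {- int N..int N}.
       complex_of_real (real (Suc N) - \<bar>real_of_int i\<bar>) * ?E i = 0"
    proof
      fix i assume "i \<in> {- int (Suc N)..int (Suc N)} - {- int N..int N}"
      then have "i = int (Suc N) \<or> i = - int (Suc N)" by auto
      then show "complex_of_real (real (Suc N) - \<bar>real_of_int i\<bar>) * ?E i = 0" by auto
    qed
  qed auto
  finally show ?case .
qed

definition fejer_coeff :: "nat \<Rightarrow> int \<Rightarrow> real" where
  "fejer_coeff N k = (real N - \<bar>real_of_int k\<bar>) / real N"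

lemma fejer_expansion:
  "complex_of_real (fejer N y)
     = (\<Sum>k\<in>{- int N..int N}. complex_of_real (fejer_coeff N k) * e_of (real_of_int k * y))"
proof -
  have "complex_of_real (fejer N y)
      = complex_of_real ((norm (\<Sum>j<N. e_of (real j * y)))\<^sup>2) / of_nat N"
    by (simp add: fejer_def)
  also have "\<dots> = (\<Sum>k\<in>{- int N..int N}. complex_of_real (real N - \<bar>real_of_int k\<bar>) * e_of (real_of_int k * y) / of_nat N)"
    unfolding norm_exponential_sum_square by (rule sum_divide_distrib)
  finally show ?thesis by (simp add: fejer_coeff_def)
qed

lemma fejer_coeff_bounds:
  assumes "N > 0" "k \<in> {- int N..int N}"
  shows "0 \<le> fejer_coeff N k" "fejer_coeff N k \<le> 1"
  using assms by (auto simp: fejer_coeff_def field_simps)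

lemma fejer_coeff_0: "N > 0 \<Longrightarrow> fejer_coeff N 0 = 1"
  by (simp add: fejer_coeff_def)

text \<open>All phases j (y - r) with j < N stay within a sixth of a turn, where the cosine is at
  least 1/2; hence the exponential sum has real part at least N/2. This is the origin of the
  6.\<close>

lemma fejer_near_integer:
  assumes "N > 0" "\<bar>y - of_int r\<bar> \<le> 1 / (6 * real N)"
  shows "fejer N y \<ge> real N / 4"
proof -
  define z where "z = y - of_int r"
  have ez: "e_of (real j * y) = e_of (real j * z)" for j
  proof -
    have "real j * y = real j * z + of_int (int j * r)" by (simp add: z_def algebra_simps)
    then show ?thesis by (simp only: e_of_add e_of_int mult_1_right)
  qed
  have cosz: "cos (2 * pi * (real j * z)) \<ge> 1/2" if "j < N" for j
  proof -
    have "real j * \<bar>z\<bar> \<le> real N * (1 / (6 * real N))"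
      using assms that by (intro mult_mono) (auto simp: z_def)
    then have "\<bar>real j * z\<bar> \<le> 1/6" using \<open>N > 0\<close> by (simp add: abs_mult)
    then have b: "\<bar>2 * pi * (real j * z)\<bar> \<le> pi / 3" by (simp add: abs_mult)
    have "cos (pi/3) \<le> cos \<bar>2 * pi * (real j * z)\<bar>"
      using b pi_gt_zero by (intro cos_monotone_0_pi_le) auto
    then show ?thesis by (simp add: cos_60)
  qed
  have "real N / 2 \<le> (\<Sum>j<N. cos (2 * pi * (real j * z)))"
    using sum_mono[of "{..<N}" "\<lambda>_. 1/2" "\<lambda>j. cos (2 * pi * (real j * z))"] cosz by simp
  also have "\<dots> = Re (\<Sum>j<N. e_of (real j * y))" by (simp only: ez) (simp add: e_of_def)
  also have "\<dots> \<le> norm (\<Sum>j<N. e_of (real j * y))" by (rule complex_Re_le_cmod)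
  finally have "(real N / 2)\<^sup>2 \<le> (norm (\<Sum>j<N. e_of (real j * y)))\<^sup>2"
    by (intro power_mono) auto
  then have "(real N / 2)\<^sup>2 / real N \<le> fejer N y"
    unfolding fejer_def by (intro divide_right_mono) auto
  then show ?thesis using \<open>N > 0\<close> by (simp add: power2_eq_square)
qed

text \<open>The geometric sum, written without a division so that it also covers integers y.\<close>

lemma fejer_decay:
  assumes "N > 0"
  shows "(norm (1 - e_of y))\<^sup>2 * fejer N y \<le> 4 / real N"
proof -
  have "(1 - e_of y) * (\<Sum>j<N. e_of (real j * y)) = 1 - e_of y ^ N"
    unfolding e_of_of_nat_mult by (rule one_diff_power_eq[symmetric])
  then have "norm (1 - e_of y) * norm (\<Sum>j<N. e_of (real j * y)) = norm (1 - e_of y ^ N)"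
    by (metis norm_mult)
  also have "\<dots> \<le> 2"
    using norm_triangle_ineq4[of 1 "e_of y ^ N"] by (simp add: norm_power)
  finally have "(norm (1 - e_of y) * norm (\<Sum>j<N. e_of (real j * y)))\<^sup>2 \<le> 2\<^sup>2"
    by (intro power_mono) auto
  then show ?thesis using \<open>N > 0\<close> by (simp add: fejer_def power_mult_distrib divide_right_mono)
qed

lemma continuous_on_fejer [continuous_intros]: "continuous_on A f \<Longrightarrow> continuous_on A (\<lambda>x. fejer N (f x))"
  unfolding fejer_def divide_inverse by (intro continuous_intros)

lemma measurable_fejer [measurable]: "fejer N \<in> borel_measurable borel"
  by (intro borel_measurable_continuous_onI continuous_intros)

subsection \<open>The uniform distribution on the unit interval\<close>

definition unif :: "real measure" where
  "unif = restrict_space lborel {0..1}"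

lemma space_unif: "space unif = {0..1}"
  by (simp add: unif_def space_restrict_space)

lemma prob_space_unif: "prob_space unif"
  by (rule prob_spaceI) (simp add: unif_def space_restrict_space emeasure_restrict_space)

lemma borel_measurable_unif: "f \<in> borel_measurable borel \<Longrightarrow> f \<in> borel_measurable unif"
  unfolding unif_def by (rule measurable_restrict_space1) simp

lemma integral_unif:
  fixes f :: "real \<Rightarrow> 'b::{banach, second_countable_topology}"
  shows "(LINT u|unif. f u) = (LINT u:{0..1}|lborel. f u)"
  unfolding unif_def set_lebesgue_integral_def by (rule integral_restrict_space) simp

lemma unif_integral_e_of:
  assumes "t \<noteq> 0"
  shows "(LINT u|unif. e_of (t * u)) = (e_of t - 1) / (2 * pi * \<i> * t)"
proof -
  let ?F = "\<lambda>u. e_of (t * u) / (2 * pi * \<i> * t)"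
  have "(LBINT u. indicator {0..1} u *\<^sub>R e_of (t * u)) = ?F 1 - ?F 0"
  proof (rule integral_FTC_atLeastAtMost)
    fix x :: real
    let ?c = "2 * pi * \<i> * t"
    have "((\<lambda>z. exp (?c * z) / ?c) has_field_derivative exp (?c * of_real x)) (at (of_real x))"
      using assms by (auto intro!: derivative_eq_intros)
    then have "((\<lambda>u. exp (?c * of_real u) / ?c) has_vector_derivative exp (?c * of_real x)) (at x within {0..1})"
      by (rule has_vector_derivative_real_field)
    then show "(?F has_vector_derivative e_of (t * x)) (at x within {0..1})"
      by (simp add: e_of_def cis_conv_exp mult_ac)
  qed (auto intro!: continuous_intros)
  then show ?thesis
    using assms by (simp add: integral_unif set_lebesgue_integral_def diff_divide_distrib)
qed

lemma unif_integral_e_of_int: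
  assumes "k \<noteq> 0"
  shows "(LINT u|unif. e_of (real_of_int k * u)) = 0"
  using assms by (simp add: unif_integral_e_of)

lemma unif_integral_e_of_bound:
  shows "norm (LINT u|unif. e_of (t * u)) \<le> 1"
    "t \<noteq> 0 \<Longrightarrow> norm (LINT u|unif. e_of (t * u)) \<le> 1 / (pi * \<bar>t\<bar>)"
proof -
  interpret prob_space unif by (rule prob_space_unif)
  have "norm (LINT u|unif. e_of (t * u)) \<le> (LINT u|unif. norm (e_of (t * u)))" by (rule integral_norm_bound)
  then show "norm (LINT u|unif. e_of (t * u)) \<le> 1" by (simp add: prob_space)
  assume t: "t \<noteq> 0"
  have "norm (e_of t - 1) \<le> 2" using norm_triangle_ineq4[of "e_of t" 1] by simp
  then show "norm (LINT u|unif. e_of (t * u)) \<le> 1 / (pi * \<bar>t\<bar>)"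
    using t by (simp add: unif_integral_e_of norm_divide norm_mult divide_simps)
qed

lemma prob_space_PiM_unif: "prob_space (PiM J (\<lambda>_. unif))"
  by (intro prob_space_PiM prob_space_unif)

lemma measurable_PiM_unif_component [measurable (raw)]:
  assumes "j \<in> J"
  shows "(\<lambda>\<omega>. \<omega> j) \<in> borel_measurable (PiM J (\<lambda>_. unif))"
  using measurable_compose[OF measurable_component_singleton[OF assms, of "\<lambda>_. unif"] borel_measurable_unif[of "\<lambda>x. x"]]
  by simp

lemma PiM_unif_range:
  assumes "\<omega> \<in> space (PiM J (\<lambda>_. unif))" "j \<in> J"
  shows "0 \<le> \<omega> j" "\<omega> j \<le> 1"
  using assms by (auto simp: space_PiM space_unif PiE_def Pi_def)

lemma PiM_unif_integral_e_of:
  assumes "finite J"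
  shows "(LINT \<omega>|PiM J (\<lambda>_. unif). e_of (\<Sum>j\<in>J. t j * \<omega> j)) = (\<Prod>j\<in>J. LINT u|unif. e_of (t j * u))"
proof -
  interpret U: prob_space unif by (rule prob_space_unif)
  interpret product_sigma_finite "\<lambda>_. unif" by standard
  have "(LINT \<omega>|PiM J (\<lambda>_. unif). e_of (\<Sum>j\<in>J. t j * \<omega> j))
      = (LINT \<omega>|PiM J (\<lambda>_. unif). (\<Prod>j\<in>J. e_of (t j * \<omega> j)))"
    using assms by (simp add: e_of_sum)
  also have "\<dots> = (\<Prod>j\<in>J. LINT u|unif. e_of (t j * u))"
  proof (rule product_integral_prod[OF assms])
    show "integrable unif (\<lambda>u. e_of (t j * u))" for j
      by (rule U.integrable_const_bound[of _ 1]) (auto intro!: borel_measurable_unif)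
  qed
  finally show ?thesis .
qed

subsection \<open>Periodic bumps\<close>

text \<open>Convolution with the Fejer kernel damps the k-th Fourier coefficient of g by
  \<open>fejer_coeff N k\<close> and removes all frequencies beyond N.\<close>

lemma fejer_mean_expansion:
  fixes g :: "real \<Rightarrow> real"
  assumes [measurable]: "g \<in> borel_measurable borel" and B: "\<And>u. \<bar>g u\<bar> \<le> B"
  shows "complex_of_real (LINT u|unif. g u * fejer N (y - u))
    = (\<Sum>k\<in>{- int N..int N}. complex_of_real (fejer_coeff N k) *
          (LINT u|unif. complex_of_real (g u) * e_of (- (real_of_int k * u))) * e_of (real_of_int k * y))"
proof -
  interpret prob_space unif by (rule prob_space_unif)
  have "complex_of_real (LINT u|unif. g u * fejer N (y - u))
     = (LINT u|unif. complex_of_real (g u) * complex_of_real (fejer N (y - u)))"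
    by (simp flip: integral_complex_of_real)
  also have "\<dots> = (LINT u|unif. (\<Sum>k\<in>{- int N..int N}. complex_of_real (fejer_coeff N k) *
          (complex_of_real (g u) * e_of (- (real_of_int k * u))) * e_of (real_of_int k * y)))"
  proof (rule Bochner_Integration.integral_cong[OF refl])
    fix u
    have "e_of (real_of_int k * (y - u)) = e_of (- (real_of_int k * u)) * e_of (real_of_int k * y)" for k
      by (simp add: algebra_simps flip: e_of_add)
    then show "complex_of_real (g u) * complex_of_real (fejer N (y - u))
       = (\<Sum>k\<in>{- int N..int N}. complex_of_real (fejer_coeff N k) *
          (complex_of_real (g u) * e_of (- (real_of_int k * u))) * e_of (real_of_int k * y))"
      unfolding fejer_expansion sum_distrib_left by (intro sum.cong refl) simp
  qed
  also have "\<dots> = (\<Sum>k\<in>{- int N..int N}. LINT u|unif. complex_of_real (fejer_coeff N k) *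
          (complex_of_real (g u) * e_of (- (real_of_int k * u))) * e_of (real_of_int k * y))"
  proof (rule Bochner_Integration.integral_sum)
    fix k
    show "integrable unif (\<lambda>u. complex_of_real (fejer_coeff N k) *
          (complex_of_real (g u) * e_of (- (real_of_int k * u))) * e_of (real_of_int k * y))"
      using B by (intro integrable_mult_left integrable_mult_right integrable_const_bound[of _ B])
        (auto simp: norm_mult intro!: borel_measurable_unif)
  qed
  also have "\<dots> = (\<Sum>k\<in>{- int N..int N}. complex_of_real (fejer_coeff N k) *
          (LINT u|unif. complex_of_real (g u) * e_of (- (real_of_int k * u))) * e_of (real_of_int k * y))"
    by simp
  finally show ?thesis .
qed

lemma integrable_fejer:
  fixes g :: "real \<Rightarrow> real"
  assumes [measurable]: "g \<in> borel_measurable borel" and B: "\<And>u. \<bar>g u\<bar> \<le> B"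
  shows "integrable unif (\<lambda>u. g u * fejer N (y - u))"
proof -
  interpret prob_space unif by (rule prob_space_unif)
  have "fejer N z \<le> (real N)\<^sup>2 / real N" for z
    unfolding fejer_def
    by (intro divide_right_mono power_mono order.trans[OF norm_sum]) auto
  then have "norm (g u * fejer N (y - u)) \<le> B * ((real N)\<^sup>2 / real N)" for u
    unfolding norm_mult using B[of u] fejer_nonneg[of N "y - u"]
    by (intro mult_mono) auto
  then show ?thesis
    by (intro integrable_const_bound[of _ "B * ((real N)\<^sup>2 / real N)"]) (auto intro!: borel_measurable_unif)
qed

lemma fejer_integral:
  assumes "N > 0"
  shows "(LINT u|unif. fejer N (y - u)) = 1"
proof -
  interpret prob_space unif by (rule prob_space_unif)
  have z: "(LINT u|unif. e_of (- (real_of_int k * u))) = (if k = 0 then 1 else 0)" for k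
    using unif_integral_e_of_int[of "- k"] by (auto simp: prob_space)
  have "complex_of_real (LINT u|unif. 1 * fejer N (y - u)) = 1"
    using assms by (subst fejer_mean_expansion[of _ 1])
      (auto simp: z if_distrib[of "\<lambda>x. _ * x"] if_distrib[of "\<lambda>x. x * _"] fejer_coeff_0 cong: if_cong)
  then have "(LINT u|unif. 1 * fejer N (y - u)) = 1" by (simp only: of_real_eq_1_iff)
  then show ?thesis by simp
qed

text \<open>The Lipschitz condition is stated in the chordal distance on the circle, which is the
  factor that \<open>fejer_decay\<close> controls. The first moment of the kernel is then
  O(N^(-1/2)) by AM-GM between its mass 1 and its second moment, at most 4/N.\<close>

lemma fejer_mean_approx:
  fixes g :: "real \<Rightarrow> real"
  assumes [measurable]: "g \<in> borel_measurable borel" and B: "\<And>u. \<bar>g u\<bar> \<le> B"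
    and L: "\<And>u v. \<bar>g u - g v\<bar> \<le> norm (e_of u - e_of v)" and N: "N > 0"
  shows "\<bar>(LINT u|unif. g u * fejer N (y - u)) - g y\<bar> \<le> 5 / (2 * sqrt (real N))"
proof -
  interpret prob_space unif by (rule prob_space_unif)
  have int: "integrable unif (\<lambda>u. (g u - g y) * fejer N (y - u))"
    using B by (intro integrable_fejer[of _ "2 * B"]) (auto intro: order.trans[OF abs_triangle_ineq4] simp: add_mono[of _ B _ B, simplified])
  have int1: "integrable unif (\<lambda>u. fejer N (y - u))"
    using integrable_fejer[of "\<lambda>_. 1" 1 N y] by simp
  have "(LINT u|unif. g u * fejer N (y - u)) - g y
      = (LINT u|unif. g u * fejer N (y - u)) - (LINT u|unif. g y * fejer N (y - u))"
    using fejer_integral[OF N] by simp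
  also have "\<dots> = (LINT u|unif. (g u - g y) * fejer N (y - u))"
    using integrable_fejer[of g B N y] B int1 by (simp add: left_diff_distrib)
  finally have "\<bar>(LINT u|unif. g u * fejer N (y - u)) - g y\<bar>
      = norm (LINT u|unif. (g u - g y) * fejer N (y - u))" by simp
  also have "\<dots> \<le> (LINT u|unif. norm ((g u - g y) * fejer N (y - u)))" by (rule integral_norm_bound)
  also have "\<dots> \<le> (LINT u|unif. 2 / sqrt (real N) + fejer N (y - u) / (2 * sqrt (real N)))"
  proof (rule integral_mono)
    show "integrable unif (\<lambda>u. norm ((g u - g y) * fejer N (y - u)))" using int by simp
    show "integrable unif (\<lambda>u. 2 / sqrt (real N) + fejer N (y - u) / (2 * sqrt (real N)))"
      using int1 by simp
    fix u
    define w where "w = norm (1 - e_of (y - u))"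
    define s where "s = sqrt (real N)"
    have s: "s > 0" "s\<^sup>2 = real N" using N by (auto simp: s_def)
    have "e_of u - e_of y = e_of u * (1 - e_of (y - u))"
      by (simp add: algebra_simps flip: e_of_add)
    then have "norm (e_of u - e_of y) = w" by (simp add: norm_mult w_def)
    then have "\<bar>g u - g y\<bar> \<le> w" using L[of u y] by simp
    then have "norm ((g u - g y) * fejer N (y - u)) \<le> w * fejer N (y - u)"
      by (simp add: abs_mult fejer_nonneg mult_right_mono)
    \<comment> \<open>AM-GM: \<open>2 w \<le> s w\<^sup>2 + 1 / s\<close>\<close>
    also have "w \<le> (s * w\<^sup>2 + 1 / s) / 2"
    proof -
      have "0 \<le> (s * w - 1)\<^sup>2 / s" using s by simp
      also have "\<dots> = s * w\<^sup>2 + 1 / s - 2 * w" using s by (simp add: power2_eq_square field_simps)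
      finally show ?thesis by simp
    qed
    then have "w * fejer N (y - u) \<le> (s * w\<^sup>2 + 1 / s) / 2 * fejer N (y - u)"
      by (intro mult_right_mono fejer_nonneg)
    also have "\<dots> = s / 2 * (w\<^sup>2 * fejer N (y - u)) + fejer N (y - u) / (2 * s)"
      by (simp add: algebra_simps add_divide_distrib)
    also have "s / 2 * (w\<^sup>2 * fejer N (y - u)) \<le> s / 2 * (4 / real N)"
      using fejer_decay[OF N, of "y - u"] s unfolding w_def by (intro mult_left_mono) auto
    also have "s / 2 * (4 / real N) = 2 / s" using s by (simp add: s(2)[symmetric] power2_eq_square)
    finally show "norm ((g u - g y) * fejer N (y - u)) \<le> 2 / sqrt (real N) + fejer N (y - u) / (2 * sqrt (real N))"
      by (simp add: s_def)
  qed
  also have "\<dots> = 2 / sqrt (real N) + 1 / (2 * sqrt (real N))"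
    using int1 fejer_integral[OF N, of y] by (simp add: prob_space)
  also have "\<dots> = 5 / (2 * sqrt (real N))" by (simp add: add_divide_distrib[symmetric] field_simps)
  finally show ?thesis .
qed

text \<open>The cosine serves as a continuous periodic substitute for the distance to the nearest
  integer. The bound d <= 1/2 keeps both angles in [0, pi], where it is decreasing.\<close>

lemma cos_near_one_imp_near_integer:
  assumes d: "0 \<le> d" "d \<le> 1/2" and c: "cos (2 * pi * y) \<ge> cos (2 * pi * d)"
  shows "\<exists>r::int. \<bar>y - real_of_int r\<bar> \<le> d"
proof -
  define r where "r = round y"
  have r: "\<bar>y - of_int r\<bar> \<le> 1/2" unfolding r_def using of_int_round_abs_le[of y] by linarith
  have "cos (2 * pi * \<bar>y - of_int r\<bar>) = cos (2 * pi * y)"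
  proof -
    have "cos (2 * pi * \<bar>y - of_int r\<bar>) = cos \<bar>2 * pi * (y - of_int r)\<bar>" by (simp only: abs_mult) simp
    also have "\<dots> = Re (e_of (y - of_int r))" by (simp add: e_of_def)
    also have "e_of (y - of_int r) = e_of y" using e_of_diff[of y "of_int r"] e_of_int[of "- r"] by simp
    finally show ?thesis by (simp add: e_of_def)
  qed
  then have "cos (2 * pi * d) \<le> cos (2 * pi * \<bar>y - of_int r\<bar>)" using c by simp
  then have "2 * pi * \<bar>y - of_int r\<bar> \<le> 2 * pi * d"
    using r d by (subst (asm) cos_mono_le_eq) auto
  then show ?thesis by (intro exI[of _ r]) simp
qed

lemma near_integer_imp_cos_near_one:
  assumes d: "0 \<le> d" "d \<le> 1/2" and r: "\<bar>y - real_of_int r\<bar> \<le> d"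
  shows "cos (2 * pi * y) \<ge> cos (2 * pi * d)"
proof -
  have "e_of (y - of_int r) = e_of y" using e_of_diff[of y "of_int r"] e_of_int[of "- r"] by simp
  then have "cos (2 * pi * y) = Re (e_of (y - of_int r))" by (simp add: e_of_def)
  also have "\<dots> = cos \<bar>2 * pi * (y - of_int r)\<bar>" by (simp add: e_of_def)
  also have "\<dots> = cos (2 * pi * \<bar>y - of_int r\<bar>)" by (simp only: abs_mult) simp
  finally have e: "cos (2 * pi * y) = cos (2 * pi * \<bar>y - of_int r\<bar>)" .
  have "2 * pi * \<bar>y - of_int r\<bar> \<le> 2 * pi * d" using r by simp
  then show ?thesis unfolding e using d by (intro cos_monotone_0_pi_le) auto
qed

text \<open>Convolving a continuous bump with \<open>M\<close> uniform distributions on \<open>[0, \<delta>]\<close> multiplies the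
  \<open>k\<close>-th Fourier coefficient by a factor that is \<open>O((\<delta> \<bar>k\<bar>)\<^sup>-\<^sup>M)\<close> and enlarges the support by \<open>M \<delta>\<close>.
  The Fejer means of the bump supply the coefficients \<open>c n\<close>.\<close>

lemma periodic_bump:
  fixes \<delta> :: real and M :: nat
  assumes \<delta>: "0 < \<delta>" "\<delta> < 1/2"
  obtains f :: "real \<Rightarrow> real" and c :: "nat \<Rightarrow> int \<Rightarrow> complex" and B :: real
  where "continuous_on UNIV f" "\<And>y. 0 \<le> f y" "\<And>y. f y \<le> B"
    "\<And>y. f y \<noteq> 0 \<Longrightarrow> \<exists>r::int. \<bar>y - real_of_int r\<bar> \<le> real (Suc M) * \<delta>"
    "\<And>n. c n 0 = 1" "\<And>n k. norm (c n k) \<le> 1"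
    "\<And>n k. k \<noteq> 0 \<Longrightarrow> norm (c n k) \<le> (1 / (pi * \<delta> * \<bar>real_of_int k\<bar>)) ^ M"
    "\<And>y. (\<lambda>n. \<Sum>k\<in>{- int (Suc n)..int (Suc n)}. c n k * e_of (real_of_int k * y)) \<longlonglongrightarrow> complex_of_real (f y)"
    "\<And>n y. norm (\<Sum>k\<in>{- int (Suc n)..int (Suc n)}. c n k * e_of (real_of_int k * y)) \<le> B"
proof -
  interpret U: prob_space unif by (rule prob_space_unif)
  \<comment> \<open>The truncated cosine vanishes farther than \<open>\<delta>\<close> from the
    integers and is Lipschitz in the chordal distance, as \<open>fejer_mean_approx\<close>
    requires.\<close>
  define f0 where "f0 y = max 0 (cos (2 * pi * y) - cos (2 * pi * \<delta>))" for y :: real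
  have cf0: "continuous_on UNIV f0" unfolding f0_def by (intro continuous_intros)
  have m0[measurable]: "f0 \<in> borel_measurable borel"
    using cf0 by (rule borel_measurable_continuous_onI)
  have f0_nonneg: "0 \<le> f0 y" for y by (simp add: f0_def)
  have f0_2: "f0 y \<le> 2" for y
    unfolding f0_def using cos_le_one[of "2 * pi * y"] cos_ge_minus_one[of "2 * pi * \<delta>"] by linarith
  have f0_abs: "\<bar>f0 y\<bar> \<le> 2" for y using f0_nonneg[of y] f0_2[of y] by simp
  have L: "\<bar>f0 u - f0 v\<bar> \<le> norm (e_of u - e_of v)" for u v
  proof -
    have "\<bar>f0 u - f0 v\<bar> \<le> \<bar>cos (2 * pi * u) - cos (2 * pi * v)\<bar>" unfolding f0_def by linarith
    also have "\<dots> = \<bar>Re (e_of u - e_of v)\<bar>" by (simp add: e_of_def)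
    also have "\<dots> \<le> norm (e_of u - e_of v)" by (rule abs_Re_le_cmod)
    finally show ?thesis .
  qed
  have int0: "integrable unif f0"
    using f0_abs by (intro U.integrable_const_bound[of _ 2]) (auto intro!: borel_measurable_unif)
  define a0 where "a0 = (LINT u|unif. f0 u)"
  have a0: "a0 > 0"
  proof -
    \<comment> \<open>\<open>\<eta>\<close> is a lower bound for \<open>f0\<close> on
      [0, \<open>\<delta>\<close>/2], so the mean of \<open>f0\<close> is positive and can be
      divided out.\<close>
    define \<eta> where "\<eta> = cos (pi * \<delta>) - cos (2 * pi * \<delta>)"
    have "cos (2 * pi * \<delta>) < cos (pi * \<delta>)"
      using \<delta> by (intro cos_monotone_0_pi) auto
    then have \<eta>: "\<eta> > 0" by (simp add: \<eta>_def)
    have le: "\<eta> * indicator {0..\<delta>/2} u \<le> f0 u" for u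
    proof (cases "u \<in> {0..\<delta>/2}")
      case True
      then have "pi * (2 * u) \<le> pi * \<delta>" by (intro mult_left_mono) auto
      then have "cos (pi * \<delta>) \<le> cos (2 * pi * u)"
        using True \<delta> by (intro cos_monotone_0_pi_le) auto
      then show ?thesis using True by (simp add: f0_def \<eta>_def)
    qed (simp add: f0_nonneg)
    have "measure unif {0..\<delta>/2} = \<delta>/2"
      using \<delta> by (simp add: unif_def measure_restrict_space)
    moreover have "{0..\<delta>/2} \<in> sets unif"
      using \<delta> by (auto simp: unif_def sets_restrict_space intro!: image_eqI[of _ _ "{0..\<delta>/2}"])
    ultimately have "\<eta> * (\<delta>/2) = (LINT u|unif. \<eta> * indicator {0..\<delta>/2} u)"
      by simp
    also have "\<dots> \<le> a0" unfolding a0_def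
      using le \<open>{0..\<delta>/2} \<in> sets unif\<close> by (intro integral_mono int0) (auto simp: U.emeasure_eq_measure)
    finally show ?thesis using \<eta> \<delta> by (smt (verit) mult_pos_pos half_gt_zero)
  qed
  define a where "a k = (LINT u|unif. complex_of_real (f0 u) * e_of (- (real_of_int k * u)))" for k :: int
  have a_0: "a 0 = complex_of_real a0" by (simp add: a_def a0_def)
  have a_le: "norm (a k) \<le> a0" for k
  proof -
    have "norm (a k) \<le> (LINT u|unif. norm (complex_of_real (f0 u) * e_of (- (real_of_int k * u))))"
      unfolding a_def by (rule integral_norm_bound)
    also have "\<dots> = a0" by (simp add: norm_mult a0_def f0_nonneg)
    finally show ?thesis .
  qed
  define W where "W = PiM {..<M} (\<lambda>_. unif)"
  interpret W: prob_space W unfolding W_def by (rule prob_space_PiM_unif)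
  \<comment> \<open>The repeated convolution is realised as the mean of
    \<open>f0 (y - S \<omega>)\<close> over \<open>M\<close> independent uniform variables.
    Independence turns its effect on the k-th coefficient into the M-th power \<open>uh k\<close>,
    and the range of \<open>S\<close> gives the enlargement of the support.\<close>
  define S where "S \<omega> = \<delta> * (\<Sum>j<M. \<omega> j)" for \<omega> :: "nat \<Rightarrow> real"
  have mS[measurable]: "S \<in> borel_measurable W"
    unfolding S_def W_def by measurable
  have S_range: "0 \<le> S \<omega>" "S \<omega> \<le> \<delta> * M" if "\<omega> \<in> space W" for \<omega>
  proof -
    have r: "0 \<le> \<omega> j" "\<omega> j \<le> 1" if "j < M" for j
      using PiM_unif_range[of \<omega> "{..<M}" j] that \<open>\<omega> \<in> space W\<close> unfolding W_def by auto
    show "0 \<le> S \<omega>" using r \<delta> unfolding S_def by (intro mult_nonneg_nonneg sum_nonneg) auto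
    have "(\<Sum>j<M. \<omega> j) \<le> M" using sum_mono[of "{..<M}" \<omega> "\<lambda>_. 1"] r by simp
    then show "S \<omega> \<le> \<delta> * M" using \<delta> unfolding S_def by (intro mult_left_mono) auto
  qed
  define P where "P N y = (LINT u|unif. f0 u * fejer N (y - u))" for N y
  define Pc where "Pc N y = (\<Sum>k\<in>{- int N..int N}. complex_of_real (fejer_coeff N k) * a k * e_of (real_of_int k * y))" for N y
  have P_Pc: "complex_of_real (P N y) = Pc N y" for N y
    unfolding P_def Pc_def a_def using f0_abs by (rule fejer_mean_expansion[OF m0])
  have Pcm[measurable]: "Pc N \<in> borel_measurable borel" for N
    unfolding Pc_def by measurable
  have Pm[measurable]: "P N \<in> borel_measurable borel" for N
  proof -
    have "P N = (\<lambda>y. Re (Pc N y))" using P_Pc by (metis Re_complex_of_real)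
    then show ?thesis by simp
  qed
  have P_approx: "\<bar>P (Suc n) y - f0 y\<bar> \<le> 5 / (2 * sqrt (real (Suc n)))" for n y
    unfolding P_def by (rule fejer_mean_approx[OF m0 f0_abs L]) auto
  have e3: "5 / (2 * sqrt (real (Suc n))) \<le> 5/2" for n
    by (auto simp: field_simps)
  have P_bound: "\<bar>P (Suc n) y\<bar> \<le> 9/2" for n y
    using P_approx[of n y] e3[of n] f0_abs[of y] by linarith
  define uh where "uh k = (LINT u|unif. e_of ((- real_of_int k * \<delta>) * u)) ^ M" for k :: int
  have uh_1: "norm (uh k) \<le> 1" for k
    unfolding uh_def norm_power by (intro power_le_one unif_integral_e_of_bound) auto
  have uh_M: "norm (uh k) \<le> (1 / (pi * \<delta> * \<bar>real_of_int k\<bar>)) ^ M" if "k \<noteq> 0" for k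
    unfolding uh_def norm_power using unif_integral_e_of_bound(2)[of "- real_of_int k * \<delta>"] \<delta> that
    by (intro power_mono) (auto simp: abs_mult mult_ac)
  have uh_0: "uh 0 = 1" by (simp add: uh_def U.prob_space)
  define f where "f y = (LINT \<omega>|W. f0 (y - S \<omega>)) / a0" for y
  \<comment> \<open>Division by \<open>a0\<close> normalises the mean to 1. Setting the coefficients
    to 0 outside the window makes the bounds valid for all k.\<close>
  define c where "c n k = (if k \<in> {- int (Suc n)..int (Suc n)} then
      complex_of_real (fejer_coeff (Suc n) k) * (a k / complex_of_real a0) * uh k else 0)" for n k
  define p where "p n y = (\<Sum>k\<in>{- int (Suc n)..int (Suc n)}. c n k * e_of (real_of_int k * y))" for n y
  have p_eq: "p n y = complex_of_real ((LINT \<omega>|W. P (Suc n) (y - S \<omega>)) / a0)" for n y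
  proof -
    let ?K = "{- int (Suc n)..int (Suc n)}"
    have "complex_of_real (LINT \<omega>|W. P (Suc n) (y - S \<omega>)) = (LINT \<omega>|W. Pc (Suc n) (y - S \<omega>))"
      by (simp flip: integral_complex_of_real P_Pc)
    also have "\<dots> = (\<Sum>k\<in>?K. LINT \<omega>|W. complex_of_real (fejer_coeff (Suc n) k) * a k * e_of (real_of_int k * (y - S \<omega>)))"
      unfolding Pc_def
    proof (rule Bochner_Integration.integral_sum)
      fix k
      have "integrable W (\<lambda>\<omega>. e_of (real_of_int k * (y - S \<omega>)))"
        by (rule W.integrable_const_bound[of _ 1]) auto
      then show "integrable W (\<lambda>\<omega>. complex_of_real (fejer_coeff (Suc n) k) * a k * e_of (real_of_int k * (y - S \<omega>)))"
        by simp
    qed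
    also have "\<dots> = (\<Sum>k\<in>?K. complex_of_real (fejer_coeff (Suc n) k) * a k * (uh k * e_of (real_of_int k * y)))"
    proof (rule sum.cong[OF refl])
      fix k
      have "e_of (real_of_int k * (y - S \<omega>)) = e_of (\<Sum>j<M. (- real_of_int k * \<delta>) * \<omega> j) * e_of (real_of_int k * y)" for \<omega>
        unfolding S_def sum_distrib_left[symmetric] by (simp add: algebra_simps flip: e_of_add)
      then have "(LINT \<omega>|W. e_of (real_of_int k * (y - S \<omega>)))
         = (LINT \<omega>|W. e_of (\<Sum>j<M. (- real_of_int k * \<delta>) * \<omega> j)) * e_of (real_of_int k * y)"
        by simp
      also have "(LINT \<omega>|W. e_of (\<Sum>j<M. (- real_of_int k * \<delta>) * \<omega> j)) = uh k"
        unfolding W_def uh_def by (subst PiM_unif_integral_e_of) auto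
      finally show "(LINT \<omega>|W. complex_of_real (fejer_coeff (Suc n) k) * a k * e_of (real_of_int k * (y - S \<omega>)))
         = complex_of_real (fejer_coeff (Suc n) k) * a k * (uh k * e_of (real_of_int k * y))"
        by simp
    qed
    also have "\<dots> = complex_of_real a0 * p n y"
      using a0 unfolding p_def sum_distrib_left by (intro sum.cong refl) (simp add: c_def)
    finally show ?thesis using a0 by (simp add: field_simps)
  qed
  have intP: "integrable W (\<lambda>\<omega>. P (Suc n) (y - S \<omega>))" for n y
    using P_bound by (intro W.integrable_const_bound[of _ "9/2"]) auto
  have intf: "integrable W (\<lambda>\<omega>. f0 (y - S \<omega>))" for y
    using f0_abs by (intro W.integrable_const_bound[of _ 2]) auto
  have approx: "norm (p n y - complex_of_real (f y)) \<le> 5 / (2 * sqrt (real (Suc n))) / a0" for n y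
  proof -
    have "\<bar>(LINT \<omega>|W. P (Suc n) (y - S \<omega>)) - (LINT \<omega>|W. f0 (y - S \<omega>))\<bar>
       = norm (LINT \<omega>|W. P (Suc n) (y - S \<omega>) - f0 (y - S \<omega>))"
      using intP intf by simp
    also have "\<dots> \<le> (LINT \<omega>|W. norm (P (Suc n) (y - S \<omega>) - f0 (y - S \<omega>)))" by (rule integral_norm_bound)
    also have "\<dots> \<le> (LINT \<omega>|W. 5 / (2 * sqrt (real (Suc n))))"
    proof (rule integral_mono)
      show "integrable W (\<lambda>\<omega>. norm (P (Suc n) (y - S \<omega>) - f0 (y - S \<omega>)))"
        using intP intf by (intro integrable_norm Bochner_Integration.integrable_diff)
      show "norm (P (Suc n) (y - S \<omega>) - f0 (y - S \<omega>)) \<le> 5 / (2 * sqrt (real (Suc n)))" for \<omega>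
        unfolding real_norm_def by (rule P_approx)
    qed simp
    also have "\<dots> = 5 / (2 * sqrt (real (Suc n)))" by (simp add: W.prob_space)
    finally have *: "\<bar>(LINT \<omega>|W. P (Suc n) (y - S \<omega>)) - (LINT \<omega>|W. f0 (y - S \<omega>))\<bar> / a0
        \<le> 5 / (2 * sqrt (real (Suc n))) / a0"
      using a0 by (intro divide_right_mono) auto
    have "p n y - complex_of_real (f y)
        = complex_of_real (((LINT \<omega>|W. P (Suc n) (y - S \<omega>)) - (LINT \<omega>|W. f0 (y - S \<omega>))) / a0)"
      unfolding p_eq f_def by (simp add: diff_divide_distrib)
    then have "norm (p n y - complex_of_real (f y)) = \<bar>(LINT \<omega>|W. P (Suc n) (y - S \<omega>)) - (LINT \<omega>|W. f0 (y - S \<omega>))\<bar> / a0"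
      using a0 by (simp only: norm_of_real abs_divide)
    with * show ?thesis by simp
  qed
  have lim0: "(\<lambda>n. 5 / (2 * sqrt (real (Suc n))) / a0) \<longlonglongrightarrow> 0"
  proof -
    have "(\<lambda>n. 5 / (2 * a0) * sqrt (inverse (real (Suc n)))) \<longlonglongrightarrow> 5 / (2 * a0) * sqrt 0"
      by (intro tendsto_intros LIMSEQ_inverse_real_of_nat)
    moreover have "5 / (2 * a0) * sqrt (inverse (real (Suc n))) = 5 / (2 * sqrt (real (Suc n))) / a0" for n
      unfolding real_sqrt_inverse by (simp only: divide_inverse inverse_mult_distrib mult_ac)
    ultimately show ?thesis by (simp only: real_sqrt_zero mult_zero_right)
  qed
  have f_nonneg: "0 \<le> f y" for y
    unfolding f_def using f0_nonneg a0 by (intro divide_nonneg_nonneg integral_nonneg_AE) auto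
  have f_le: "f y \<le> 2 / a0" for y
  proof -
    have "(LINT \<omega>|W. f0 (y - S \<omega>)) \<le> (LINT \<omega>|W. 2)"
      using intf f0_2 by (intro integral_mono) auto
    then show ?thesis using a0 unfolding f_def by (intro divide_right_mono) (auto simp: W.prob_space)
  qed
  show thesis
  proof (rule that[of f "5 / a0" c])
    \<comment> \<open>Continuity of \<open>f\<close> comes from uniform approximation by
      trigonometric polynomials.\<close>
    have "uniform_limit UNIV p (\<lambda>y. complex_of_real (f y)) sequentially"
    proof (rule uniform_limitI)
      fix e :: real assume "e > 0"
      then have "eventually (\<lambda>n. 5 / (2 * sqrt (real (Suc n))) / a0 < e) sequentially"
        using lim0 by (rule order_tendstoD(2)[rotated])
      then show "\<forall>\<^sub>F n in sequentially. \<forall>x\<in>UNIV. dist (p n x) (complex_of_real (f x)) < e"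
        by eventually_elim (use approx in \<open>auto simp: dist_norm intro: le_less_trans\<close>)
    qed
    then have "continuous_on UNIV (\<lambda>y. complex_of_real (f y))"
    proof (rule uniform_limit_theorem[rotated])
      show "\<forall>\<^sub>F n in sequentially. continuous_on UNIV (p n)"
        unfolding p_def by (intro always_eventually allI continuous_intros)
    qed simp
    then have "continuous_on UNIV (\<lambda>y. Re (complex_of_real (f y)))" by (rule continuous_on_Re)
    then show "continuous_on UNIV f" by simp
    \<comment> \<open>One constant must bound \<open>f\<close> and all its approximations:
      \<open>f\<close> is at most 2/a0 and the error at most (5/2)/a0.\<close>
    show "f y \<le> 5 / a0" for y using f_le[of y] a0 by (smt (verit) divide_right_mono)
    show "\<exists>r::int. \<bar>y - real_of_int r\<bar> \<le> real (Suc M) * \<delta>" if "f y \<noteq> 0" for y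
    proof -
      have "\<exists>\<omega>\<in>space W. f0 (y - S \<omega>) \<noteq> 0"
      proof (rule ccontr)
        assume "\<not> ?thesis"
        then have "(LINT \<omega>|W. f0 (y - S \<omega>)) = (LINT \<omega>|W. 0)"
          by (intro Bochner_Integration.integral_cong) auto
        then show False using that by (simp add: f_def)
      qed
      then obtain \<omega> where \<omega>: "\<omega> \<in> space W" "f0 (y - S \<omega>) \<noteq> 0" by blast
      then have "cos (2 * pi * (y - S \<omega>)) \<ge> cos (2 * pi * \<delta>)" by (auto simp: f0_def max_def split: if_splits)
      then obtain r :: int where "\<bar>y - S \<omega> - real_of_int r\<bar> \<le> \<delta>"
        using cos_near_one_imp_near_integer[of \<delta> "y - S \<omega>"] \<delta> by auto
      moreover have "0 \<le> S \<omega>" "S \<omega> \<le> \<delta> * M" using S_range \<omega>(1) by auto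
      ultimately show ?thesis by (intro exI[of _ r]) (auto simp: algebra_simps)
    qed
    show "c n 0 = 1" for n using a0 by (simp add: c_def fejer_coeff_0 a_0 uh_0)
    have na: "norm (complex_of_real (fejer_coeff (Suc n) k) * (a k / complex_of_real a0)) \<le> 1"
      if "k \<in> {- int (Suc n)..int (Suc n)}" for n k
      using fejer_coeff_bounds[OF _ that] a_le[of k] a0
      unfolding norm_mult norm_divide norm_of_real by (intro mult_le_one) auto
    show "norm (c n k) \<le> 1" for n k
    proof (cases "k \<in> {- int (Suc n)..int (Suc n)}")
      case True
      then show ?thesis
        unfolding c_def if_P[OF True] norm_mult[of _ "uh k"] using uh_1 by (intro mult_le_one na) auto
    qed (auto simp: c_def)
    show "norm (c n k) \<le> (1 / (pi * \<delta> * \<bar>real_of_int k\<bar>)) ^ M" if "k \<noteq> 0" for n k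
    proof (cases "k \<in> {- int (Suc n)..int (Suc n)}")
      case True
      then have "norm (c n k) \<le> 1 * norm (uh k)"
        unfolding c_def if_P[OF True] norm_mult[of _ "uh k"] using na by (intro mult_right_mono) auto
      then show ?thesis using uh_M[OF that] by simp
    next
      case False
      then show ?thesis using \<delta> by (auto simp: c_def)
    qed
    show "(\<lambda>n. \<Sum>k\<in>{- int (Suc n)..int (Suc n)}. c n k * e_of (real_of_int k * y)) \<longlonglongrightarrow> complex_of_real (f y)" for y
      unfolding p_def[symmetric]
      by (rule LIM_zero_cancel[OF Lim_null_comparison[OF always_eventually lim0]]) (use approx in blast)
    show "norm (\<Sum>k\<in>{- int (Suc n)..int (Suc n)}. c n k * e_of (real_of_int k * y)) \<le> 5 / a0" for n y
    proof -
      have "norm (p n y) \<le> norm (p n y - complex_of_real (f y)) + norm (complex_of_real (f y))"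
        by (metis add.commute diff_add_cancel norm_triangle_ineq)
      also have "\<dots> \<le> (5/2) / a0 + 2 / a0"
      proof (rule add_mono)
        show "norm (p n y - complex_of_real (f y)) \<le> (5/2) / a0"
          using approx[of n y] divide_right_mono[OF e3[of n], of a0] a0 by linarith
        show "norm (complex_of_real (f y)) \<le> 2 / a0" using f_le[of y] f_nonneg[of y] by simp
      qed
      also have "\<dots> \<le> 5 / a0" using a0 by (simp add: field_simps)
      finally show ?thesis by (simp add: p_def)
    qed
  qed (rule f_nonneg)
qed

subsection \<open>The divisor bound\<close>

text \<open>The products p^i d with i <= e and d dividing m exhaust the divisors; p may divide m, as
  only surjectivity enters.\<close>

lemma card_divisors_prime_power_mult:
  fixes p m e :: nat
  assumes "prime p" "m > 0"
  shows "card {d. d dvd p ^ e * m} \<le> Suc e * card {d. d dvd m}"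
proof -
  have "{d. d dvd p ^ e * m} \<subseteq> (\<lambda>(i, d). p ^ i * d) ` ({..e} \<times> {d. d dvd m})"
  proof
    fix d assume "d \<in> {d. d dvd p ^ e * m}"
    then obtain x y where xy: "d = x * y" "x dvd p ^ e" "y dvd m"
      using dvd_productE[of d "p ^ e" m] by auto
    then obtain i where "i \<le> e" "x = p ^ i" using divides_primepow_nat[OF assms(1)] by blast
    with xy show "d \<in> (\<lambda>(i, d). p ^ i * d) ` ({..e} \<times> {d. d dvd m})"
      by (intro image_eqI[of _ _ "(i, y)"]) auto
  qed
  moreover have fin: "finite {d. d dvd m}" using assms(2) by simp
  ultimately have "card {d. d dvd p ^ e * m} \<le> card ({..e} \<times> {d. d dvd m})"
    by (intro surj_card_le) auto
  then show ?thesis by (simp add: card_cartesian_product)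
qed

text \<open>Strong induction that strips the full power p^e of one prime. It multiplies the divisor
  count by at most e + 1, which p^(e eps) outweighs once p^eps >= 2. A smaller prime costs an
  additional factor A, but only once per prime below p0.\<close>

lemma divisor_bound_aux:
  fixes \<epsilon> A :: real and p0 n :: nat
  assumes "\<epsilon> > 0" "A \<ge> 1" and A: "\<And>e::nat. real e + 1 \<le> A * 2 powr (real e * \<epsilon>)"
    and p0: "real p0 powr \<epsilon> \<ge> 2" and n: "n > 0"
  shows "real (card {d. d dvd n}) \<le> A ^ card {p. prime p \<and> p < p0 \<and> p dvd n} * real n powr \<epsilon>"
  using n
proof (induction n rule: less_induct)
  case (less n)
  show ?case
  proof (cases "n = 1")
    case True
    then show ?thesis using assms by (simp add: dvd_1_iff_1 not_prime_1 cong: conj_cong)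
  next
    case False
    then obtain p where p: "prime p" "p dvd n" using prime_factor_nat by blast
    obtain e m where em: "n = p ^ e * m" "\<not> p dvd m"
      using multiplicity_decompose'[of n p] less.prems p(1) by (metis not_gr_zero not_prime_unit)
    have m: "m > 0" using em less.prems by (metis gr0I mult_0_right)
    have "e > 0" using em p by (cases e) auto
    have p2: "p \<ge> 2" using p(1) prime_ge_2_nat by blast
    have "m < n" using em(1) m \<open>e > 0\<close> p2 one_less_power[of p e] by (simp add: )
    let ?S = "\<lambda>n. {p. prime p \<and> p < p0 \<and> p dvd n}"
    have pw: "real n powr \<epsilon> = (real p powr \<epsilon>) ^ e * real m powr \<epsilon>"
      unfolding em(1) using p2 by (simp add: powr_mult powr_power flip: powr_realpow) (simp add: powr_powr mult.commute powr_realpow[symmetric])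
    have d: "real (card {d. d dvd n}) \<le> real (Suc e) * real (card {d. d dvd m})"
      using card_divisors_prime_power_mult[OF p(1) m, of e] em(1) by (metis of_nat_le_iff of_nat_mult)
    have IH: "real (card {d. d dvd m}) \<le> A ^ card (?S m) * real m powr \<epsilon>"
      using less.IH[OF \<open>m < n\<close> m] .
    have fin: "finite (?S n)" by simp
    have sub: "?S m \<subseteq> ?S n" using em(1) by auto
    show ?thesis
    proof (cases "p < p0")
      case True
      have "insert p (?S m) \<subseteq> ?S n" using True p sub by auto
      then have "card (insert p (?S m)) \<le> card (?S n)" using fin by (rule card_mono[rotated])
      moreover have "p \<notin> ?S m" using em by auto
      ultimately have c: "Suc (card (?S m)) \<le> card (?S n)" by simp
      have "2 powr (real e * \<epsilon>) \<le> (real p powr \<epsilon>) ^ e"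
      proof -
        have "2 powr (real e * \<epsilon>) = (2 powr \<epsilon>) ^ e" by (simp add: powr_power mult.commute)
        also have "\<dots> \<le> (real p powr \<epsilon>) ^ e" using p2 assms by (intro power_mono powr_mono2) auto
        finally show ?thesis .
      qed
      then have "real (Suc e) \<le> A * (real p powr \<epsilon>) ^ e"
        using A[of e] assms(2) by (smt (verit) mult_left_mono of_nat_Suc)
      then have "real (Suc e) * real (card {d. d dvd m}) \<le> A * (real p powr \<epsilon>) ^ e * (A ^ card (?S m) * real m powr \<epsilon>)"
        using IH assms(2) by (intro mult_mono) auto
      also have "\<dots> = A ^ Suc (card (?S m)) * real n powr \<epsilon>" by (simp add: pw)
      also have "\<dots> \<le> A ^ card (?S n) * real n powr \<epsilon>"
        using c assms(2) by (intro mult_right_mono power_increasing) auto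
      finally show ?thesis using d by linarith
    next
      case False
      have "2 \<le> real p powr \<epsilon>" using p0 False assms(1) powr_mono2[of \<epsilon> "real p0" "real p"] by simp
      then have "2 ^ e \<le> (real p powr \<epsilon>) ^ e" by (intro power_mono) auto
      moreover have "real (Suc e) \<le> 2 ^ e" by (metis Suc_leI less_exp of_nat_le_iff of_nat_numeral of_nat_power)
      ultimately have "real (Suc e) \<le> (real p powr \<epsilon>) ^ e" by linarith
      then have "real (Suc e) * real (card {d. d dvd m}) \<le> (real p powr \<epsilon>) ^ e * (A ^ card (?S m) * real m powr \<epsilon>)"
        using IH by (intro mult_mono) auto
      also have "\<dots> = A ^ card (?S m) * real n powr \<epsilon>" by (simp add: pw)
      also have "\<dots> \<le> A ^ card (?S n) * real n powr \<epsilon>"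
        using card_mono[OF fin sub] assms(2) by (intro mult_right_mono power_increasing) auto
      finally show ?thesis using d by linarith
    qed
  qed
qed

lemma divisor_bound:
  fixes \<epsilon> :: real
  assumes "\<epsilon> > 0"
  obtains C where "C > 0" "\<And>n::nat. n > 0 \<Longrightarrow> real (card {d. d dvd n}) \<le> C * real n powr \<epsilon>"
proof -
  \<comment> \<open>From 2^(e eps) >= 1 + e eps ln 2 one gets e <= 2^(e eps) / (eps ln 2); the
    additional 1 pays for the 1 in e + 1.\<close>
  define A where "A = 1 + 1 / (\<epsilon> * ln 2)"
  have A1: "A \<ge> 1" using assms by (simp add: A_def)
  have A: "real e + 1 \<le> A * 2 powr (real e * \<epsilon>)" for e :: nat
  proof -
    have "2 powr (real e * \<epsilon>) \<ge> 1 + real e * \<epsilon> * ln 2"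
      using exp_ge_add_one_self[of "real e * \<epsilon> * ln 2"] by (simp add: powr_def)
    moreover have "0 < \<epsilon> * ln 2" using assms by simp
    ultimately have 1: "real e \<le> 1 / (\<epsilon> * ln 2) * 2 powr (real e * \<epsilon>)"
      by (simp add: field_simps)
    have "1 \<le> 2 powr (real e * \<epsilon>)" using assms by (intro ge_one_powr_ge_zero) auto
    with 1 show ?thesis unfolding A_def by (simp add: distrib_right)
  qed
  define p0 where "p0 = nat \<lceil>2 powr (1 / \<epsilon>)\<rceil>"
  have "2 powr (1 / \<epsilon>) \<le> real p0" unfolding p0_def by linarith
  then have "(2 powr (1 / \<epsilon>)) powr \<epsilon> \<le> real p0 powr \<epsilon>"
    using assms by (intro powr_mono2) auto
  then have p0: "real p0 powr \<epsilon> \<ge> 2" using assms by (simp add: powr_powr)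
  show thesis
  proof (rule that[of "A ^ p0"])
    show "A ^ p0 > 0" using A1 by simp
    fix n :: nat assume n: "n > 0"
    have "card {p. prime p \<and> p < p0 \<and> p dvd n} \<le> card {..<p0}" by (intro card_mono) auto
    then have "A ^ card {p. prime p \<and> p < p0 \<and> p dvd n} \<le> A ^ p0" using A1 by (intro power_increasing) auto
    then have "A ^ card {p. prime p \<and> p < p0 \<and> p dvd n} * real n powr \<epsilon> \<le> A ^ p0 * real n powr \<epsilon>"
      by (intro mult_right_mono) auto
    then show "real (card {d. d dvd n}) \<le> A ^ p0 * real n powr \<epsilon>"
      using divisor_bound_aux[OF assms A1 A p0 n] by linarith
  qed
qed

subsection \<open>Max norm of vectors, matrices and rank one matrices\<close>

lemma abs_component_le_infnorm_matrix: "\<bar>A $ i $ j\<bar> \<le> infnorm (A :: real^'n^'m)"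
  using Basis_le_infnorm[of "axis i (axis j 1)" A] by (simp add: inner_axis axis_in_Basis_iff)

lemma infnorm_attained:
  obtains b where "b \<in> Basis" "infnorm (x :: 'a::euclidean_space) = \<bar>x \<bullet> b\<bar>"
proof -
  have "Max ((\<lambda>i. \<bar>x \<bullet> i\<bar>) ` Basis) \<in> (\<lambda>i. \<bar>x \<bullet> i\<bar>) ` Basis"
    by (intro Max_in) auto
  then obtain b where "b \<in> Basis" "Max ((\<lambda>i. \<bar>x \<bullet> i\<bar>) ` Basis) = \<bar>x \<bullet> b\<bar>" by blast
  then show thesis using that[of b] by (simp only: infnorm_Max)
qed

lemma infnorm_matrix_attained:
  obtains i j where "infnorm (A :: real^'n^'m) = \<bar>A $ i $ j\<bar>"
proof -
  obtain b where b: "b \<in> Basis" "infnorm A = \<bar>A \<bullet> b\<bar>" using infnorm_attained by blast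
  then obtain i j where "b = axis i (axis j 1)" by (auto simp: Basis_vec_def)
  then show thesis using b(2) that[of i j] by (simp add: inner_axis)
qed

lemma infnorm_vec_attained:
  obtains i where "infnorm (x :: real^'n) = \<bar>x $ i\<bar>"
proof -
  obtain b where b: "b \<in> Basis" "infnorm x = \<bar>x \<bullet> b\<bar>" using infnorm_attained by blast
  then obtain i where "b = axis i 1" by (auto simp: Basis_vec_def)
  then show thesis using b(2) that[of i] by (simp add: inner_axis)
qed

definition outer :: "int^'m \<Rightarrow> int^'n \<Rightarrow> int^'n^'m" where
  "outer k q = (\<chi> i j. k $ i * q $ j)"

definition real_mat :: "int^'n^'m \<Rightarrow> real^'n^'m" where
  "real_mat l = (\<chi> i j. real_of_int (l $ i $ j))"

lemma real_mat_nth [simp]: "real_mat l $ i $ j = real_of_int (l $ i $ j)"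
  by (simp add: real_mat_def)

lemma real_vec_nth [simp]: "real_vec q $ i = real_of_int (q $ i)"
  by (simp add: real_vec_def)

lemma outer_nth [simp]: "outer k q $ i $ j = k $ i * q $ j"
  by (simp add: outer_def)

lemma real_vec_eq_0_iff [simp]: "real_vec q = 0 \<longleftrightarrow> q = 0"
  by (simp add: vec_eq_iff)

lemma real_mat_eq_0_iff [simp]: "real_mat q = 0 \<longleftrightarrow> q = 0"
  by (simp add: vec_eq_iff)

lemma infnorm_outer: "infnorm (real_mat (outer k q)) = infnorm (real_vec k) * infnorm (real_vec q)"
proof (rule antisym)
  obtain i j where "infnorm (real_mat (outer k q)) = \<bar>real_mat (outer k q) $ i $ j\<bar>"
    using infnorm_matrix_attained by blast
  also have "\<dots> = \<bar>real_vec k $ i\<bar> * \<bar>real_vec q $ j\<bar>" by (simp add: abs_mult)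
  also have "\<dots> \<le> infnorm (real_vec k) * infnorm (real_vec q)"
    by (intro mult_mono component_le_infnorm_cart infnorm_pos_le) auto
  finally show "infnorm (real_mat (outer k q)) \<le> infnorm (real_vec k) * infnorm (real_vec q)" .
next
  obtain i where i: "infnorm (real_vec k) = \<bar>real_vec k $ i\<bar>" using infnorm_vec_attained by blast
  obtain j where j: "infnorm (real_vec q) = \<bar>real_vec q $ j\<bar>" using infnorm_vec_attained by blast
  show "infnorm (real_vec k) * infnorm (real_vec q) \<le> infnorm (real_mat (outer k q))"
    unfolding i j using abs_component_le_infnorm_matrix[of "real_mat (outer k q)" i j] by (simp add: abs_mult)
qed

lemma inner_outer: "x \<bullet> real_mat (outer k q) = real_vec k \<bullet> (x *v real_vec q)"
  by (simp add: inner_vec_def matrix_vector_mult_def sum_distrib_left mult_ac)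

lemma infnorm_real_vec_ge_1: "q \<noteq> 0 \<Longrightarrow> infnorm (real_vec q) \<ge> 1"
proof -
  assume "q \<noteq> 0"
  then obtain i where "q $ i \<noteq> 0" by (auto simp: vec_eq_iff)
  then have "1 \<le> \<bar>real_vec q $ i\<bar>" by simp
  then show ?thesis using component_le_infnorm_cart[of "real_vec q" i] by linarith
qed

lemma infnorm_real_mat_ge_1: "l \<noteq> 0 \<Longrightarrow> infnorm (real_mat l) \<ge> 1"
proof -
  assume "l \<noteq> 0"
  then obtain i j where "l $ i $ j \<noteq> 0" by (auto simp: vec_eq_iff)
  then have "1 \<le> \<bar>real_mat l $ i $ j\<bar>" by simp
  then show ?thesis using abs_component_le_infnorm_matrix[of "real_mat l" i j] by linarith
qed

text \<open>Applied with a = l and b = \<open>\<xi>\<close> - l, this trades decay in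
  \<open>\<xi>\<close> - l and in l for decay in \<open>\<xi>\<close>.\<close>

lemma one_plus_infnorm_submult: "1 + infnorm (a + b) \<le> (1 + infnorm a) * (1 + infnorm b)"
proof -
  have "0 \<le> infnorm a * infnorm b" by (simp add: infnorm_pos_le)
  then show ?thesis using infnorm_triangle[of a b] by (simp add: algebra_simps)
qed

subsection \<open>Sums over lattice points\<close>

text \<open>The subtracted 2/(N+1) is what makes the induction go through: the two new terms are at
  most 2/(N+1) - 2/(N+2).\<close>

lemma sum_int_inverse_square:
  "(\<Sum>z\<in>{- int N..int N}. 1 / (1 + \<bar>real_of_int z\<bar>)\<^sup>2) \<le> 4 - 2 / (real N + 1)"
proof (induction N)
  case 0
  then show ?case by simp
next
  case (Suc N)
  have e: "{- int (Suc N)..int (Suc N)} = insert (- int (Suc N)) (insert (int (Suc N)) {- int N..int N})"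
    by auto
  have "2 / (2 + real N)\<^sup>2 \<le> 2 / ((real N + 1) * (real N + 2))"
    by (intro frac_le mult_pos_pos) (auto simp: power2_eq_square algebra_simps)
  also have "\<dots> = 2 / (real N + 1) - 2 / (real N + 2)" by (simp add: field_simps)
  finally have "2 / (2 + real N)\<^sup>2 \<le> 2 / (real N + 1) - 2 / (real N + 2)" .
  with Suc show ?case unfolding e by (simp add: algebra_simps)
qed

text \<open>Replacing y by its floor changes 1 + |y - z| by a factor of at most 2. This costs 4
  after squaring, and the centred sum is at most 4.\<close>

lemma sum_shifted_inverse_square:
  fixes y :: real
  assumes "finite B"
  shows "(\<Sum>z\<in>B. 1 / (1 + \<bar>y - real_of_int z\<bar>)\<^sup>2) \<le> 16"
proof -
  let ?B' = "(\<lambda>z. z - \<lfloor>y\<rfloor>) ` B"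
  obtain N where N: "?B' \<subseteq> {- int N..int N}"
  proof -
    have "finite (abs ` ?B')" using assms by simp
    then obtain N0 where "\<And>x. x \<in> abs ` ?B' \<Longrightarrow> x \<le> N0" using bdd_above_finite unfolding bdd_above_def by meson
    then have "?B' \<subseteq> {- int (nat N0)..int (nat N0)}" by (force simp: abs_le_iff)
    then show thesis by (rule that)
  qed
  have "(\<Sum>z\<in>B. 1 / (1 + \<bar>y - real_of_int z\<bar>)\<^sup>2) \<le> (\<Sum>z\<in>B. 4 * (1 / (1 + \<bar>real_of_int (z - \<lfloor>y\<rfloor>)\<bar>)\<^sup>2))"
  proof (rule sum_mono)
    fix z
    define v a where "v = real_of_int \<lfloor>y\<rfloor>" and "a = real_of_int z"
    have "v \<le> y" unfolding v_def by (rule of_int_floor_le)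
    moreover have "y < v + 1" unfolding v_def by (rule real_of_int_floor_add_one_gt)
    ultimately have "\<bar>y - v\<bar> \<le> 1" by simp
    moreover have "\<bar>a - v\<bar> \<le> \<bar>y - a\<bar> + \<bar>y - v\<bar>"
      using abs_triangle_ineq[of "a - y" "y - v"] by (simp add: abs_minus_commute)
    ultimately have "1 + \<bar>a - v\<bar> \<le> 2 * (1 + \<bar>y - a\<bar>)"
      using abs_ge_zero[of "y - a"] by (smt (verit))
    then have "1 + \<bar>real_of_int (z - \<lfloor>y\<rfloor>)\<bar> \<le> 2 * (1 + \<bar>y - real_of_int z\<bar>)"
      unfolding v_def a_def of_int_diff .
    moreover have "1 / b\<^sup>2 \<le> 4 * (1 / c\<^sup>2)" if "c \<le> 2 * b" "b \<ge> 1" "c \<ge> 1" for b c :: real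
    proof -
      have "c\<^sup>2 \<le> (2 * b)\<^sup>2" using that by (intro power_mono) auto
      then show ?thesis using that by (simp add: field_simps)
    qed
    ultimately show "1 / (1 + \<bar>y - real_of_int z\<bar>)\<^sup>2 \<le> 4 * (1 / (1 + \<bar>real_of_int (z - \<lfloor>y\<rfloor>)\<bar>)\<^sup>2)"
      by (metis abs_ge_zero le_add_same_cancel1)
  qed
  also have "\<dots> = 4 * (\<Sum>z\<in>?B'. 1 / (1 + \<bar>real_of_int z\<bar>)\<^sup>2)"
    by (subst sum.reindex) (auto simp: inj_on_def sum_distrib_left)
  also have "(\<Sum>z\<in>?B'. 1 / (1 + \<bar>real_of_int z\<bar>)\<^sup>2) \<le> (\<Sum>z\<in>{- int N..int N}. 1 / (1 + \<bar>real_of_int z\<bar>)\<^sup>2)"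
    by (intro sum_mono2 N) auto
  also have "\<dots> \<le> 4" using sum_int_inverse_square[of N] by (smt (verit) divide_nonneg_nonneg of_nat_0_le_iff)
  finally show ?thesis by simp
qed

text \<open>By injectivity the sum is part of the sum over a full box of coordinate functions, and
  the latter factors into one-dimensional sums.\<close>

lemma sum_prod_le_power:
  fixes w :: "'i::finite \<Rightarrow> int \<Rightarrow> real" and h :: "'l \<Rightarrow> 'i \<Rightarrow> int"
  assumes fin: "finite \<Lambda>" and inj: "inj_on h \<Lambda>" and w: "\<And>i z. w i z \<ge> 0"
    and K: "\<And>i B. finite B \<Longrightarrow> (\<Sum>z\<in>B. w i z) \<le> K"
  shows "(\<Sum>l\<in>\<Lambda>. \<Prod>i\<in>UNIV. w i (h l i)) \<le> K ^ CARD('i)"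
proof -
  define B where "B = (\<Union>l\<in>\<Lambda>. range (h l))"
  have fB: "finite B" unfolding B_def using fin by auto
  have "(\<Sum>l\<in>\<Lambda>. \<Prod>i\<in>UNIV. w i (h l i)) = (\<Sum>g\<in>h ` \<Lambda>. \<Prod>i\<in>UNIV. w i (g i))"
    using inj by (simp add: sum.reindex)
  also have "\<dots> \<le> (\<Sum>g\<in>PiE UNIV (\<lambda>_. B). \<Prod>i\<in>UNIV. w i (g i))"
    using fB w by (intro sum_mono2 finite_PiE) (auto simp: B_def intro!: prod_nonneg)
  also have "\<dots> = (\<Prod>i\<in>UNIV. \<Sum>z\<in>B. w i z)"
    using fB by (subst prod_sum_PiE) auto
  also have "\<dots> \<le> (\<Prod>i\<in>(UNIV::'i set). K)"
    using K[OF fB] w by (intro prod_mono) (auto intro: sum_nonneg)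
  finally show ?thesis by simp
qed

text \<open>The exponent 2mn is shared out as 2 per matrix entry, each entry being bounded by the
  max norm. The bound is uniform in \<open>\<xi>\<close>.\<close>

lemma lattice_sum_bound:
  fixes \<xi> :: "real^'n^'m"
  assumes "finite \<Lambda>"
  shows "(\<Sum>l\<in>\<Lambda>. (1 + infnorm (\<xi> - real_mat l)) powr (- real (2 * CARD('m) * CARD('n))))
     \<le> 16 ^ (CARD('m) * CARD('n))"
proof -
  define w where "w = (\<lambda>(i, j) z. 1 / (1 + \<bar>\<xi> $ i $ j - real_of_int z\<bar>)\<^sup>2)"
  have "(\<Sum>l\<in>\<Lambda>. (1 + infnorm (\<xi> - real_mat l)) powr (- real (2 * CARD('m) * CARD('n))))
     \<le> (\<Sum>l\<in>\<Lambda>. \<Prod>p\<in>(UNIV::('m \<times> 'n) set). w p (case p of (i, j) \<Rightarrow> l $ i $ j))"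
  proof (rule sum_mono)
    fix l
    have pos: "1 + infnorm (\<xi> - real_mat l) > 0" using infnorm_pos_le[of "\<xi> - real_mat l"] by linarith
    have "(1 + infnorm (\<xi> - real_mat l)) powr (- real (2 * CARD('m) * CARD('n)))
       = (\<Prod>p\<in>(UNIV::('m \<times> 'n) set). 1 / (1 + infnorm (\<xi> - real_mat l))\<^sup>2)"
      unfolding prod_constant card_prod powr_minus_divide powr_realpow[OF pos]
      by (simp add: power_one_over power_mult mult.assoc)
    also have "\<dots> \<le> (\<Prod>p\<in>(UNIV::('m \<times> 'n) set). w p (case p of (i, j) \<Rightarrow> l $ i $ j))"
    proof (intro prod_mono conjI)
      fix p :: "'m \<times> 'n"
      obtain i j where p: "p = (i, j)" by (cases p)
      have "1 + \<bar>\<xi> $ i $ j - real_of_int (l $ i $ j)\<bar> \<le> 1 + infnorm (\<xi> - real_mat l)"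
        using abs_component_le_infnorm_matrix[of "\<xi> - real_mat l" i j] by simp
      then have "(1 + \<bar>\<xi> $ i $ j - real_of_int (l $ i $ j)\<bar>)\<^sup>2 \<le> (1 + infnorm (\<xi> - real_mat l))\<^sup>2"
        by (intro power_mono) auto
      then show "1 / (1 + infnorm (\<xi> - real_mat l))\<^sup>2 \<le> w p (case p of (i, j) \<Rightarrow> l $ i $ j)"
        unfolding w_def p prod.case by (intro frac_le zero_less_power) auto
    qed (use pos in auto)
    finally show "(1 + infnorm (\<xi> - real_mat l)) powr (- real (2 * CARD('m) * CARD('n)))
        \<le> (\<Prod>p\<in>(UNIV::('m \<times> 'n) set). w p (case p of (i, j) \<Rightarrow> l $ i $ j))" .
  qed
  also have "\<dots> \<le> 16 ^ CARD('m \<times> 'n)"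
  proof (rule sum_prod_le_power[OF assms])
    show "inj_on (\<lambda>l p. case p of (i, j) \<Rightarrow> l $ i $ j) \<Lambda>"
      by (auto simp: inj_on_def vec_eq_iff fun_eq_iff)
    show "w p z \<ge> 0" for p z by (auto simp: w_def split: prod.split)
    show "(\<Sum>z\<in>B. w p z) \<le> 16" if "finite B" for p B
      using sum_shifted_inverse_square[OF that] by (cases p) (auto simp: w_def)
  qed
  finally show ?thesis by simp
qed

section \<open>Counting representations of a lattice point as a rank one matrix\<close>

text \<open>Fix an entry l_ij = k_i q_j different from 0. Then k_i is a divisor of it up to sign,
  which gives the factor 2; k_i determines q through row i, and q_j determines k through column
  j.\<close>

lemma card_outer_fibre:
  fixes l :: "int^'n^'m"
  assumes C: "\<And>n::nat. n > 0 \<Longrightarrow> real (card {d. d dvd n}) \<le> C * real n powr \<epsilon>" and C0: "C > 0" and \<epsilon>: "\<epsilon> > 0"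
    and "l \<noteq> 0" and P: "finite P"
  shows "real (card {p \<in> P. (case p of (k, q) \<Rightarrow> outer k q) = l}) \<le> 2 * C * infnorm (real_mat l) powr \<epsilon>"
proof -
  obtain i j where ij: "l $ i $ j \<noteq> 0" using \<open>l \<noteq> 0\<close> by (auto simp: vec_eq_iff)
  define D where "D = {d. d dvd nat \<bar>l $ i $ j\<bar>}"
  have fD: "finite D" unfolding D_def using ij by (intro finite_divisors_nat) simp
  let ?F = "{p \<in> P. (case p of (k, q) \<Rightarrow> outer k q) = l}"
  let ?h = "\<lambda>(k, q). k $ i :: int"
  have dv: "fst p $ i * snd p $ j = l $ i $ j" if "p \<in> ?F" for p
    using that by (cases p) auto
  have inj: "inj_on ?h ?F"
  proof (rule inj_onI)
    fix p p' assume p: "p \<in> ?F" "p' \<in> ?F" "?h p = ?h p'"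
    obtain k q k' q' where e: "p = (k, q)" "p' = (k', q')" by (cases p, cases p')
    have eq: "outer k q = l" "outer k' q' = l" "k $ i = k' $ i" using p e by auto
    have nz: "k $ i \<noteq> 0" "q $ j \<noteq> 0" using dv[OF p(1)] e ij by auto
    have a: "k $ a * q $ b = k' $ a * q' $ b" for a b using eq by (metis outer_nth)
    have "q $ b = q' $ b" for b using a[of i b] eq(3) nz by auto
    moreover have "k $ b = k' $ b" for b using a[of b j] nz calculation[of j] by auto
    ultimately show "p = p'" unfolding e by (simp add: vec_eq_iff)
  qed
  have sub: "?h ` ?F \<subseteq> int ` D \<union> (\<lambda>d. - int d) ` D"
  proof
    fix z assume "z \<in> ?h ` ?F"
    then obtain p where p: "p \<in> ?F" "z = fst p $ i" by (auto split: prod.splits)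
    have "z dvd l $ i $ j" unfolding p(2) dv[OF p(1), symmetric] by (rule dvd_triv_left)
    then have "nat \<bar>z\<bar> \<in> D" unfolding D_def by (simp add: nat_dvd_iff)
    moreover have "z = int (nat \<bar>z\<bar>) \<or> z = - int (nat \<bar>z\<bar>)" by linarith
    ultimately show "z \<in> int ` D \<union> (\<lambda>d. - int d) ` D" by blast
  qed
  have "card ?F = card (?h ` ?F)" using inj by (rule card_image[symmetric])
  also have "\<dots> \<le> card (int ` D \<union> (\<lambda>d. - int d) ` D)" using sub fD by (intro card_mono) auto
  also have "\<dots> \<le> card (int ` D) + card ((\<lambda>d. - int d) ` D)" by (rule card_Un_le)
  also have "\<dots> \<le> card D + card D" by (intro add_mono card_image_le fD)
  finally have "real (card ?F) \<le> 2 * real (card D)" by simp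
  also have "real (card D) \<le> C * real (nat \<bar>l $ i $ j\<bar>) powr \<epsilon>"
    unfolding D_def using ij by (intro C) auto
  also have "\<dots> \<le> C * infnorm (real_mat l) powr \<epsilon>"
    using C0 \<epsilon> abs_component_le_infnorm_matrix[of "real_mat l" i j]
    by (intro mult_left_mono powr_mono2) auto
  finally show ?thesis by simp
qed

text \<open>Group the terms by l = k (x) q. The number of representations costs |l|^(t - t') and
  leaves |l|^(-t'), which submultiplicativity converts into (1 + |xi|)^(-t') at the price of t'
  powers of 1 + |xi - l|. The condition on \<open>D\<close> leaves 2mn powers to sum over l. The
  constant does not depend on \<open>P\<close> or \<open>\<xi>\<close>.\<close>

lemma rank_one_sum_bound:
  fixes t t' :: real
  assumes t: "0 < t'" "t' < t" and D: "D \<ge> t' + real (2 * CARD('m) * CARD('n))"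
  obtains C where "C > 0"
    "\<And>P (\<xi> :: real^'n^'m). \<lbrakk>finite P; \<And>k q. (k, q) \<in> P \<Longrightarrow> k \<noteq> 0 \<and> q \<noteq> 0\<rbrakk> \<Longrightarrow>
      (\<Sum>(k, q)\<in>P. infnorm (real_mat (outer k q)) powr (- t) * (1 + infnorm (\<xi> - real_mat (outer k q))) powr (- D))
        \<le> C * (1 + infnorm \<xi>) powr (- t')"
proof -
  obtain C where C: "C > 0" "\<And>n::nat. n > 0 \<Longrightarrow> real (card {d. d dvd n}) \<le> C * real n powr (t - t')"
    using divisor_bound[of "t - t'"] t by auto
  let ?d = "2 * CARD('m) * CARD('n)"
  \<comment> \<open>2 C comes from the number of representations, 2^t' from 1 + |l| <= 2 |l|, and
    the power of 16 from the lattice sum.\<close>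
  define C' where "C' = 2 * C * (2 powr t' * 16 ^ (CARD('m) * CARD('n)))"
  show thesis
  proof (rule that[of C'])
    show "C' > 0" using C(1) by (simp add: C'_def)
    fix P :: "((int^'m) \<times> (int^'n)) set" and \<xi> :: "real^'n^'m"
    assume P: "finite P" and nz: "\<And>k q. (k, q) \<in> P \<Longrightarrow> k \<noteq> 0 \<and> q \<noteq> 0"
    define h where "h = (\<lambda>(k :: int^'m, q :: int^'n). outer k q)"
    define g where "g l = infnorm (real_mat l) powr (- t) * (1 + infnorm (\<xi> - real_mat l)) powr (- D)" for l
    have h0: "l \<noteq> 0" if "l \<in> h ` P" for l
    proof -
      obtain k q where kq: "(k, q) \<in> P" "l = outer k q" using \<open>l \<in> h ` P\<close> by (auto simp: h_def)
      then have "infnorm (real_mat l) \<noteq> 0" using nz[OF kq(1)] by (simp add: infnorm_outer infnorm_eq_0)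
      then show ?thesis by (auto simp: infnorm_eq_0)
    qed
    have "(\<Sum>(k, q)\<in>P. infnorm (real_mat (outer k q)) powr (- t) * (1 + infnorm (\<xi> - real_mat (outer k q))) powr (- D))
        = (\<Sum>p\<in>P. g (h p))"
      by (intro sum.cong) (auto simp: g_def h_def)
    also have "\<dots> = (\<Sum>l\<in>h ` P. \<Sum>p\<in>{p \<in> P. h p = l}. g (h p))"
      using P by (rule sum.image_gen)
    also have "\<dots> = (\<Sum>l\<in>h ` P. real (card {p \<in> P. h p = l}) * g l)"
      by (intro sum.cong refl) simp
    also have "\<dots> \<le> (\<Sum>l\<in>h ` P. 2 * C * (2 powr t' * (1 + infnorm \<xi>) powr (- t') * (1 + infnorm (\<xi> - real_mat l)) powr (- real ?d)))"
    proof (rule sum_mono)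
      fix l assume l: "l \<in> h ` P"
      define a where "a = infnorm (real_mat l)"
      define b where "b = 1 + infnorm (\<xi> - real_mat l)"
      define c where "c = 1 + infnorm \<xi>"
      have a: "a \<ge> 1" unfolding a_def by (intro infnorm_real_mat_ge_1 h0 l)
      have b: "b \<ge> 1" by (simp add: b_def infnorm_pos_le)
      have c: "c \<ge> 1" by (simp add: c_def infnorm_pos_le)
      have "c \<le> (1 + a) * b"
        using one_plus_infnorm_submult[of "real_mat l" "\<xi> - real_mat l"] by (simp add: a_def b_def c_def)
      also have "\<dots> \<le> 2 * a * b" using a b by (intro mult_right_mono) auto
      finally have "c powr t' \<le> (2 * a * b) powr t'" using c t by (intro powr_mono2) auto
      also have "\<dots> = 2 powr t' * a powr t' * b powr t'" using a b by (simp add: powr_mult)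
      finally have abc: "a powr (- t') \<le> 2 powr t' * c powr (- t') * b powr t'"
        using a c by (simp add: powr_minus field_simps)
      have "real (card {p \<in> P. h p = l}) \<le> 2 * C * a powr (t - t')"
        unfolding h_def a_def using card_outer_fibre[OF C(2) C(1) _ h0[OF l] P] t by simp
      then have "real (card {p \<in> P. h p = l}) * g l \<le> 2 * C * a powr (t - t') * (a powr (- t) * b powr (- D))"
        unfolding g_def a_def b_def by (intro mult_right_mono) auto
      also have "\<dots> = 2 * C * (a powr (- t') * b powr (- D))"
        using a by (simp add: powr_diff powr_minus field_simps)
      also have "\<dots> \<le> 2 * C * (2 powr t' * c powr (- t') * b powr t' * b powr (- D))"
        using abc C(1) by (intro mult_left_mono mult_right_mono) auto
      also have "\<dots> = 2 * C * (2 powr t' * c powr (- t') * b powr (t' - D))"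
        by (simp add: powr_add[symmetric])
      also have "\<dots> \<le> 2 * C * (2 powr t' * c powr (- t') * b powr (- real ?d))"
        using C(1) b D by (intro mult_left_mono powr_mono) auto
      finally show "real (card {p \<in> P. h p = l}) * g l \<le> 2 * C * (2 powr t' * (1 + infnorm \<xi>) powr (- t') * (1 + infnorm (\<xi> - real_mat l)) powr (- real ?d))"
        by (simp add: b_def c_def)
    qed
    also have "\<dots> = 2 * C * 2 powr t' * (1 + infnorm \<xi>) powr (- t') * (\<Sum>l\<in>h ` P. (1 + infnorm (\<xi> - real_mat l)) powr (- real ?d))"
      by (simp add: sum_distrib_left mult_ac)
    also have "\<dots> \<le> 2 * C * 2 powr t' * (1 + infnorm \<xi>) powr (- t') * 16 ^ (CARD('m) * CARD('n))"
      using C(1) P lattice_sum_bound[of "h ` P" \<xi>] by (intro mult_left_mono) auto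
    finally show "(\<Sum>(k, q)\<in>P. infnorm (real_mat (outer k q)) powr (- t) * (1 + infnorm (\<xi> - real_mat (outer k q))) powr (- D))
        \<le> C' * (1 + infnorm \<xi>) powr (- t')"
      by (simp add: C'_def mult_ac)
  qed
qed

subsection \<open>A compactly supported measure with rapidly decaying Fourier transform\<close>

lemma unif_integral_e_of_bound_uniform: "norm (LINT u|unif. e_of (t * u)) \<le> 2 / (1 + \<bar>t\<bar>)"
proof (cases "\<bar>t\<bar> \<le> 1")
  case True
  then have "1 \<le> 2 / (1 + \<bar>t\<bar>)" by (simp add: field_simps)
  then show ?thesis using unif_integral_e_of_bound(1)[of t] by linarith
next
  case False
  have "norm (LINT u|unif. e_of (t * u)) \<le> 1 / (pi * \<bar>t\<bar>)"
    using False by (intro unif_integral_e_of_bound) auto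
  also have "\<dots> \<le> 1 / (1 * \<bar>t\<bar>)" using False pi_ge_two
    by (intro divide_left_mono mult_right_mono mult_pos_pos) auto
  also have "\<dots> \<le> 2 / (1 + \<bar>t\<bar>)" using False by (simp add: field_simps)
  finally show ?thesis .
qed

text \<open>Each coordinate is an independent sum of \<open>M\<close> uniform variables, so the
  transform is a product of M-th powers. All factors are at most 1, and the coordinate in which
  \<open>\<xi>\<close> is largest already yields decay in the max norm.\<close>

lemma rapidly_decaying_measure:
  fixes M :: nat
  obtains \<mu> :: "'a::euclidean_space measure"
  where "prob_space \<mu>" "sets \<mu> = sets borel" "AE x in \<mu>. x \<in> cbox 0 (real M *\<^sub>R One)"
    "\<And>\<xi>. norm (LINT x|\<mu>. e_of (- (x \<bullet> \<xi>))) \<le> (2 / (1 + infnorm \<xi>)) ^ M"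
proof -
  define J where "J = (Basis :: 'a set) \<times> {..<M}"
  define W where "W = PiM J (\<lambda>_. unif)"
  interpret W: prob_space W unfolding W_def by (rule prob_space_PiM_unif)
  define X where "X \<omega> = (\<Sum>b\<in>(Basis::'a set). (\<Sum>j<M. \<omega> (b, j)) *\<^sub>R b)" for \<omega> :: "'a \<times> nat \<Rightarrow> real"
  have comp: "(\<lambda>\<omega>. \<omega> (b, j)) \<in> borel_measurable W" if "b \<in> Basis" "j \<in> {..<M}" for b j
    unfolding W_def using that by (intro measurable_PiM_unif_component) (auto simp: J_def)
  have X[measurable]: "X \<in> borel_measurable W"
    unfolding X_def by (intro borel_measurable_sum borel_measurable_scaleR borel_measurable_const comp)
  have Xb: "X \<omega> \<bullet> b = (\<Sum>j<M. \<omega> (b, j))" if "b \<in> Basis" for \<omega> b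
    using that by (simp add: X_def inner_sum_left inner_Basis if_distrib sum.delta' cong: if_cong)
  show thesis
  proof (rule that[of "distr W borel X"])
    show "prob_space (distr W borel X)" by (rule W.prob_space_distr) simp
    show "sets (distr W borel X) = sets borel" by simp
    have "X \<omega> \<in> cbox 0 (real M *\<^sub>R One)" if "\<omega> \<in> space W" for \<omega>
    proof (unfold mem_box, intro ballI conjI)
      fix b :: 'a assume b: "b \<in> Basis"
      have r: "0 \<le> \<omega> (b, j)" "\<omega> (b, j) \<le> 1" if "j < M" for j
        using PiM_unif_range[of \<omega> J "(b, j)"] \<open>\<omega> \<in> space W\<close> b that by (auto simp: W_def J_def)
      show "0 \<bullet> b \<le> X \<omega> \<bullet> b" using r by (auto simp: Xb[OF b] intro!: sum_nonneg)
      show "X \<omega> \<bullet> b \<le> (real M *\<^sub>R One) \<bullet> b"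
        using sum_mono[of "{..<M}" "\<lambda>j. \<omega> (b, j)" "\<lambda>_. 1"] r b by (simp add: Xb[OF b])
    qed
    then show "AE x in distr W borel X. x \<in> cbox 0 (real M *\<^sub>R One)"
      by (subst AE_distr_iff) auto
    fix \<xi> :: 'a
    have "(LINT x|distr W borel X. e_of (- (x \<bullet> \<xi>))) = (LINT \<omega>|W. e_of (- (X \<omega> \<bullet> \<xi>)))"
      by (rule integral_distr) auto
    also have "\<dots> = (LINT \<omega>|W. e_of (\<Sum>p\<in>J. - (\<xi> \<bullet> fst p) * \<omega> p))"
    proof (intro Bochner_Integration.integral_cong refl arg_cong[of _ _ e_of])
      fix \<omega> :: "'a \<times> nat \<Rightarrow> real"
      have "- (X \<omega> \<bullet> \<xi>) = (\<Sum>b\<in>Basis. \<Sum>j<M. - (\<xi> \<bullet> b) * \<omega> (b, j))"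
        by (subst euclidean_inner) (simp add: Xb sum_distrib_right sum_distrib_left mult_ac flip: sum_negf)
      also have "\<dots> = (\<Sum>p\<in>J. - (\<xi> \<bullet> fst p) * \<omega> p)"
        unfolding J_def by (subst sum.cartesian_product) (auto intro: sum.cong)
      finally show "- (X \<omega> \<bullet> \<xi>) = (\<Sum>p\<in>J. - (\<xi> \<bullet> fst p) * \<omega> p)" .
    qed
    also have "\<dots> = (\<Prod>p\<in>J. LINT u|unif. e_of (- (\<xi> \<bullet> fst p) * u))"
      unfolding W_def by (rule PiM_unif_integral_e_of) (simp add: J_def)
    finally have "norm (LINT x|distr W borel X. e_of (- (x \<bullet> \<xi>)))
       = (\<Prod>p\<in>J. norm (LINT u|unif. e_of (- (\<xi> \<bullet> fst p) * u)))"
      by (simp add: prod_norm)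
    also have "\<dots> = (\<Prod>b\<in>Basis. norm (LINT u|unif. e_of (- (\<xi> \<bullet> b) * u)) ^ M)"
      unfolding J_def by (subst prod.cartesian_product[symmetric, where g = "\<lambda>b j. norm (LINT u|unif. e_of (- (\<xi> \<bullet> b) * u))", unfolded case_prod_beta]) simp
    also have "\<dots> \<le> (2 / (1 + infnorm \<xi>)) ^ M"
    proof -
      obtain b where b: "b \<in> Basis" "infnorm \<xi> = \<bar>\<xi> \<bullet> b\<bar>" using infnorm_attained by blast
      let ?v = "\<lambda>b. norm (LINT u|unif. e_of (- (\<xi> \<bullet> b) * u)) ^ M"
      have v1: "?v c \<le> 1" "0 \<le> ?v c" for c
        using unif_integral_e_of_bound(1)[of "- (\<xi> \<bullet> c)"] by (auto intro: power_le_one)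
      have "(\<Prod>b\<in>Basis. ?v b) = ?v b * (\<Prod>b\<in>Basis - {b}. ?v b)" using b(1) by (intro prod.remove) auto
      also have "\<dots> \<le> ?v b" using v1 by (intro mult_right_le_one_le prod_nonneg prod_le_1) auto
      also have "?v b \<le> (2 / (1 + \<bar>\<xi> \<bullet> b\<bar>)) ^ M"
        using unif_integral_e_of_bound_uniform[of "- (\<xi> \<bullet> b)"] by (intro power_mono) auto
      finally show ?thesis by (simp add: b(2))
    qed
    finally show "norm (LINT x|distr W borel X. e_of (- (x \<bullet> \<xi>))) \<le> (2 / (1 + infnorm \<xi>)) ^ M" .
  qed
qed

subsection \<open>Bumps near the rational hyperplanes of one denominator\<close>

text \<open>Multiplying out, the choice of one frequency in each of the m coordinates is an integer
  vector k, and the combined phase is x . (k (x) q) by \<open>inner_outer\<close>. The second claim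
  is the finiteness of integer boxes.\<close>

lemma prod_trig_expansion:
  fixes x :: "real^'n^'m" and \<theta> :: "real^'m"
  assumes "finite S"
  shows "(\<Prod>i\<in>UNIV. \<Sum>k\<in>S. c k * e_of (real_of_int k * ((x *v real_vec q) $ i - \<theta> $ i)))
    = (\<Sum>k\<in>{k. \<forall>i. k $ i \<in> S}. (\<Prod>i\<in>UNIV. c (k $ i) * e_of (- (real_of_int (k $ i) * \<theta> $ i)))
          * e_of (x \<bullet> real_mat (outer k q)))"
    and "finite {k :: int^'m. \<forall>i. k $ i \<in> S}"
proof -
  have box: "{k :: int^'m. \<forall>i. k $ i \<in> S} = vec_lambda ` PiE UNIV (\<lambda>_. S)" (is "?K = _")
  proof
    show "?K \<subseteq> vec_lambda ` PiE UNIV (\<lambda>_. S)"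
    proof
      fix k assume "k \<in> ?K"
      then show "k \<in> vec_lambda ` PiE UNIV (\<lambda>_. S)" by (intro image_eqI[of _ _ "\<lambda>i. k $ i"]) auto
    qed
  qed auto
  then show "finite ?K" using assms by (auto intro!: finite_imageI finite_PiE)
  have "(\<Prod>i\<in>UNIV. \<Sum>k\<in>S. c k * e_of (real_of_int k * ((x *v real_vec q) $ i - \<theta> $ i)))
      = (\<Sum>g\<in>PiE UNIV (\<lambda>_. S). \<Prod>i\<in>UNIV. c (g i) * e_of (real_of_int (g i) * ((x *v real_vec q) $ i - \<theta> $ i)))"
    using assms by (subst prod_sum_PiE) auto
  also have "\<dots> = (\<Sum>k\<in>?K. \<Prod>i\<in>UNIV. c (k $ i) * e_of (real_of_int (k $ i) * ((x *v real_vec q) $ i - \<theta> $ i)))"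
    unfolding box by (subst sum.reindex) (auto simp: inj_on_def vec_lambda_inject)
  also have "\<dots> = (\<Sum>k\<in>?K. (\<Prod>i\<in>UNIV. c (k $ i) * e_of (- (real_of_int (k $ i) * \<theta> $ i))) * e_of (x \<bullet> real_mat (outer k q)))"
  proof (rule sum.cong[OF refl])
    fix k :: "int^'m"
    have "x \<bullet> real_mat (outer k q) = (\<Sum>i\<in>UNIV. real_of_int (k $ i) * (x *v real_vec q) $ i)"
      unfolding inner_outer by (simp add: inner_vec_def)
    then show "(\<Prod>i\<in>UNIV. c (k $ i) * e_of (real_of_int (k $ i) * ((x *v real_vec q) $ i - \<theta> $ i)))
       = (\<Prod>i\<in>UNIV. c (k $ i) * e_of (- (real_of_int (k $ i) * \<theta> $ i))) * e_of (x \<bullet> real_mat (outer k q))"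
      by (simp add: e_of_sum prod.distrib[symmetric] right_diff_distrib mult.assoc flip: e_of_add)
  qed
  finally show "(\<Prod>i\<in>UNIV. \<Sum>k\<in>S. c k * e_of (real_of_int k * ((x *v real_vec q) $ i - \<theta> $ i)))
    = (\<Sum>k\<in>?K. (\<Prod>i\<in>UNIV. c (k $ i) * e_of (- (real_of_int (k $ i) * \<theta> $ i)))
          * e_of (x \<bullet> real_mat (outer k q)))" .
qed

lemma continuous_on_matrix_vector_component [continuous_intros]:
  "continuous_on A (\<lambda>x :: real^'n^'m. (x *v v) $ i)"
  unfolding matrix_vector_mult_def vec_lambda_beta by (intro continuous_intros)

text \<open>The product over i of periodic bumps at (x q)_i - theta_i. In the coefficient bound only
  the factor of the largest |k_i| is kept, which gives the M-th power of the max norm.\<close>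

lemma hyperplane_bump:
  fixes \<delta> :: real and M :: nat and q :: "int^'n" and \<theta> :: "real^'m"
  assumes \<delta>: "0 < \<delta>" "\<delta> < 1/2"
  obtains F :: "real^'n^'m \<Rightarrow> real" and b :: "nat \<Rightarrow> int^'m \<Rightarrow> complex" and K :: "nat \<Rightarrow> (int^'m) set" and B :: real
  where "continuous_on UNIV F" "\<And>x. 0 \<le> F x" "\<And>x. F x \<le> B"
    "\<And>x i. F x \<noteq> 0 \<Longrightarrow> \<exists>r::int. \<bar>(x *v real_vec q) $ i - \<theta> $ i - real_of_int r\<bar> \<le> real (Suc M) * \<delta>"
    "\<And>n. finite (K n)" "\<And>n. 0 \<in> K n" "\<And>n. b n 0 = 1" "\<And>n k. norm (b n k) \<le> 1"
    "\<And>n k. k \<noteq> 0 \<Longrightarrow> norm (b n k) \<le> (1 / (pi * \<delta> * infnorm (real_vec k))) ^ M"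
    "\<And>x. (\<lambda>n. \<Sum>k\<in>K n. b n k * e_of (x \<bullet> real_mat (outer k q))) \<longlonglongrightarrow> complex_of_real (F x)"
    "\<And>n x. norm (\<Sum>k\<in>K n. b n k * e_of (x \<bullet> real_mat (outer k q))) \<le> B"
proof -
  obtain f :: "real \<Rightarrow> real" and c :: "nat \<Rightarrow> int \<Rightarrow> complex" and B :: real
    where f: "continuous_on UNIV f" "\<And>y. 0 \<le> f y" "\<And>y. f y \<le> B"
    "\<And>y. f y \<noteq> 0 \<Longrightarrow> \<exists>r::int. \<bar>y - real_of_int r\<bar> \<le> real (Suc M) * \<delta>"
    and c: "\<And>n. c n 0 = 1" "\<And>n k. norm (c n k) \<le> 1"
    "\<And>n k. k \<noteq> 0 \<Longrightarrow> norm (c n k) \<le> (1 / (pi * \<delta> * \<bar>real_of_int k\<bar>)) ^ M"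
    "\<And>y. (\<lambda>n. \<Sum>k\<in>{- int (Suc n)..int (Suc n)}. c n k * e_of (real_of_int k * y)) \<longlonglongrightarrow> complex_of_real (f y)"
    "\<And>n y. norm (\<Sum>k\<in>{- int (Suc n)..int (Suc n)}. c n k * e_of (real_of_int k * y)) \<le> B"
    by (rule periodic_bump[OF \<delta>, of M]) (rule that)
  define S where "S n = {- int (Suc n)..int (Suc n)}" for n
  define y where "y x i = (x *v real_vec q) $ i - \<theta> $ i" for x :: "real^'n^'m" and i
  define F where "F x = (\<Prod>i\<in>UNIV. f (y x i))" for x
  define K where "K n = {k :: int^'m. \<forall>i. k $ i \<in> S n}" for n
  define b where "b n k = (\<Prod>i\<in>UNIV. c n (k $ i) * e_of (- (real_of_int (k $ i) * \<theta> $ i)))" for n and k :: "int^'m"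
  have eq: "(\<Sum>k\<in>K n. b n k * e_of (x \<bullet> real_mat (outer k q)))
     = (\<Prod>i\<in>UNIV. \<Sum>k\<in>S n. c n k * e_of (real_of_int k * y x i))" for n x
    unfolding K_def b_def y_def by (subst prod_trig_expansion) (auto simp: S_def)
  have B0: "0 \<le> B" using f(2)[of 0] f(3)[of 0] by linarith
  show thesis
  proof (rule that[of F "B ^ CARD('m)" K b])
    show "continuous_on UNIV F" unfolding F_def y_def
      by (intro continuous_on_prod continuous_on_compose2[OF f(1)] continuous_intros) auto
    show "0 \<le> F x" for x unfolding F_def by (intro prod_nonneg) (auto simp: f)
    show "F x \<le> B ^ CARD('m)" for x
    proof -
      have "F x \<le> (\<Prod>i\<in>(UNIV :: 'm set). B)" unfolding F_def by (intro prod_mono conjI f)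
      then show ?thesis by simp
    qed
    show "\<exists>r::int. \<bar>(x *v real_vec q) $ i - \<theta> $ i - real_of_int r\<bar> \<le> real (Suc M) * \<delta>" if "F x \<noteq> 0" for x i
      using f(4)[of "y x i"] that unfolding F_def y_def by auto
    show "finite (K n)" for n unfolding K_def S_def by (intro prod_trig_expansion) auto
    show "0 \<in> K n" for n by (simp add: K_def S_def)
    show "b n 0 = 1" for n by (simp add: b_def c)
    show "norm (b n k) \<le> 1" for n k
      unfolding b_def prod_norm[symmetric] norm_mult using c by (intro prod_le_1) auto
    show "norm (b n k) \<le> (1 / (pi * \<delta> * infnorm (real_vec k))) ^ M" if "k \<noteq> 0" for n k
    proof -
      obtain i where i: "infnorm (real_vec k) = \<bar>real_vec k $ i\<bar>" using infnorm_vec_attained by blast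
      then have ki: "k $ i \<noteq> 0" using infnorm_real_vec_ge_1[OF that] by auto
      have "norm (b n k) = (\<Prod>i\<in>UNIV. norm (c n (k $ i)))"
        unfolding b_def prod_norm[symmetric] norm_mult by simp
      also have "\<dots> = norm (c n (k $ i)) * (\<Prod>i\<in>UNIV - {i}. norm (c n (k $ i)))" by (intro prod.remove) auto
      also have "\<dots> \<le> norm (c n (k $ i))" using c by (intro mult_right_le_one_le prod_nonneg prod_le_1) auto
      also have "\<dots> \<le> (1 / (pi * \<delta> * \<bar>real_of_int (k $ i)\<bar>)) ^ M" using c(3)[OF ki] .
      finally show ?thesis by (simp add: i)
    qed
    show "(\<lambda>n. \<Sum>k\<in>K n. b n k * e_of (x \<bullet> real_mat (outer k q))) \<longlonglongrightarrow> complex_of_real (F x)" for x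
      unfolding eq F_def of_real_prod S_def by (intro tendsto_prod c)
    show "norm (\<Sum>k\<in>K n. b n k * e_of (x \<bullet> real_mat (outer k q))) \<le> B ^ CARD('m)" for n x
    proof -
      have "(\<Prod>i\<in>UNIV. norm (\<Sum>k\<in>S n. c n k * e_of (real_of_int k * y x i))) \<le> (\<Prod>i\<in>(UNIV::'m set). B)"
        unfolding S_def by (intro prod_mono conjI norm_ge_zero c(5))
      then show ?thesis unfolding eq by (simp add: prod_norm)
    qed
  qed
qed

section \<open>Fourier transforms of weighted measures\<close>

text \<open>The Fourier transform of G d\<open>\<mu>\<close>, left unnormalised so that it is linear
  in \<open>G\<close>; its value at 0 is the mass.\<close>

definition ftw :: "'a::euclidean_space measure \<Rightarrow> ('a \<Rightarrow> real) \<Rightarrow> 'a \<Rightarrow> complex" where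
  "ftw \<mu> G \<xi> = (LINT x|\<mu>. complex_of_real (G x) * e_of (- (x \<bullet> \<xi>)))"

lemma integrable_ftw:
  fixes \<mu> :: "'a::euclidean_space measure"
  assumes "prob_space \<mu>" "sets \<mu> = sets borel" "continuous_on UNIV G" "\<And>x. \<bar>G x\<bar> \<le> B"
  shows "integrable \<mu> (\<lambda>x. complex_of_real (G x) * e_of (- (x \<bullet> \<xi>)))"
proof -
  interpret prob_space \<mu> by fact
  have "(\<lambda>x. complex_of_real (G x) * e_of (- (x \<bullet> \<xi>))) \<in> borel_measurable borel"
    by (intro borel_measurable_continuous_onI continuous_intros assms)
  then have "(\<lambda>x. complex_of_real (G x) * e_of (- (x \<bullet> \<xi>))) \<in> borel_measurable \<mu>"
    using assms(2) measurable_cong_sets by blast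
  then show ?thesis using assms(4) by (intro integrable_const_bound[of _ B]) (auto simp: norm_mult)
qed

text \<open>Multiplication by e(x . v) translates the transform by v. The partial sums are bounded
  and converge pointwise, so dominated convergence passes to the limit.\<close>

lemma ftw_mult_series:
  fixes \<mu> :: "'a::euclidean_space measure"
  assumes \<mu>: "prob_space \<mu>" "sets \<mu> = sets borel" and G: "continuous_on UNIV G" "\<And>x. \<bar>G x\<bar> \<le> BG"
    and F: "continuous_on UNIV F"
    and lim: "\<And>x. (\<lambda>n. \<Sum>k\<in>K n. b n k * e_of (x \<bullet> v k)) \<longlonglongrightarrow> complex_of_real (F x)"
    and bd: "\<And>n x. norm (\<Sum>k\<in>K n. b n k * e_of (x \<bullet> v k)) \<le> B"
  shows "(\<lambda>n. \<Sum>k\<in>K n. b n k * ftw \<mu> G (\<xi> - v k)) \<longlonglongrightarrow> ftw \<mu> (\<lambda>x. G x * F x) \<xi>"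
proof -
  interpret prob_space \<mu> by fact
  have mb: "h \<in> borel_measurable \<mu>" if "continuous_on UNIV h" for h :: "'a \<Rightarrow> complex"
    using borel_measurable_continuous_onI[OF that] \<mu>(2) measurable_cong_sets by blast
  let ?s = "\<lambda>n x. (\<Sum>k\<in>K n. b n k * e_of (x \<bullet> v k)) * (complex_of_real (G x) * e_of (- (x \<bullet> \<xi>)))"
  have "(\<lambda>n. LINT x|\<mu>. ?s n x) \<longlonglongrightarrow> (LINT x|\<mu>. complex_of_real (F x) * (complex_of_real (G x) * e_of (- (x \<bullet> \<xi>))))"
  proof (rule integral_dominated_convergence[where w = "\<lambda>_. B * BG"])
    show "AE x in \<mu>. (\<lambda>n. ?s n x) \<longlonglongrightarrow> complex_of_real (F x) * (complex_of_real (G x) * e_of (- (x \<bullet> \<xi>)))"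
      by (intro AE_I2 tendsto_intros lim)
    show "AE x in \<mu>. norm (?s n x) \<le> B * BG" for n
    proof (rule AE_I2)
      fix x
      show "norm (?s n x) \<le> B * BG"
        unfolding norm_mult[of "sum _ _"] using bd[of n x] G(2)[of x]
        by (intro mult_mono) (auto simp: norm_mult intro: order.trans[OF norm_ge_zero bd])
    qed
  qed (auto intro!: mb continuous_intros G F)
  also have "(\<lambda>n. LINT x|\<mu>. ?s n x) = (\<lambda>n. \<Sum>k\<in>K n. b n k * ftw \<mu> G (\<xi> - v k))"
  proof
    fix n
    have e: "e_of (x \<bullet> v k) * e_of (- (x \<bullet> \<xi>)) = e_of (- (x \<bullet> (\<xi> - v k)))" for x k
      by (simp add: inner_diff_right flip: e_of_add)
    have "?s n x = (\<Sum>k\<in>K n. b n k * (complex_of_real (G x) * e_of (- (x \<bullet> (\<xi> - v k)))))" for x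
      unfolding sum_distrib_right e[symmetric] by (intro sum.cong refl) (simp only: mult_ac)
    then have "(LINT x|\<mu>. ?s n x) = (LINT x|\<mu>. (\<Sum>k\<in>K n. b n k * (complex_of_real (G x) * e_of (- (x \<bullet> (\<xi> - v k))))))"
      by simp
    also have "\<dots> = (\<Sum>k\<in>K n. LINT x|\<mu>. b n k * (complex_of_real (G x) * e_of (- (x \<bullet> (\<xi> - v k)))))"
      by (intro Bochner_Integration.integral_sum integrable_mult_right integrable_ftw[OF \<mu> G])
    also have "\<dots> = (\<Sum>k\<in>K n. b n k * ftw \<mu> G (\<xi> - v k))"
      by (simp add: ftw_def)
    finally show "(LINT x|\<mu>. ?s n x) = (\<Sum>k\<in>K n. b n k * ftw \<mu> G (\<xi> - v k))" .
  qed
  also have "(LINT x|\<mu>. complex_of_real (F x) * (complex_of_real (G x) * e_of (- (x \<bullet> \<xi>)))) = ftw \<mu> (\<lambda>x. G x * F x) \<xi>"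
    by (simp add: ftw_def mult_ac)
  finally show ?thesis .
qed

subsection \<open>The upper bound\<close>

text \<open>A discrete comparison with the integral of x^(-s): the two terms added at N + 1 are at
  most the increment of the right side. The 3 is the value at N = 1, and max 1 |z| assigns 1 to z =
  0.\<close>

lemma sum_int_powr_lt_1:
  fixes s :: real
  assumes s: "0 \<le> s" "s < 1" and N: "N > 0"
  shows "(\<Sum>z\<in>{- int N..int N}. max 1 \<bar>real_of_int z\<bar> powr (- s)) \<le> 3 / (1 - s) * real N powr (1 - s)"
  using N
proof (induction N rule: nat_induct_non_zero)
  case 1
  have "{- int 1..int 1} = {-1, 0, 1}" by auto
  then have "(\<Sum>z\<in>{- int 1..int 1}. max 1 \<bar>real_of_int z\<bar> powr (- s)) = 3" by simp
  also have "3 \<le> 3 / (1 - s)" using s by (simp add: field_simps)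
  finally show ?case by simp
next
  case (Suc N)
  have e: "{- int (Suc N)..int (Suc N)} = insert (- int (Suc N)) (insert (int (Suc N)) {- int N..int N})"
    by auto
  define x where "x = real N"
  have x: "x > 0" using Suc by (simp add: x_def)
  \<comment> \<open>Weighted AM-GM yields (1 - s) (x+1)^(-s) <= (x+1)^(1-s) - x^(1-s) without
    derivatives.\<close>
  have "x powr (1 - s) * (x + 1) powr s \<le> (1 - s) * x + s * (x + 1)"
    using s x by (intro Youngs_inequality_0) auto
  also have "\<dots> = x + s" by (simp add: algebra_simps)
  finally have "x powr (1 - s) \<le> (x + s) * (x + 1) powr (- s)"
    using x by (simp add: powr_minus field_simps)
  moreover have "(x + 1) powr (1 - s) = (x + 1) * (x + 1) powr (- s)"
    using x by (simp add: powr_diff powr_minus field_simps)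
  ultimately have "(1 - s) * (x + 1) powr (- s) \<le> (x + 1) powr (1 - s) - x powr (1 - s)"
    by (simp add: algebra_simps)
  then have "(x + 1) powr (- s) \<le> ((x + 1) powr (1 - s) - x powr (1 - s)) / (1 - s)"
    using s by (simp add: field_simps)
  moreover have "0 \<le> ((x + 1) powr (1 - s) - x powr (1 - s)) / (1 - s)"
    using s x by (intro divide_nonneg_nonneg) (auto intro!: powr_mono2)
  ultimately have "2 * (x + 1) powr (- s) \<le> 3 * (((x + 1) powr (1 - s) - x powr (1 - s)) / (1 - s))"
    by linarith
  moreover have "\<dots> = 3 / (1 - s) * (x + 1) powr (1 - s) - 3 / (1 - s) * x powr (1 - s)"
    by (simp add: diff_divide_distrib right_diff_distrib)
  ultimately have "3 / (1 - s) * x powr (1 - s) + 2 * (x + 1) powr (- s) \<le> 3 / (1 - s) * (x + 1) powr (1 - s)"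
    by linarith
  moreover have "(\<Sum>z\<in>{- int (Suc N)..int (Suc N)}. max 1 \<bar>real_of_int z\<bar> powr (- s))
      = (\<Sum>z\<in>{- int N..int N}. max 1 \<bar>real_of_int z\<bar> powr (- s)) + 2 * (x + 1) powr (- s)"
    unfolding e by (simp add: x_def max_def add.commute)
  ultimately show ?case using Suc.IH by (simp add: x_def add.commute)
qed

lemma sum_int_powr_gt_1:
  fixes s :: real
  assumes s: "s > 1"
  obtains C where "C > 0" "\<And>N. (\<Sum>z\<in>{- int N..int N}. max 1 \<bar>real_of_int z\<bar> powr (- s)) \<le> C"
proof -
  have sm: "summable (\<lambda>n. real n powr (- s))" using s by (simp add: summable_real_powr_iff)
  define A where "A = suminf (\<lambda>n. real n powr (- s))"
  have A0: "A \<ge> 0" unfolding A_def by (intro suminf_nonneg sm) auto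
  \<comment> \<open>On the right the term n = 0 vanishes, since \<open>0 powr _ = 0\<close>; the
    separate 1 accounts for z = 0.\<close>
  have eq: "(\<Sum>z\<in>{- int N..int N}. max 1 \<bar>real_of_int z\<bar> powr (- s)) = 1 + 2 * (\<Sum>n<Suc N. real n powr (- s))" for N
  proof (induction N)
    case 0
    then show ?case by simp
  next
    case (Suc N)
    have e: "{- int (Suc N)..int (Suc N)} = insert (- int (Suc N)) (insert (int (Suc N)) {- int N..int N})"
      by auto
    have "(\<Sum>z\<in>{- int (Suc N)..int (Suc N)}. max 1 \<bar>real_of_int z\<bar> powr (- s))
       = (\<Sum>z\<in>{- int N..int N}. max 1 \<bar>real_of_int z\<bar> powr (- s)) + 2 * real (Suc N) powr (- s)"
      unfolding e by (simp add: max_def add.commute)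
    with Suc show ?case by simp
  qed
  show thesis
  proof (rule that[of "1 + 2 * A"])
    show "(\<Sum>z\<in>{- int N..int N}. max 1 \<bar>real_of_int z\<bar> powr (- s)) \<le> 1 + 2 * A" for N
      unfolding eq A_def using sum_le_suminf[OF sm, of "{..<Suc N}"] by simp
  qed (use A0 in simp)
qed

text \<open>For k different from 0 every max 1 |k_i| is at most |k|, so the exponent t can be shared
  equally among the m coordinates and the sum factors.\<close>

lemma sum_int_vec_powr:
  fixes t T :: real
  assumes t: "t \<ge> 0" and T: "\<And>S. finite S \<Longrightarrow> S \<subseteq> {- int N..int N} \<Longrightarrow> (\<Sum>z\<in>S. max 1 \<bar>real_of_int z\<bar> powr (- (t / real CARD('m)))) \<le> T"
  shows "(\<Sum>k\<in>{k :: int^'m. \<forall>i. k $ i \<in> {- int N..int N}} - {0}. infnorm (real_vec k) powr (- t)) \<le> T ^ CARD('m)"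
proof -
  let ?K = "{k :: int^'m. \<forall>i. k $ i \<in> {- int N..int N}} - {0}"
  let ?s = "t / real CARD('m)"
  define w where "w z = (if z \<in> {- int N..int N} then max 1 \<bar>real_of_int z\<bar> powr (- ?s) else 0)" for z
  have fin: "finite ?K" using prod_trig_expansion(2)[of "{- int N..int N}"] by auto
  have "(\<Sum>k\<in>?K. infnorm (real_vec k) powr (- t)) \<le> (\<Sum>k\<in>?K. \<Prod>i\<in>UNIV. w (k $ i))"
  proof (rule sum_mono)
    fix k assume k: "k \<in> ?K"
    then have k1: "infnorm (real_vec k) \<ge> 1" by (intro infnorm_real_vec_ge_1) auto
    have "infnorm (real_vec k) powr (- t) = (infnorm (real_vec k) powr (- ?s)) powr real CARD('m)"
      by (simp add: powr_powr)
    also have "\<dots> = (infnorm (real_vec k) powr (- ?s)) ^ CARD('m)"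
      using k1 by (intro powr_realpow) simp
    also have "\<dots> = (\<Prod>i\<in>(UNIV::'m set). infnorm (real_vec k) powr (- ?s))" by simp
    also have "\<dots> \<le> (\<Prod>i\<in>UNIV. w (k $ i))"
    proof (intro prod_mono conjI)
      fix i
      have "max 1 \<bar>real_of_int (k $ i)\<bar> \<le> infnorm (real_vec k)"
        using k1 component_le_infnorm_cart[of "real_vec k" i] by simp
      then have "infnorm (real_vec k) powr (- ?s) \<le> max 1 \<bar>real_of_int (k $ i)\<bar> powr (- ?s)"
        using t by (intro powr_mono2') auto
      then show "infnorm (real_vec k) powr (- ?s) \<le> w (k $ i)" using k by (auto simp: w_def)
    qed auto
    finally show "infnorm (real_vec k) powr (- t) \<le> (\<Prod>i\<in>UNIV. w (k $ i))" .
  qed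
  also have "\<dots> \<le> T ^ CARD('m)"
  proof (rule sum_prod_le_power[OF fin])
    show "inj_on (\<lambda>k. ($) k) ?K" by (auto simp: inj_on_def vec_eq_iff)
    show "w z \<ge> 0" for z by (simp add: w_def)
    show "(\<Sum>z\<in>B. w z) \<le> T" if "finite B" for B
    proof -
      have "(\<Sum>z\<in>B. w z) = (\<Sum>z\<in>B \<inter> {- int N..int N}. max 1 \<bar>real_of_int z\<bar> powr (- ?s))"
        unfolding w_def using that by (simp add: sum.inter_restrict)
      also have "\<dots> \<le> T" by (intro T) auto
      finally show ?thesis .
    qed
  qed
  finally show ?thesis .
qed

text \<open>The product of the Fejer kernels at (x q)_i - theta_i is at least (N/4)^m on the
  neighbourhood, so Markov's inequality applies to its superlevel set \<open>A\<close>, which is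
  closed and hence measurable. The mean of the product is the sum of its coefficients against the
  transform at k (x) q, where k = 0 contributes the 1.\<close>

lemma hyperplane_neighbourhood_majorant:
  fixes \<mu> :: "(real^'n^'m) measure" and \<theta> :: "real^'m" and q :: "int^'n"
  assumes \<mu>: "prob_space \<mu>" "sets \<mu> = sets borel"
    and decay: "\<And>\<xi>. infnorm \<xi> \<ge> 1 \<Longrightarrow> norm (LINT x|\<mu>. e_of (- (x \<bullet> \<xi>))) \<le> C * infnorm \<xi> powr (- t)"
    and C: "C > 0" and q: "q \<noteq> 0" and N: "N > 0"
  obtains A where "closed A"
    "\<And>x. (\<And>i. \<exists>r::int. \<bar>(x *v real_vec q) $ i - \<theta> $ i - real_of_int r\<bar> \<le> 1 / (6 * real N)) \<Longrightarrow> x \<in> A"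
    "measure \<mu> A \<le> (4 / real N) ^ CARD('m) * (1 + C * infnorm (real_vec q) powr (- t) *
        (\<Sum>k\<in>{k :: int^'m. \<forall>i. k $ i \<in> {- int N..int N}} - {0}. infnorm (real_vec k) powr (- t)))"
proof -
  interpret prob_space \<mu> by fact
  define y where "y x i = (x *v real_vec q) $ i - \<theta> $ i" for x :: "real^'n^'m" and i
  define P where "P x = (\<Prod>i\<in>UNIV. fejer N (y x i))" for x
  define A where "A = {x. P x \<ge> (real N / 4) ^ CARD('m)}"
  have cP: "continuous_on UNIV P" unfolding P_def y_def by (intro continuous_intros)
  have cA: "closed A" unfolding A_def by (rule closed_Collect_le[OF continuous_on_const cP])
  have P0: "0 \<le> P x" for x unfolding P_def by (intro prod_nonneg fejer_nonneg)
  let ?K = "{k :: int^'m. \<forall>i. k $ i \<in> {- int N..int N}}"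
  have finK: "finite ?K" using prod_trig_expansion(2)[of "{- int N..int N}"] by auto
  define b where "b k = (\<Prod>i\<in>UNIV. complex_of_real (fejer_coeff N (k $ i)) * e_of (- (real_of_int (k $ i) * \<theta> $ i)))" for k :: "int^'m"
  have eq: "complex_of_real (P x) = (\<Sum>k\<in>?K. b k * e_of (x \<bullet> real_mat (outer k q)))" for x
    unfolding P_def of_real_prod fejer_expansion y_def b_def
    by (rule prod_trig_expansion) simp
  have b1: "norm (b k) \<le> 1" if "k \<in> ?K" for k
    unfolding b_def prod_norm[symmetric] norm_mult
  proof (intro prod_le_1 conjI)
    fix i
    have "0 \<le> fejer_coeff N (k $ i)" "fejer_coeff N (k $ i) \<le> 1"
      using fejer_coeff_bounds[OF N, of "k $ i"] that by auto
    then show "norm (complex_of_real (fejer_coeff N (k $ i))) * norm (e_of (- (real_of_int (k $ i) * \<theta> $ i))) \<le> 1" by simp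
  qed auto
  have me[measurable]: "(\<lambda>x. e_of (x \<bullet> v)) \<in> borel_measurable \<mu>" for v
  proof -
    have "(\<lambda>x. e_of (x \<bullet> v)) \<in> borel_measurable borel" by (intro borel_measurable_continuous_onI continuous_intros)
    then show ?thesis using \<mu>(2) measurable_cong_sets by blast
  qed
  have ie: "integrable \<mu> (\<lambda>x. e_of (x \<bullet> v))" for v
    by (rule integrable_const_bound[of _ 1]) auto
  have iP: "integrable \<mu> (\<lambda>x. complex_of_real (P x))"
    unfolding eq by (intro Bochner_Integration.integrable_sum integrable_mult_right ie)
  have iPr: "integrable \<mu> P" using integrable_Re[OF iP] by simp
  have n1: "norm (LINT x|\<mu>. e_of (x \<bullet> real_mat (outer k q))) \<le> (if k = 0 then 1 else C * infnorm (real_vec q) powr (- t) * infnorm (real_vec k) powr (- t))" for k :: "int^'m"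
  proof (cases "k = 0")
    case True
    then have 0: "real_mat (outer k q) = 0" by (simp add: vec_eq_iff)
    show ?thesis unfolding 0 using True by (simp add: prob_space)
  next
    case False
    have l: "infnorm (- real_mat (outer k q)) = infnorm (real_vec k) * infnorm (real_vec q)"
      by (simp add: infnorm_neg infnorm_outer)
    have k1: "infnorm (real_vec k) \<ge> 1" "infnorm (real_vec q) \<ge> 1"
      using False q by (auto intro: infnorm_real_vec_ge_1)
    then have "infnorm (- real_mat (outer k q)) \<ge> 1"
      unfolding l using mult_mono[of 1 "infnorm (real_vec k)" 1 "infnorm (real_vec q)"] by simp
    then have "norm (LINT x|\<mu>. e_of (- (x \<bullet> (- real_mat (outer k q))))) \<le> C * (infnorm (real_vec k) * infnorm (real_vec q)) powr (- t)"
      using decay unfolding l[symmetric] by blast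
    then show ?thesis using False k1 by (simp add: powr_mult mult_ac)
  qed
  have "expectation P = norm (LINT x|\<mu>. complex_of_real (P x))"
    using P0 by (simp add: integral_nonneg_AE)
  also have "\<dots> = norm (\<Sum>k\<in>?K. b k * (LINT x|\<mu>. e_of (x \<bullet> real_mat (outer k q))))"
    unfolding eq by (subst Bochner_Integration.integral_sum) (auto intro: ie)
  also have "\<dots> \<le> (\<Sum>k\<in>?K. norm (b k) * norm (LINT x|\<mu>. e_of (x \<bullet> real_mat (outer k q))))"
    by (rule order.trans[OF norm_sum]) (simp add: norm_mult)
  also have "\<dots> \<le> (\<Sum>k\<in>?K. 1 * (if k = 0 then 1 else C * infnorm (real_vec q) powr (- t) * infnorm (real_vec k) powr (- t)))"
    by (intro sum_mono mult_mono b1 n1) auto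
  also have "\<dots> = 1 + C * infnorm (real_vec q) powr (- t) * (\<Sum>k\<in>?K - {0}. infnorm (real_vec k) powr (- t))"
    by (subst sum.remove[OF finK, of 0]) (auto simp: sum_distrib_left intro!: sum.cong)
  finally have EP: "expectation P \<le> 1 + C * infnorm (real_vec q) powr (- t) * (\<Sum>k\<in>?K - {0}. infnorm (real_vec k) powr (- t))" .
  have N4: "(real N / 4) ^ CARD('m) > 0" using N by simp
  have "measure \<mu> A \<le> expectation P / (real N / 4) ^ CARD('m)"
  proof -
    have "measure \<mu> A = measure \<mu> {x\<in>space \<mu>. (real N / 4) ^ CARD('m) \<le> P x}"
      using sets_eq_imp_space_eq[OF \<mu>(2)] by (simp add: A_def)
    also have "\<dots> \<le> expectation P / (real N / 4) ^ CARD('m)"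
      using iPr P0 N4 by (intro integral_Markov_inequality_measure[where A = "{}"]) auto
    finally show ?thesis .
  qed
  also have "\<dots> \<le> (1 + C * infnorm (real_vec q) powr (- t) * (\<Sum>k\<in>?K - {0}. infnorm (real_vec k) powr (- t))) / (real N / 4) ^ CARD('m)"
    using EP N4 by (intro divide_right_mono) auto
  also have "\<dots> = (4 / real N) ^ CARD('m) * (1 + C * infnorm (real_vec q) powr (- t) * (\<Sum>k\<in>?K - {0}. infnorm (real_vec k) powr (- t)))"
    by (simp add: power_divide)
  finally have mA: "measure \<mu> A \<le> \<dots>" .
  show thesis
  proof (rule that[OF cA _ mA])
    fix x assume x: "\<And>i. \<exists>r::int. \<bar>(x *v real_vec q) $ i - \<theta> $ i - real_of_int r\<bar> \<le> 1 / (6 * real N)"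
    have "fejer N (y x i) \<ge> real N / 4" for i
    proof -
      obtain r :: int where "\<bar>(x *v real_vec q) $ i - \<theta> $ i - real_of_int r\<bar> \<le> 1 / (6 * real N)"
        using x by blast
      then show ?thesis unfolding y_def by (intro fejer_near_integer[OF N, of _ r])
    qed
    then have "(\<Prod>i\<in>(UNIV::'m set). real N / 4) \<le> P x"
      unfolding P_def by (intro prod_mono) auto
    then show "x \<in> A" by (simp add: A_def)
  qed
qed

section \<open>Almost sure statements and finiteness for the limsup set\<close>

text \<open>Every point outside the support lies in a basis set of measure 0, and the basis is
  countable.\<close>

lemma AE_closed_support:
  fixes \<mu> :: "'a::euclidean_space measure"
  assumes "sets \<mu> = sets borel"
  shows "AE x in \<mu>. x \<in> closed_support \<mu>"
proof -
  obtain B :: "'a set set" where B: "countable B" "topological_basis B" using ex_countable_basis by blast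
  define B0 where "B0 = {U \<in> B. emeasure \<mu> U = 0}"
  have "- closed_support \<mu> \<subseteq> \<Union> B0"
  proof
    fix x assume "x \<in> - closed_support \<mu>"
    then obtain U where U: "open U" "x \<in> U" "emeasure \<mu> U = 0" by (auto simp: closed_support_def)
    then obtain V where V: "V \<in> B" "x \<in> V" "V \<subseteq> U" using topological_basisE[OF B(2)] by blast
    have "emeasure \<mu> V \<le> emeasure \<mu> U" using V(3) U(1) assms by (intro emeasure_mono) auto
    then show "x \<in> \<Union> B0" using U(3) V by (auto simp: B0_def)
  qed
  moreover have "\<Union> B0 \<in> null_sets \<mu>"
  proof (rule null_sets_UN'[of B0 id, simplified])
    show "countable B0" using B(1) by (auto simp: B0_def intro: countable_subset)
    show "N \<in> null_sets \<mu>" if "N \<in> B0" for N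
      using that topological_basis_open[OF B(2)] assms by (auto simp: B0_def null_sets_def)
  qed
  ultimately show ?thesis by (intro AE_I'[of "\<Union> B0"]) auto
qed

text \<open>Enumerating the index type, with empty sets at the numbers outside the image of
  \<open>I\<close>, reduces to sequences of sets.\<close>

lemma borel_cantelli_summable_on:
  fixes A :: "'i::countable \<Rightarrow> 'a set"
  assumes "finite_measure M" and A: "\<And>q. q \<in> I \<Longrightarrow> A q \<in> sets M" and s: "(\<lambda>q. measure M (A q)) summable_on I"
  shows "AE x in M. finite {q \<in> I. x \<in> A q}"
proof -
  interpret finite_measure M by fact
  define B where "B n = (if n \<in> to_nat ` I then A (from_nat n) else {})" for n
  have B: "B n \<in> sets M" for n using A by (auto simp: B_def)
  have "(\<lambda>n. measure M (B n)) summable_on (to_nat ` I)"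
    unfolding summable_on_reindex[OF inj_on_subset[OF inj_to_nat subset_UNIV]]
    using s by (rule summable_on_cong[THEN iffD1, rotated]) (auto simp: B_def)
  then have "(\<lambda>n. measure M (B n)) summable_on UNIV"
    by (rule summable_on_cong_neutral[THEN iffD1, rotated -1]) (auto simp: B_def)
  then have "summable (\<lambda>n. measure M (B n))" by (rule summable_on_imp_summable)
  then have "AE x in M. eventually (\<lambda>n. x \<in> space M - B n) sequentially"
    using B by (intro borel_cantelli_AE1) (auto simp: less_top[symmetric])
  then show ?thesis
  proof (rule AE_mp, intro AE_I2 impI)
    fix x assume "eventually (\<lambda>n. x \<in> space M - B n) sequentially"
    then obtain n0 where n0: "\<And>n. n \<ge> n0 \<Longrightarrow> x \<notin> B n" unfolding eventually_sequentially by blast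
    have "to_nat ` {q \<in> I. x \<in> A q} \<subseteq> {..<n0}"
    proof
      fix n assume "n \<in> to_nat ` {q \<in> I. x \<in> A q}"
      then have "x \<in> B n" by (auto simp: B_def)
      then show "n \<in> {..<n0}" using n0[of n] by force
    qed
    then have "finite (to_nat ` {q \<in> I. x \<in> A q})" by (rule finite_subset) simp
    then show "finite {q \<in> I. x \<in> A q}" by (rule finite_imageD) (auto intro: inj_onI)
  qed
qed

lemma finite_large_terms:
  fixes f :: "'i \<Rightarrow> real"
  assumes s: "f summable_on A" and c: "c > 0" and nn: "\<And>x. x \<in> A \<Longrightarrow> f x \<ge> 0"
  shows "finite {x \<in> A. f x \<ge> c}"
proof (rule ccontr)
  assume inf: "infinite {x \<in> A. f x \<ge> c}"
  obtain n :: nat where n: "infsum f A < real n * c" using reals_Archimedean3[OF c] by blast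
  obtain F where F: "finite F" "card F = n" "F \<subseteq> {x \<in> A. f x \<ge> c}"
    using infinite_arbitrarily_large[OF inf] by blast
  have "real n * c = (\<Sum>x\<in>F. c)" using F by simp
  also have "\<dots> \<le> sum f F" using F by (intro sum_mono) auto
  also have "\<dots> \<le> infsum f A" using F nn s by (intro finite_sum_le_infsum) auto
  finally show False using n by simp
qed

text \<open>The limsup set counts pairs (r, q). For fixed q only finitely many r qualify, so
  infinitely many pairs force infinitely many q.\<close>

lemma finite_int_vec_near:
  "finite {r :: int^'m. infnorm (v - real_vec r) < c}"
proof (rule finite_subset)
  show "{r :: int^'m. infnorm (v - real_vec r) < c} \<subseteq> {r. \<forall>i. r $ i \<in> (\<Union>i. {\<lceil>v $ i - c\<rceil>..\<lfloor>v $ i + c\<rfloor>})}"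
  proof (safe)
    fix r :: "int^'m" and i assume "infnorm (v - real_vec r) < c"
    then have "\<bar>v $ i - real_of_int (r $ i)\<bar> < c"
      using component_le_infnorm_cart[of "v - real_vec r" i] by simp
    then have "r $ i \<in> {\<lceil>v $ i - c\<rceil>..\<lfloor>v $ i + c\<rfloor>}" by (auto simp: ceiling_le_iff le_floor_iff)
    then show "r $ i \<in> (\<Union>i. {\<lceil>v $ i - c\<rceil>..\<lfloor>v $ i + c\<rfloor>})" by blast
  qed
  show "finite {r :: int^'m. \<forall>i. r $ i \<in> (\<Union>i. {\<lceil>v $ i - c\<rceil>..\<lfloor>v $ i + c\<rfloor>})}"
    by (rule prod_trig_expansion(2)) auto
qed


text \<open>Below m the sum grows like N^(m - t), above m it is bounded; a single formula covers
  both. At t = m a logarithm would appear.\<close>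

lemma sum_int_vec_powr_bound:
  fixes t :: real
  assumes t: "t \<ge> 0" "t \<noteq> real CARD('m)"
  obtains c where "c \<ge> 0" "\<And>N. N > 0 \<Longrightarrow>
    (\<Sum>k\<in>{k :: int^'m. \<forall>i. k $ i \<in> {- int N..int N}} - {0}. infnorm (real_vec k) powr (- t))
      \<le> c * (1 + real N powr (real CARD('m) - t))"
proof (cases "t < real CARD('m)")
  case True
  define s where "s = t / real CARD('m)"
  have s: "0 \<le> s" "s < 1" using True t by (auto simp: s_def field_simps)
  show thesis
  proof (rule that[of "(3 / (1 - s)) ^ CARD('m)"])
    show "(3 / (1 - s)) ^ CARD('m) \<ge> 0" using s by simp
    fix N :: nat assume N: "N > 0"
    have "(\<Sum>k\<in>{k :: int^'m. \<forall>i. k $ i \<in> {- int N..int N}} - {0}. infnorm (real_vec k) powr (- t))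
       \<le> (3 / (1 - s) * real N powr (1 - s)) ^ CARD('m)"
    proof (rule sum_int_vec_powr[OF t(1)])
      fix S assume "finite S" "S \<subseteq> {- int N..int N}"
      then have "(\<Sum>z\<in>S. max 1 \<bar>real_of_int z\<bar> powr (- s)) \<le> (\<Sum>z\<in>{- int N..int N}. max 1 \<bar>real_of_int z\<bar> powr (- s))"
        by (intro sum_mono2) auto
      also have "\<dots> \<le> 3 / (1 - s) * real N powr (1 - s)" by (rule sum_int_powr_lt_1[OF s N])
      finally show "(\<Sum>z\<in>S. max 1 \<bar>real_of_int z\<bar> powr (- (t / real CARD('m)))) \<le> 3 / (1 - s) * real N powr (1 - s)"
        by (simp add: s_def)
    qed
    also have "\<dots> = (3 / (1 - s)) ^ CARD('m) * (real N powr (1 - s)) ^ CARD('m)"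
      by (rule power_mult_distrib)
    also have "(real N powr (1 - s)) ^ CARD('m) = real N powr ((1 - s) * real CARD('m))"
      using N by (subst powr_realpow[symmetric]) (auto simp: powr_powr)
    also have "(1 - s) * real CARD('m) = real CARD('m) - t"
      by (simp add: s_def left_diff_distrib)
    also have "(3 / (1 - s)) ^ CARD('m) * real N powr (real CARD('m) - t)
        \<le> (3 / (1 - s)) ^ CARD('m) * (1 + real N powr (real CARD('m) - t))"
      using s by (intro mult_left_mono) auto
    finally show "(\<Sum>k\<in>{k :: int^'m. \<forall>i. k $ i \<in> {- int N..int N}} - {0}. infnorm (real_vec k) powr (- t))
      \<le> (3 / (1 - s)) ^ CARD('m) * (1 + real N powr (real CARD('m) - t))" .
  qed
next
  case False
  define s where "s = t / real CARD('m)"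
  have s: "s > 1" using False t by (auto simp: s_def field_simps)
  obtain C where C: "C > 0" "\<And>N. (\<Sum>z\<in>{- int N..int N}. max 1 \<bar>real_of_int z\<bar> powr (- s)) \<le> C"
    using sum_int_powr_gt_1[OF s] by blast
  show thesis
  proof (rule that[of "C ^ CARD('m)"])
    show "C ^ CARD('m) \<ge> 0" using C by simp
    fix N :: nat
    have "(\<Sum>k\<in>{k :: int^'m. \<forall>i. k $ i \<in> {- int N..int N}} - {0}. infnorm (real_vec k) powr (- t))
       \<le> C ^ CARD('m)"
    proof (rule sum_int_vec_powr[OF t(1)])
      fix S assume "finite S" "S \<subseteq> {- int N..int N}"
      then have "(\<Sum>z\<in>S. max 1 \<bar>real_of_int z\<bar> powr (- s)) \<le> (\<Sum>z\<in>{- int N..int N}. max 1 \<bar>real_of_int z\<bar> powr (- s))"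
        by (intro sum_mono2) auto
      also have "\<dots> \<le> C" by (rule C(2))
      finally show "(\<Sum>z\<in>S. max 1 \<bar>real_of_int z\<bar> powr (- (t / real CARD('m)))) \<le> C"
        by (simp add: s_def)
    qed
    also have "\<dots> \<le> C ^ CARD('m) * (1 + real N powr (real CARD('m) - t))" using C by simp
    finally show "(\<Sum>k\<in>{k :: int^'m. \<forall>i. k $ i \<in> {- int N..int N}} - {0}. infnorm (real_vec k) powr (- t))
      \<le> C ^ CARD('m) * (1 + real N powr (real CARD('m) - t))" .
  qed
qed

lemma fourier_transform_e_of: "fourier_transform \<mu> \<xi> = (LINT x|\<mu>. e_of (- (x \<bullet> \<xi>)))"
  unfolding fourier_transform_def e_of_def cis_conv_exp by (simp add: mult_ac)

text \<open>With N of order 1/Psi(q), the majorant gives the neighbourhood of q mass O(Psi(q)^m +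
  Psi_*(q)^t). Both terms are summable, so almost every x, in particular some x in the support, is
  approximated by only finitely many q.\<close>

lemma no_measure_with_large_decay:
  fixes Q :: "(int^'n) set" and \<Psi> :: "int^'n \<Rightarrow> real" and \<theta> :: "real^'m"
  assumes \<Psi>: "\<And>q. \<Psi> q \<ge> 0" and sm: "(\<lambda>q. \<Psi> q ^ CARD('m)) summable_on Q"
    and \<mu>: "\<mu> \<in> prob_measures_on (E_set Q \<Psi> \<theta>)" and C: "C > 0"
    and decay: "\<And>\<xi>. infnorm \<xi> \<ge> 1 \<Longrightarrow> cmod (fourier_transform \<mu> \<xi>) \<le> C * infnorm \<xi> powr (- t)"
    and t: "t \<ge> 0" "t \<noteq> real CARD('m)"
    and st: "(\<lambda>q. Psi_star \<Psi> q powr t) summable_on {q \<in> Q. q \<noteq> 0}"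
  shows False
proof -
  have p: "prob_space \<mu>" "sets \<mu> = sets borel" "closed_support \<mu> \<subseteq> E_set Q \<Psi> \<theta>"
    using \<mu> by (auto simp: prob_measures_on_def)
  interpret prob_space \<mu> by fact
  let ?m = "CARD('m)"
  \<comment> \<open>The omitted q are 0, those with Psi(q) = 0, for which no r qualifies, and
    finitely many with Psi(q) > 1/6. The bound 1/6 makes \<open>N q\<close> positive.\<close>
  define Q' where "Q' = {q \<in> Q. q \<noteq> 0 \<and> 0 < \<Psi> q \<and> \<Psi> q \<le> 1/6}"
  define N where "N q = nat \<lfloor>1 / (6 * \<Psi> q)\<rfloor>" for q
  obtain c where c: "c \<ge> 0" "\<And>N. N > 0 \<Longrightarrow>
    (\<Sum>k\<in>{k :: int^'m. \<forall>i. k $ i \<in> {- int N..int N}} - {0}. infnorm (real_vec k) powr (- t))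
      \<le> c * (1 + real N powr (real ?m - t))"
    using sum_int_vec_powr_bound[OF t] by blast
  \<comment> \<open>Rounding down loses at most a factor of 2, so 1/N <= 2 * 6 Psi(q).\<close>
  have N: "N q > 0" "\<Psi> q \<le> 1 / (6 * real (N q))" "1 / real (N q) \<le> 12 * \<Psi> q" if q: "q \<in> Q'" for q
  proof -
    define u where "u = 1 / (6 * \<Psi> q)"
    have pos: "\<Psi> q > 0" "\<Psi> q \<le> 1/6" using q by (auto simp: Q'_def)
    then have u1: "u \<ge> 1" by (simp add: u_def field_simps)
    then have "1 \<le> \<lfloor>u\<rfloor>" by (simp add: le_floor_iff)
    then have Nr: "real (N q) = of_int \<lfloor>u\<rfloor>"
      unfolding N_def u_def[symmetric] by (intro of_nat_nat) linarith
    then have N1: "real (N q) \<ge> 1" using \<open>1 \<le> \<lfloor>u\<rfloor>\<close> by simp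
    then show "N q > 0" by simp
    have le: "real (N q) \<le> u" unfolding Nr by (rule of_int_floor_le)
    then have "\<Psi> q * (6 * real (N q)) \<le> 1" using pos by (simp add: u_def field_simps)
    then show "\<Psi> q \<le> 1 / (6 * real (N q))" using N1 by (simp add: field_simps)
    have "u < real (N q) + 1" unfolding Nr by (rule real_of_int_floor_add_one_gt)
    then have "u \<le> 2 * real (N q)" using N1 by linarith
    then show "1 / real (N q) \<le> 12 * \<Psi> q" using N1 pos by (simp add: u_def field_simps)
  qed
  \<comment> \<open>48 = 4 * 12 combines the 4/N of the majorant with 1/N <= 12 Psi(q).\<close>
  define c1 where "c1 = 48 ^ ?m * (1 + C * c)"
  define c2 where "c2 = 4 ^ ?m * C * c * 12 powr t"
  have "\<exists>A. closed A \<and> (\<forall>x. (\<forall>i. \<exists>r::int. \<bar>(x *v real_vec q) $ i - \<theta> $ i - real_of_int r\<bar> \<le> \<Psi> q) \<longrightarrow> x \<in> A)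
      \<and> measure \<mu> A \<le> c1 * \<Psi> q ^ ?m + c2 * Psi_star \<Psi> q powr t" if q: "q \<in> Q'" for q
  proof -
    have q0: "q \<noteq> 0" and Npos: "N q > 0" using q N by (auto simp: Q'_def)
    define a where "a = infnorm (real_vec q)"
    have a1: "a \<ge> 1" unfolding a_def by (rule infnorm_real_vec_ge_1[OF q0])
    define n where "n = real (N q)"
    have n: "n > 0" "1 / n \<le> 12 * \<Psi> q" using N[OF q] by (auto simp: n_def)
    obtain A where A: "closed A"
      "\<And>x. (\<And>i. \<exists>r::int. \<bar>(x *v real_vec q) $ i - \<theta> $ i - real_of_int r\<bar> \<le> 1 / (6 * real (N q))) \<Longrightarrow> x \<in> A"
      "measure \<mu> A \<le> (4 / n) ^ ?m * (1 + C * a powr (- t) *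
        (\<Sum>k\<in>{k :: int^'m. \<forall>i. k $ i \<in> {- int (N q)..int (N q)}} - {0}. infnorm (real_vec k) powr (- t)))"
      using hyperplane_neighbourhood_majorant[OF p(1,2) decay[unfolded fourier_transform_e_of] C q0 Npos, of \<theta>]
      unfolding a_def n_def by blast
    have "measure \<mu> A \<le> (4 / n) ^ ?m * (1 + C * a powr (- t) * (c * (1 + n powr (real ?m - t))))"
      using A(3) c(2)[OF Npos] C n
      by (elim order.trans) (intro mult_left_mono add_left_mono, auto simp: n_def)
    also have "\<dots> = (4 / n) ^ ?m * (1 + C * c * a powr (- t)) + 4 ^ ?m * C * c * a powr (- t) * (n powr (real ?m - t) / n ^ ?m)"
      by (simp add: power_divide algebra_simps add_divide_distrib)
    \<comment> \<open>The m-th powers cancel; what remains, n^(-t) |q|^(-t), is of order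
      Psi_*(q)^t.\<close>
    also have "n powr (real ?m - t) / n ^ ?m = (1 / n) powr t"
      using n by (simp add: powr_diff powr_realpow powr_divide)
    also have "(4 / n) ^ ?m * (1 + C * c * a powr (- t)) \<le> (48 * \<Psi> q) ^ ?m * (1 + C * c)"
    proof (rule mult_mono)
      have "C * c * a powr (- t) \<le> C * c"
        using C c(1) a1 t powr_mono2'[of "- t" 1 a] by (intro mult_left_le) auto
      then show "1 + C * c * a powr (- t) \<le> 1 + C * c" by simp
      show "(4 / n) ^ ?m \<le> (48 * \<Psi> q) ^ ?m" using n by (intro power_mono) auto
    qed (use C c \<Psi>[of q] in auto)
    also have "4 ^ ?m * C * c * a powr (- t) * (1 / n) powr t \<le> 4 ^ ?m * C * c * a powr (- t) * (12 * \<Psi> q) powr t"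
      using n C c t by (intro mult_left_mono powr_mono2) auto
    also have "\<dots> = c2 * Psi_star \<Psi> q powr t"
      using a1 \<Psi>[of q] by (simp add: c2_def Psi_star_def a_def[symmetric] powr_mult powr_divide powr_minus field_simps)
    also have "(48 * \<Psi> q) ^ ?m * (1 + C * c) = c1 * \<Psi> q ^ ?m" by (simp add: c1_def power_mult_distrib)
    finally have "measure \<mu> A \<le> c1 * \<Psi> q ^ ?m + c2 * Psi_star \<Psi> q powr t" by simp
    moreover have "x \<in> A" if x: "\<forall>i. \<exists>r::int. \<bar>(x *v real_vec q) $ i - \<theta> $ i - real_of_int r\<bar> \<le> \<Psi> q" for x
      using A(2)[of x] x N(2)[OF q] by (meson order.trans)
    ultimately show ?thesis using A(1) by blast
  qed
  then obtain A where A: "\<And>q. q \<in> Q' \<Longrightarrow> closed (A q)"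
      "\<And>q x. q \<in> Q' \<Longrightarrow> (\<And>i. \<exists>r::int. \<bar>(x *v real_vec q) $ i - \<theta> $ i - real_of_int r\<bar> \<le> \<Psi> q) \<Longrightarrow> x \<in> A q"
      "\<And>q. q \<in> Q' \<Longrightarrow> measure \<mu> (A q) \<le> c1 * \<Psi> q ^ ?m + c2 * Psi_star \<Psi> q powr t"
    by metis
  have "(\<lambda>q. c1 * \<Psi> q ^ ?m + c2 * Psi_star \<Psi> q powr t) summable_on Q'"
    by (intro summable_on_add summable_on_cmult_right summable_on_subset_banach[OF sm] summable_on_subset_banach[OF st])
       (auto simp: Q'_def)
  then have "(\<lambda>q. measure \<mu> (A q)) summable_on Q'"
    by (rule summable_on_comparison_test) (use A(3) in auto)
  then have "AE x in \<mu>. finite {q \<in> Q'. x \<in> A q}"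
    using A(1) p(2) by (intro borel_cantelli_summable_on) (auto intro: finite_measure_axioms)
  moreover have "AE x in \<mu>. x \<in> closed_support \<mu>" by (rule AE_closed_support[OF p(2)])
  ultimately have "AE x in \<mu>. False"
  proof eventually_elim
    case (elim x)
    let ?P = "{(r :: int^'m, q). q \<in> Q \<and> infnorm (x *v real_vec q - real_vec r - \<theta>) < \<Psi> q}"
    \<comment> \<open>A finite set containing every q that occurs in a solution at x.\<close>
    define R where "R = {q \<in> Q. q = 0 \<or> \<Psi> q ^ ?m \<ge> (1/6) ^ ?m} \<union> {q \<in> Q'. x \<in> A q}"
    have "finite {q \<in> Q. q = 0 \<or> \<Psi> q ^ ?m \<ge> (1/6) ^ ?m}"
    proof (rule finite_subset)
      show "finite (insert 0 {q \<in> Q. \<Psi> q ^ ?m \<ge> (1/6) ^ ?m})"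
        using finite_large_terms[OF sm, of "(1/6) ^ ?m"] \<Psi> by simp
    qed auto
    then have finR: "finite R" using elim(1) by (simp add: R_def)
    have "?P \<subseteq> (\<Union>q\<in>R. (\<lambda>r. (r, q)) ` {r. infnorm ((x *v real_vec q - \<theta>) - real_vec r) < \<Psi> q})"
    proof
      fix p assume "p \<in> ?P"
      then obtain r q where rq: "p = (r, q)" "q \<in> Q" "infnorm (x *v real_vec q - real_vec r - \<theta>) < \<Psi> q" by auto
      then have pos: "\<Psi> q > 0" using infnorm_pos_le le_less_trans by blast
      have lt: "infnorm ((x *v real_vec q - \<theta>) - real_vec r) < \<Psi> q" using rq(3) by (simp add: algebra_simps)
      have "q \<in> R"
      proof (cases "q = 0 \<or> \<Psi> q ^ ?m \<ge> (1/6) ^ ?m")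
        case False
        then have "\<Psi> q \<le> 1/6" using power_mono[of "1/6" "\<Psi> q" ?m] by linarith
        then have qQ: "q \<in> Q'" using False pos rq(2) by (auto simp: Q'_def)
        moreover have "x \<in> A q"
        proof (rule A(2)[OF qQ])
          fix i
          have "\<bar>(x *v real_vec q) $ i - \<theta> $ i - real_of_int (r $ i)\<bar> \<le> \<Psi> q"
            using component_le_infnorm_cart[of "(x *v real_vec q - \<theta>) - real_vec r" i] lt by simp
          then show "\<exists>r::int. \<bar>(x *v real_vec q) $ i - \<theta> $ i - real_of_int r\<bar> \<le> \<Psi> q" by blast
        qed
        ultimately show ?thesis by (simp add: R_def)
      qed (use rq(2) in \<open>auto simp: R_def\<close>)
      then show "p \<in> (\<Union>q\<in>R. (\<lambda>r. (r, q)) ` {r. infnorm ((x *v real_vec q - \<theta>) - real_vec r) < \<Psi> q})"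
        using lt rq(1) by auto
    qed
    moreover have "finite (\<Union>q\<in>R. (\<lambda>r. (r, q)) ` {r :: int^'m. infnorm ((x *v real_vec q - \<theta>) - real_vec r) < \<Psi> q})"
      by (intro finite_UN_I finR finite_imageI finite_int_vec_near)
    ultimately have "finite ?P" by (rule finite_subset)
    then show False using elim(2) p(3) by (auto simp: E_set_def)
  qed
  then show False by simp
qed

subsection \<open>One step of the construction\<close>

lemma inj_outer: "q \<noteq> 0 \<Longrightarrow> inj (\<lambda>k. outer k q)"
proof (rule injI)
  fix k k' assume q: "q \<noteq> 0" and eq: "outer k q = outer k' q"
  obtain j where j: "q $ j \<noteq> 0" using q by (auto simp: vec_eq_iff)
  have "k $ i * q $ j = k' $ i * q $ j" for i using eq by (metis outer_nth)
  then show "k = k'" using j by (simp add: vec_eq_iff)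
qed

text \<open>Two coefficient bounds serve different ends. The one of order t has a constant depending
  only on \<open>M\<close> and \<open>t\<close>, so that averaging over q can later make the error
  small. The one of order \<open>M\<close> has a constant depending on q and \<open>\<psi>\<close>,
  and only shows that the product retains decay of order \<open>D\<close>. The term k = 0 is split
  off because it reproduces \<open>ftw \<mu> G\<close>.\<close>

lemma multiply_hyperplane_bump:
  fixes \<mu> :: "(real^'n^'m) measure" and \<theta> :: "real^'m" and q :: "int^'n" and D t \<psi> :: real and M :: nat
  assumes \<mu>: "prob_space \<mu>" "sets \<mu> = sets borel"
    and G: "continuous_on UNIV G" "\<And>x. \<bar>G x\<bar> \<le> BG"
    and CG: "CG > 0" "\<And>\<xi>. norm (ftw \<mu> G \<xi>) \<le> CG * (1 + infnorm \<xi>) powr (- D)"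
    and q: "q \<noteq> 0" and \<psi>: "0 < \<psi>" "\<psi> \<le> 1" and D: "D \<ge> 0" and t: "t > 0"
    and M: "M \<ge> 1" "real M \<ge> t" "real M \<ge> D + real (2 * CARD('m) * CARD('n))"
  obtains F b K B C where "continuous_on UNIV F" "\<And>x. 0 \<le> F x" "\<And>x. F x \<le> B"
    "\<And>x i. F x \<noteq> 0 \<Longrightarrow> \<exists>r::int. \<bar>(x *v real_vec q) $ i - \<theta> $ i - real_of_int r\<bar> \<le> \<psi> / 2"
    "\<And>n. finite (K n)"
    "\<And>\<xi>. (\<lambda>n. \<Sum>k\<in>K n - {0}. b n k * ftw \<mu> G (\<xi> - real_mat (outer k q))) \<longlonglongrightarrow> ftw \<mu> (\<lambda>x. G x * F x) \<xi> - ftw \<mu> G \<xi>"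
    "\<And>n k. k \<noteq> 0 \<Longrightarrow> norm (b n k) \<le> (2 * (real M + 1) / pi) powr t * (\<psi> * infnorm (real_vec k)) powr (- t)"
    "\<And>\<xi>. norm (ftw \<mu> (\<lambda>x. G x * F x) \<xi>) \<le> C * (1 + infnorm \<xi>) powr (- D)"
proof -
  \<comment> \<open>Chosen so that the bump has radius (M+1) \<open>\<delta>\<close> =
    \<open>\<psi>\<close>/2. The halving leaves room for the strict inequality on the closed support
    of the weak limit.\<close>
  define \<delta> where "\<delta> = \<psi> / (2 * (real M + 1))"
  have "\<delta> \<le> 1 / 4" unfolding \<delta>_def using \<psi> M by (intro frac_le) auto
  then have \<delta>: "0 < \<delta>" "\<delta> < 1/2" using \<psi> by (auto simp: \<delta>_def)
  have M\<delta>: "real (Suc M) * \<delta> = \<psi> / 2" by (simp add: \<delta>_def field_simps)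
  obtain F :: "real^'n^'m \<Rightarrow> real" and b :: "nat \<Rightarrow> int^'m \<Rightarrow> complex" and K :: "nat \<Rightarrow> (int^'m) set" and B :: real
  where F: "continuous_on UNIV F" "\<And>x. 0 \<le> F x" "\<And>x. F x \<le> B"
    and supp: "\<And>x i. F x \<noteq> 0 \<Longrightarrow> \<exists>r::int. \<bar>(x *v real_vec q) $ i - \<theta> $ i - real_of_int r\<bar> \<le> real (Suc M) * \<delta>"
    and K: "\<And>n. finite (K n)" "\<And>n. 0 \<in> K n"
    and b: "\<And>n. b n 0 = 1" "\<And>n k. norm (b n k) \<le> 1"
    "\<And>n k. k \<noteq> 0 \<Longrightarrow> norm (b n k) \<le> (1 / (pi * \<delta> * infnorm (real_vec k))) ^ M"
    and lim: "\<And>x. (\<lambda>n. \<Sum>k\<in>K n. b n k * e_of (x \<bullet> real_mat (outer k q))) \<longlonglongrightarrow> complex_of_real (F x)"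
    "\<And>n x. norm (\<Sum>k\<in>K n. b n k * e_of (x \<bullet> real_mat (outer k q))) \<le> B"
    by (rule hyperplane_bump[OF \<delta>, where M = M and \<theta> = \<theta> and q = q]) (rule that)
  have l1: "(\<lambda>n. \<Sum>k\<in>K n. b n k * ftw \<mu> G (\<xi> - real_mat (outer k q))) \<longlonglongrightarrow> ftw \<mu> (\<lambda>x. G x * F x) \<xi>" for \<xi>
    by (rule ftw_mult_series[OF \<mu> G F(1) lim])
  have o0: "real_mat (outer 0 q) = (0 :: real^'n^'m)" by (simp add: vec_eq_iff)
  have split: "(\<Sum>k\<in>K n. b n k * ftw \<mu> G (\<xi> - real_mat (outer k q)))
      = ftw \<mu> G \<xi> + (\<Sum>k\<in>K n - {0}. b n k * ftw \<mu> G (\<xi> - real_mat (outer k q)))" for n \<xi>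
    by (subst sum.remove[OF K]) (simp add: b(1) o0)
  have l2: "(\<lambda>n. \<Sum>k\<in>K n - {0}. b n k * ftw \<mu> G (\<xi> - real_mat (outer k q))) \<longlonglongrightarrow> ftw \<mu> (\<lambda>x. G x * F x) \<xi> - ftw \<mu> G \<xi>" for \<xi>
    using tendsto_diff[OF l1[of \<xi>] tendsto_const[of "ftw \<mu> G \<xi>"]] unfolding split by simp
  have coeff: "norm (b n k) \<le> (2 * (real M + 1) / pi) powr t * (\<psi> * infnorm (real_vec k)) powr (- t)" if k: "k \<noteq> 0" for n k
  proof -
    define a where "a = infnorm (real_vec k)"
    have a: "a \<ge> 1" unfolding a_def by (rule infnorm_real_vec_ge_1[OF k])
    define u where "u = 1 / (pi * \<delta> * a)"
    have u0: "u > 0" using \<delta> a by (simp add: u_def)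
    \<comment> \<open>An interpolation: for u >= 1 the trivial bound 1 is enough, and for u < 1 one
      has u^M <= u^t since M >= t.\<close>
    have "norm (b n k) \<le> u powr t"
    proof (cases "u \<ge> 1")
      case True
      then have "1 \<le> u powr t" using t by (intro ge_one_powr_ge_zero) auto
      then show ?thesis using b(2)[of n k] by linarith
    next
      case False
      have "norm (b n k) \<le> u ^ M" using b(3)[OF k] by (simp add: u_def a_def)
      also have "\<dots> = u powr real M" using u0 by (simp add: powr_realpow)
      also have "\<dots> \<le> u powr t" using False u0 M by (intro powr_mono') auto
      finally show ?thesis .
    qed
    also have "u = (2 * (real M + 1) / pi) * (1 / (\<psi> * a))" by (simp add: u_def \<delta>_def)
    also have "\<dots> powr t = (2 * (real M + 1) / pi) powr t * (1 / (\<psi> * a)) powr t"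
      by (rule powr_mult)
    also have "(1 / (\<psi> * a)) powr t = (\<psi> * a) powr (- t)"
      by (subst powr_divide) (use a \<psi> in \<open>auto simp: powr_minus_divide\<close>)
    finally show ?thesis by (simp add: a_def)
  qed
  define Q where "Q = infnorm (real_vec q)"
  have Q1: "Q \<ge> 1" unfolding Q_def by (rule infnorm_real_vec_ge_1[OF q])
  \<comment> \<open>The second entry comes from 1 + v <= 2 Q a, where v = a Q is the norm of k (x)
    q; the first covers k = 0.\<close>
  define C1 where "C1 = max 1 ((2 * Q / (pi * \<delta>)) ^ M)"
  have C1: "C1 \<ge> 1" by (simp add: C1_def)
  have dec: "norm (b n k) \<le> C1 * (1 + infnorm (real_mat (outer k q) :: real^'n^'m)) powr (- real M)" for n k
  proof (cases "k = 0")
    case True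
    then show ?thesis using C1 by (simp add: o0 b(1) infnorm_0)
  next
    case False
    define a where "a = infnorm (real_vec k)"
    have a: "a \<ge> 1" unfolding a_def by (rule infnorm_real_vec_ge_1[OF False])
    define v where "v = infnorm (real_mat (outer k q) :: real^'n^'m)"
    have v: "v = a * Q" by (simp add: v_def a_def Q_def infnorm_outer)
    have v1: "v \<ge> 1" unfolding v using mult_mono[of 1 a 1 Q] a Q1 by simp
    have "1 / (pi * \<delta> * a) \<le> (2 * Q / (pi * \<delta>)) * (1 / (1 + v))"
    proof -
      have "1 + v \<le> 2 * Q * a" using v v1 by (simp add: mult_ac)
      then have "1 / a \<le> 2 * Q / (1 + v)" using a v1 by (simp add: field_simps)
      then have "1 / (pi * \<delta>) * (1 / a) \<le> 1 / (pi * \<delta>) * (2 * Q / (1 + v))"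
        using \<delta> by (intro mult_left_mono) auto
      then show ?thesis by simp
    qed
    then have "(1 / (pi * \<delta> * a)) ^ M \<le> ((2 * Q / (pi * \<delta>)) * (1 / (1 + v))) ^ M"
      using a \<delta> by (intro power_mono) auto
    also have "\<dots> = (2 * Q / (pi * \<delta>)) ^ M * (1 + v) powr (- real M)"
      using v1 by (simp add: power_mult_distrib powr_minus powr_realpow power_divide divide_inverse power_inverse)
    also have "\<dots> \<le> C1 * (1 + v) powr (- real M)" unfolding C1_def by (intro mult_right_mono) auto
    finally show ?thesis using b(3)[OF False, of n] by (simp add: a_def v_def)
  qed
  have bound: "norm (\<Sum>k\<in>K n. b n k * ftw \<mu> G (\<xi> - real_mat (outer k q))) \<le> C1 * CG * 16 ^ (CARD('m) * CARD('n)) * (1 + infnorm \<xi>) powr (- D)" for n \<xi>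
  proof -
    let ?v = "\<lambda>k. real_mat (outer k q) :: real^'n^'m"
    have "norm (\<Sum>k\<in>K n. b n k * ftw \<mu> G (\<xi> - ?v k)) \<le> (\<Sum>k\<in>K n. norm (b n k) * norm (ftw \<mu> G (\<xi> - ?v k)))"
      by (rule order.trans[OF norm_sum]) (simp add: norm_mult)
    also have "\<dots> \<le> (\<Sum>k\<in>K n. C1 * CG * (1 + infnorm \<xi>) powr (- D) * (1 + infnorm (?v k)) powr (- real (2 * CARD('m) * CARD('n))))"
    proof (rule sum_mono)
      fix k
      define v where "v = 1 + infnorm (?v k)"
      define w where "w = 1 + infnorm (\<xi> - ?v k)"
      define x where "x = 1 + infnorm \<xi>"
      have ge: "v \<ge> 1" "w \<ge> 1" "x \<ge> 1" by (auto simp: v_def w_def x_def infnorm_pos_le)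
      have "x \<le> v * w" using one_plus_infnorm_submult[of "?v k" "\<xi> - ?v k"] by (simp add: v_def w_def x_def)
      then have "x powr D \<le> (v * w) powr D" using ge D by (intro powr_mono2) auto
      also have "\<dots> = v powr D * w powr D" using ge by (simp add: powr_mult)
      finally have "w powr (- D) \<le> v powr D * x powr (- D)"
        using ge by (simp add: powr_minus field_simps)
      then have "norm (ftw \<mu> G (\<xi> - ?v k)) \<le> CG * (v powr D * x powr (- D))"
        using CG(2)[of "\<xi> - ?v k"] CG(1) by (elim order.trans) (auto simp: w_def intro!: mult_left_mono)
      then have "norm (b n k) * norm (ftw \<mu> G (\<xi> - ?v k)) \<le> (C1 * v powr (- real M)) * (CG * (v powr D * x powr (- D)))"
        using dec[of n k] C1 by (intro mult_mono) (auto simp: v_def)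
      also have "\<dots> = C1 * CG * x powr (- D) * v powr (D - real M)"
        using ge by (simp add: powr_diff powr_minus field_simps)
      also have "\<dots> \<le> C1 * CG * x powr (- D) * v powr (- real (2 * CARD('m) * CARD('n)))"
        using C1 CG(1) ge M(3) by (intro mult_left_mono powr_mono) auto
      finally show "norm (b n k) * norm (ftw \<mu> G (\<xi> - ?v k)) \<le> C1 * CG * (1 + infnorm \<xi>) powr (- D) * (1 + infnorm (?v k)) powr (- real (2 * CARD('m) * CARD('n)))"
        by (simp add: v_def x_def)
    qed
    also have "\<dots> = C1 * CG * (1 + infnorm \<xi>) powr (- D) * (\<Sum>k\<in>K n. (1 + infnorm (?v k)) powr (- real (2 * CARD('m) * CARD('n))))"
      by (rule sum_distrib_left[symmetric])
    finally have le: "norm (\<Sum>k\<in>K n. b n k * ftw \<mu> G (\<xi> - ?v k)) \<le> \<dots>" .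
    have "(\<Sum>k\<in>K n. (1 + infnorm (?v k)) powr (- real (2 * CARD('m) * CARD('n))))
       = (\<Sum>l\<in>(\<lambda>k. outer k q) ` K n. (1 + infnorm (0 - (real_mat l :: real^'n^'m))) powr (- real (2 * CARD('m) * CARD('n))))"
      by (subst sum.reindex[OF inj_on_subset[OF inj_outer[OF q] subset_UNIV]]) (simp add: infnorm_neg)
    also have "\<dots> \<le> 16 ^ (CARD('m) * CARD('n))"
      using K by (intro lattice_sum_bound) auto
    finally have "(\<Sum>k\<in>K n. (1 + infnorm (?v k)) powr (- real (2 * CARD('m) * CARD('n)))) \<le> 16 ^ (CARD('m) * CARD('n))" .
    then have "C1 * CG * (1 + infnorm \<xi>) powr (- D) * (\<Sum>k\<in>K n. (1 + infnorm (?v k)) powr (- real (2 * CARD('m) * CARD('n))))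
       \<le> C1 * CG * (1 + infnorm \<xi>) powr (- D) * 16 ^ (CARD('m) * CARD('n))"
      using C1 CG(1) by (intro mult_left_mono) auto
    with le show ?thesis by (simp add: mult_ac)
  qed
  have "norm (ftw \<mu> (\<lambda>x. G x * F x) \<xi>) \<le> C1 * CG * 16 ^ (CARD('m) * CARD('n)) * (1 + infnorm \<xi>) powr (- D)" for \<xi>
    using bound by (intro Lim_bounded[OF tendsto_norm[OF l1]]) auto
  then show thesis using that[OF F supp[unfolded M\<delta>] K(1) l2 coeff] by blast
qed

text \<open>With weights Psi_*(q)^t / S the coefficient bound (Psi(q) |k|)^(-t) becomes |k (x)
  q|^(-t) / S, and \<open>rank_one_sum_bound\<close> sums this against the decay of the transform of
  G. All other constants are fixed before \<open>V\<close> is chosen, so divergence lets S outweigh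
  them. \<open>U\<close> holds the q that are already spent.\<close>

lemma one_step:
  fixes \<mu> :: "(real^'n^'m) measure" and \<theta> :: "real^'m" and Q U :: "(int^'n) set" and \<Psi> :: "int^'n \<Rightarrow> real"
  assumes \<mu>: "prob_space \<mu>" "sets \<mu> = sets borel"
    and G: "continuous_on UNIV G" "\<And>x. \<bar>G x\<bar> \<le> BG"
    and CG: "CG > 0" "\<And>\<xi>. norm (ftw \<mu> G \<xi>) \<le> CG * (1 + infnorm \<xi>) powr (- D)"
    and t: "0 < t'" "t' < t" and D: "D \<ge> t' + real (2 * CARD('m) * CARD('n))"
    and \<Psi>: "\<And>q. \<Psi> q \<ge> 0" and U: "finite U"
    and div: "\<not> (\<lambda>q. Psi_star \<Psi> q powr t) summable_on {q \<in> Q. q \<noteq> 0}"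
    and fin: "finite {q \<in> Q. \<Psi> q > 1}" and \<epsilon>: "\<epsilon> > 0"
  obtains F V BF C where "continuous_on UNIV F" "\<And>x. 0 \<le> F x" "\<And>x. F x \<le> BF"
    "finite V" "V \<subseteq> Q - U" "\<And>q. q \<in> V \<Longrightarrow> 0 < \<Psi> q \<and> \<Psi> q \<le> 1"
    "\<And>x. F x \<noteq> 0 \<Longrightarrow> \<exists>q\<in>V. \<forall>i. \<exists>r::int. \<bar>(x *v real_vec q) $ i - \<theta> $ i - real_of_int r\<bar> \<le> \<Psi> q / 2"
    "\<And>\<xi>. norm (ftw \<mu> (\<lambda>x. G x * F x) \<xi> - ftw \<mu> G \<xi>) \<le> \<epsilon> * (1 + infnorm \<xi>) powr (- t')"
    "C > 0" "\<And>\<xi>. norm (ftw \<mu> (\<lambda>x. G x * F x) \<xi>) \<le> C * (1 + infnorm \<xi>) powr (- D)"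
proof -
  define M where "M = nat \<lceil>max t (D + real (2 * CARD('m) * CARD('n)))\<rceil> + 1"
  have M: "M \<ge> 1" "real M \<ge> t" "real M \<ge> D + real (2 * CARD('m) * CARD('n))"
    unfolding M_def by linarith+
  have D0: "D \<ge> 0" using D t by (smt (verit) of_nat_0_le_iff)
  have t0: "t > 0" using t by simp
  obtain C0 where C0: "C0 > 0"
    "\<And>P (\<xi> :: real^'n^'m). \<lbrakk>finite P; \<And>k q. (k, q) \<in> P \<Longrightarrow> k \<noteq> 0 \<and> q \<noteq> 0\<rbrakk> \<Longrightarrow>
      (\<Sum>(k, q)\<in>P. infnorm (real_mat (outer k q)) powr (- t) * (1 + infnorm (\<xi> - real_mat (outer k q))) powr (- D))
        \<le> C0 * (1 + infnorm \<xi>) powr (- t')"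
    using rank_one_sum_bound[OF t D] by blast
  define A where "A = (2 * (real M + 1) / pi) powr t"
  have A0: "A > 0" by (simp add: A_def)
  \<comment> \<open>The final error constant is A CG C0 / S, which is at most
    \<open>\<epsilon>\<close> once S exceeds this threshold; the 1 keeps S positive.\<close>
  define S0 where "S0 = max 1 (A * CG * C0 / \<epsilon>)"
  \<comment> \<open>Only finitely many terms and terms equal to 0 are removed, so divergence
    persists.\<close>
  define Q' where "Q' = {q \<in> Q. q \<noteq> 0 \<and> 0 < \<Psi> q \<and> \<Psi> q \<le> 1} - U"
  let ?w = "\<lambda>q. Psi_star \<Psi> q powr t"
  have ndiv: "\<not> ?w summable_on Q'"
  proof
    assume s: "?w summable_on Q'"
    have "?w summable_on ({q \<in> Q. \<Psi> q > 1} \<union> U)" using fin U by simp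
    then have "?w summable_on (Q' \<union> ({q \<in> Q. \<Psi> q > 1} \<union> U))"
      using s fin U by (intro summable_on_union) auto
    then have "?w summable_on (Q' \<union> ({q \<in> Q. \<Psi> q > 1} \<union> U)) \<inter> {q \<in> Q. q \<noteq> 0}"
      by (rule summable_on_subset_banach) auto
    then have "?w summable_on {q \<in> Q. q \<noteq> 0}"
    proof (rule summable_on_cong_neutral[THEN iffD1, rotated -1])
      fix q assume q: "q \<in> {q \<in> Q. q \<noteq> 0} - (Q' \<union> ({q \<in> Q. \<Psi> q > 1} \<union> U)) \<inter> {q \<in> Q. q \<noteq> 0}"
      then have "\<Psi> q = 0" using \<Psi>[of q] by (auto simp: Q'_def)
      then show "?w q = 0" by (simp add: Psi_star_def)
    qed auto
    then show False using div by blast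
  qed
  have "\<exists>V. finite V \<and> V \<subseteq> Q' \<and> sum ?w V > S0"
  proof (rule ccontr)
    assume "\<not> ?thesis"
    then have le: "sum ?w V \<le> S0" if "V \<in> {F. F \<subseteq> Q' \<and> finite F}" for V
      using that by (auto simp: not_less)
    have "?w summable_on Q'"
      by (rule nonneg_bdd_above_summable_on[OF _ bdd_aboveI2[OF le]]) auto
    then show False using ndiv by blast
  qed
  then obtain V where V: "finite V" "V \<subseteq> Q'" "sum ?w V > S0" by blast
  define S where "S = sum ?w V"
  have S: "S > 0" "A * CG * C0 / \<epsilon> \<le> S" using V(3) by (auto simp: S_def S0_def)
  have Vq: "q \<noteq> 0" "0 < \<Psi> q" "\<Psi> q \<le> 1" if "q \<in> V" for q using V(2) that by (auto simp: Q'_def)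
  define good where "good q F b K B C \<longleftrightarrow> continuous_on UNIV F \<and> (\<forall>x. 0 \<le> F x) \<and> (\<forall>x. F x \<le> B) \<and>
    (\<forall>x i. F x \<noteq> 0 \<longrightarrow> (\<exists>r::int. \<bar>(x *v real_vec q) $ i - \<theta> $ i - real_of_int r\<bar> \<le> \<Psi> q / 2)) \<and>
    (\<forall>n. finite (K n)) \<and>
    (\<forall>\<xi>. (\<lambda>n. \<Sum>k\<in>K n - {0}. b n k * ftw \<mu> G (\<xi> - real_mat (outer k q))) \<longlonglongrightarrow> ftw \<mu> (\<lambda>x. G x * F x) \<xi> - ftw \<mu> G \<xi>) \<and>
    (\<forall>n k. k \<noteq> 0 \<longrightarrow> norm (b n k) \<le> A * (\<Psi> q * infnorm (real_vec k)) powr (- t)) \<and>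
    (\<forall>\<xi>. norm (ftw \<mu> (\<lambda>x. G x * F x) \<xi>) \<le> C * (1 + infnorm \<xi>) powr (- D))"
    for q F and b :: "nat \<Rightarrow> int^'m \<Rightarrow> complex" and K :: "nat \<Rightarrow> (int^'m) set" and B C :: real
  have "\<exists>F b K B C. good q F b K B C" if q: "q \<in> V" for q
  proof (rule multiply_hyperplane_bump[OF \<mu> G CG Vq[OF q] D0 t0 M, where \<theta> = \<theta>])
    fix F b K B C
    assume "continuous_on UNIV F" "\<And>x. 0 \<le> F x" "\<And>x. F x \<le> B"
      "\<And>x i. F x \<noteq> 0 \<Longrightarrow> \<exists>r::int. \<bar>(x *v real_vec q) $ i - \<theta> $ i - real_of_int r\<bar> \<le> \<Psi> q / 2"
      "\<And>n. finite (K n)"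
      "\<And>\<xi>. (\<lambda>n. \<Sum>k\<in>K n - {0}. b n k * ftw \<mu> G (\<xi> - real_mat (outer k q))) \<longlonglongrightarrow> ftw \<mu> (\<lambda>x. G x * F x) \<xi> - ftw \<mu> G \<xi>"
      "\<And>n k. k \<noteq> 0 \<Longrightarrow> norm (b n k) \<le> (2 * (real M + 1) / pi) powr t * (\<Psi> q * infnorm (real_vec k)) powr (- t)"
      "\<And>\<xi>. norm (ftw \<mu> (\<lambda>x. G x * F x) \<xi>) \<le> C * (1 + infnorm \<xi>) powr (- D)"
    then have "good q F b K B C" unfolding good_def A_def by (intro conjI allI impI)
    then show ?thesis by blast
  qed
  then obtain F b K B C where good: "\<And>q. q \<in> V \<Longrightarrow> good q (F q) (b q) (K q) (B q) (C q)"
    by metis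
  have F: "continuous_on UNIV (F q)" "0 \<le> F q x" "F q x \<le> B q" if "q \<in> V" for q x
    using good[OF that] unfolding good_def by auto
  have supp: "\<exists>r::int. \<bar>(x *v real_vec q) $ i - \<theta> $ i - real_of_int r\<bar> \<le> \<Psi> q / 2" if "q \<in> V" "F q x \<noteq> 0" for q x i
    using good[OF that(1)] that(2) unfolding good_def by blast
  have K: "finite (K q n)" if "q \<in> V" for q n
    using good[OF that] unfolding good_def by blast
  have lim: "(\<lambda>n. \<Sum>k\<in>K q n - {0}. b q n k * ftw \<mu> G (\<xi> - real_mat (outer k q))) \<longlonglongrightarrow> ftw \<mu> (\<lambda>x. G x * F q x) \<xi> - ftw \<mu> G \<xi>" if "q \<in> V" for q \<xi>
    using good[OF that] unfolding good_def by blast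
  have b: "norm (b q n k) \<le> A * (\<Psi> q * infnorm (real_vec k)) powr (- t)" if "q \<in> V" "k \<noteq> 0" for q n k
    using good[OF that(1)] that(2) unfolding good_def by blast
  have C: "norm (ftw \<mu> (\<lambda>x. G x * F q x) \<xi>) \<le> C q * (1 + infnorm \<xi>) powr (- D)" if "q \<in> V" for q \<xi>
    using good[OF that] unfolding good_def by blast
  define W where "W q = ?w q / S" for q
  have W0: "0 \<le> W q" for q using S by (simp add: W_def)
  have W1: "(\<Sum>q\<in>V. W q) = 1" using S by (simp add: W_def S_def flip: sum_divide_distrib)
  define FF where "FF x = (\<Sum>q\<in>V. W q * F q x)" for x
  have lin: "ftw \<mu> (\<lambda>x. G x * FF x) \<xi> = (\<Sum>q\<in>V. complex_of_real (W q) * ftw \<mu> (\<lambda>x. G x * F q x) \<xi>)" for \<xi>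
  proof -
    have "ftw \<mu> (\<lambda>x. G x * FF x) \<xi> = (LINT x|\<mu>. (\<Sum>q\<in>V. complex_of_real (W q) * (complex_of_real (G x * F q x) * e_of (- (x \<bullet> \<xi>)))))"
      unfolding ftw_def FF_def by (intro Bochner_Integration.integral_cong refl)
        (simp add: sum_distrib_left sum_distrib_right mult_ac)
    also have "\<dots> = (\<Sum>q\<in>V. LINT x|\<mu>. complex_of_real (W q) * (complex_of_real (G x * F q x) * e_of (- (x \<bullet> \<xi>))))"
    proof (rule Bochner_Integration.integral_sum)
      fix q assume q: "q \<in> V"
      have BG: "\<bar>G x * F q x\<bar> \<le> BG * B q" for x
        unfolding abs_mult using G(2)[of x] F(2,3)[OF q, of x] by (intro mult_mono) auto
      show "integrable \<mu> (\<lambda>x. complex_of_real (W q) * (complex_of_real (G x * F q x) * e_of (- (x \<bullet> \<xi>))))"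
        by (intro integrable_mult_right integrable_ftw[OF \<mu> _ BG] continuous_on_mult G F q)
    qed
    finally show ?thesis by (simp add: ftw_def)
  qed
  have diff: "ftw \<mu> (\<lambda>x. G x * FF x) \<xi> - ftw \<mu> G \<xi>
     = (\<Sum>q\<in>V. complex_of_real (W q) * (ftw \<mu> (\<lambda>x. G x * F q x) \<xi> - ftw \<mu> G \<xi>))" for \<xi>
  proof -
    have "(\<Sum>q\<in>V. complex_of_real (W q) * ftw \<mu> G \<xi>) = ftw \<mu> G \<xi>"
      using W1 by (simp flip: sum_distrib_right of_real_sum)
    then show ?thesis by (simp add: lin right_diff_distrib sum_subtractf)
  qed
  have lim': "(\<lambda>n. \<Sum>q\<in>V. complex_of_real (W q) * (\<Sum>k\<in>K q n - {0}. b q n k * ftw \<mu> G (\<xi> - real_mat (outer k q))))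
      \<longlonglongrightarrow> ftw \<mu> (\<lambda>x. G x * FF x) \<xi> - ftw \<mu> G \<xi>" for \<xi>
    unfolding diff by (intro tendsto_sum tendsto_mult tendsto_const lim)
  have part: "norm (\<Sum>q\<in>V. complex_of_real (W q) * (\<Sum>k\<in>K q n - {0}. b q n k * ftw \<mu> G (\<xi> - real_mat (outer k q))))
     \<le> \<epsilon> * (1 + infnorm \<xi>) powr (- t')" for n \<xi>
  proof -
    let ?v = "\<lambda>k q. real_mat (outer k q) :: real^'n^'m"
    let ?g = "\<lambda>k q. infnorm (?v k q) powr (- t) * (1 + infnorm (\<xi> - ?v k q)) powr (- D)"
    define P where "P = (SIGMA q:V. K q n - {0})"
    have fP: "finite P" unfolding P_def using V(1) K by auto
    have "norm (\<Sum>q\<in>V. complex_of_real (W q) * (\<Sum>k\<in>K q n - {0}. b q n k * ftw \<mu> G (\<xi> - ?v k q)))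
       \<le> (\<Sum>q\<in>V. \<Sum>k\<in>K q n - {0}. W q * (norm (b q n k) * norm (ftw \<mu> G (\<xi> - ?v k q))))"
    proof (rule order.trans[OF norm_sum], rule sum_mono)
      fix q
      have "norm (complex_of_real (W q) * (\<Sum>k\<in>K q n - {0}. b q n k * ftw \<mu> G (\<xi> - ?v k q)))
          \<le> W q * (\<Sum>k\<in>K q n - {0}. norm (b q n k * ftw \<mu> G (\<xi> - ?v k q)))"
        unfolding norm_mult[of "complex_of_real _"] using W0[of q] by (simp add: mult_left_mono norm_sum)
      then show "norm (complex_of_real (W q) * (\<Sum>k\<in>K q n - {0}. b q n k * ftw \<mu> G (\<xi> - ?v k q)))
          \<le> (\<Sum>k\<in>K q n - {0}. W q * (norm (b q n k) * norm (ftw \<mu> G (\<xi> - ?v k q))))"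
        by (simp add: sum_distrib_left norm_mult)
    qed
    also have "\<dots> \<le> (\<Sum>q\<in>V. \<Sum>k\<in>K q n - {0}. A * CG / S * ?g k q)"
    proof (intro sum_mono)
      fix q k assume q: "q \<in> V" and k: "k \<in> K q n - {0}"
      define a where "a = infnorm (real_vec k)"
      define c where "c = infnorm (real_vec q)"
      have ac: "a \<ge> 1" "c \<ge> 1" using k Vq(1)[OF q] by (auto simp: a_def c_def intro: infnorm_real_vec_ge_1)
      have v: "infnorm (?v k q) = a * c" by (simp add: a_def c_def infnorm_outer)
      have "W q * norm (b q n k) \<le> W q * (A * (\<Psi> q * a) powr (- t))"
        using b[OF q, of k n] k W0 by (intro mult_left_mono) (auto simp: a_def)
      also have "\<dots> = A / S * (a * c) powr (- t)"
        \<comment> \<open>Here the weight cancels Psi(q)^(-t) and supplies the |q|^(-t) missing from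
          |k (x) q|^(-t).\<close>
        using ac Vq[OF q] by (simp add: W_def Psi_star_def c_def[symmetric] powr_mult powr_divide powr_minus field_simps)
      finally have le: "W q * norm (b q n k) \<le> A / S * (a * c) powr (- t)" .
      have "W q * norm (b q n k) * norm (ftw \<mu> G (\<xi> - ?v k q)) \<le> A / S * (a * c) powr (- t) * (CG * (1 + infnorm (\<xi> - ?v k q)) powr (- D))"
        by (rule mult_mono[OF le CG(2)]) (use A0 S in auto)
      then show "W q * (norm (b q n k) * norm (ftw \<mu> G (\<xi> - ?v k q))) \<le> A * CG / S * ?g k q"
        unfolding v by (simp add: mult_ac)
    qed
    also have "\<dots> = A * CG / S * (\<Sum>q\<in>V. \<Sum>k\<in>K q n - {0}. ?g k q)" by (simp only: sum_distrib_left)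
    also have "(\<Sum>q\<in>V. \<Sum>k\<in>K q n - {0}. ?g k q) = (\<Sum>(q, k)\<in>P. ?g k q)"
      unfolding P_def using V(1) K by (intro sum.Sigma) auto
    \<comment> \<open>The range of k depends on q, so the pairs arise as (q, k) and are swapped for
      \<open>rank_one_sum_bound\<close>.\<close>
    also have "\<dots> = (\<Sum>(k, q)\<in>prod.swap ` P. ?g k q)"
      by (subst sum.reindex) (auto simp: case_prod_beta)
    also have "A * CG / S * \<dots> \<le> A * CG / S * (C0 * (1 + infnorm \<xi>) powr (- t'))"
      using A0 CG S fP Vq by (intro mult_left_mono C0(2)) (auto simp: P_def)
    also have "\<dots> = A * CG * C0 / S * (1 + infnorm \<xi>) powr (- t')" by simp
    also have "\<dots> \<le> \<epsilon> * (1 + infnorm \<xi>) powr (- t')"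
      using S \<epsilon> by (intro mult_right_mono) (auto simp: field_simps)
    finally show ?thesis .
  qed
  show thesis
  proof (rule that)
    show "continuous_on UNIV FF" unfolding FF_def by (intro continuous_intros F)
    show "0 \<le> FF x" for x unfolding FF_def using W0 F by (intro sum_nonneg) auto
    show "FF x \<le> (\<Sum>q\<in>V. W q * B q)" for x unfolding FF_def using W0 F by (intro sum_mono mult_left_mono) auto
    show "finite V" by (rule V)
    show "V \<subseteq> Q - U" using V(2) by (auto simp: Q'_def)
    show "0 < \<Psi> q \<and> \<Psi> q \<le> 1" if "q \<in> V" for q using Vq[OF that] by simp
    show "\<exists>q\<in>V. \<forall>i. \<exists>r::int. \<bar>(x *v real_vec q) $ i - \<theta> $ i - real_of_int r\<bar> \<le> \<Psi> q / 2" if x: "FF x \<noteq> 0" for x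
    proof -
      obtain q where "q \<in> V" "W q * F q x \<noteq> 0" using x unfolding FF_def by (meson sum.neutral)
      then show ?thesis using supp[of q x] by auto
    qed
    show "norm (ftw \<mu> (\<lambda>x. G x * FF x) \<xi> - ftw \<mu> G \<xi>) \<le> \<epsilon> * (1 + infnorm \<xi>) powr (- t')" for \<xi>
      using part by (intro Lim_bounded[OF tendsto_norm[OF lim']]) auto
    \<comment> \<open>The signs of the \<open>C q\<close> are unknown; absolute values and the added
      1 give a positive constant.\<close>
    show "(\<Sum>q\<in>V. W q * \<bar>C q\<bar>) + 1 > 0" using W0 by (smt (verit) abs_ge_zero mult_nonneg_nonneg sum_nonneg)
    show "norm (ftw \<mu> (\<lambda>x. G x * FF x) \<xi>) \<le> ((\<Sum>q\<in>V. W q * \<bar>C q\<bar>) + 1) * (1 + infnorm \<xi>) powr (- D)" for \<xi>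
    proof -
      have "norm (ftw \<mu> (\<lambda>x. G x * FF x) \<xi>) \<le> (\<Sum>q\<in>V. W q * (\<bar>C q\<bar> * (1 + infnorm \<xi>) powr (- D)))"
        unfolding lin
      proof (rule order.trans[OF norm_sum], rule sum_mono)
        fix q assume q: "q \<in> V"
        have "norm (ftw \<mu> (\<lambda>x. G x * F q x) \<xi>) \<le> \<bar>C q\<bar> * (1 + infnorm \<xi>) powr (- D)"
          using C[OF q, of \<xi>] by (elim order.trans) (intro mult_right_mono, auto)
        then show "norm (complex_of_real (W q) * ftw \<mu> (\<lambda>x. G x * F q x) \<xi>) \<le> W q * (\<bar>C q\<bar> * (1 + infnorm \<xi>) powr (- D))"
          using W0[of q] by (simp add: norm_mult mult_left_mono)
      qed
      also have "\<dots> = (\<Sum>q\<in>V. W q * \<bar>C q\<bar>) * (1 + infnorm \<xi>) powr (- D)"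
        by (simp only: sum_distrib_right mult.assoc)
      also have "\<dots> \<le> ((\<Sum>q\<in>V. W q * \<bar>C q\<bar>) + 1) * (1 + infnorm \<xi>) powr (- D)" by (intro mult_right_mono) auto
      finally show ?thesis .
    qed
  qed
qed

subsection \<open>The lower bound\<close>

text \<open>The state of the iteration is the density built so far together with the set of q used.
  Mass and decay pass to the weak limit because the bounds are uniform in the stage. The support
  condition of a stage passes because it is the vanishing of a continuous function.\<close>

lemma fourier_dimension_lower_construction:
  fixes \<theta> :: "real^'m" and Q :: "(int^'n) set" and \<Psi> :: "int^'n \<Rightarrow> real" and t t' :: real
  assumes t: "0 < t'" "t' < t" and \<Psi>: "\<And>q. \<Psi> q \<ge> 0"
    and div: "\<not> (\<lambda>q. Psi_star \<Psi> q powr t) summable_on {q \<in> Q. q \<noteq> 0}"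
    and fin: "finite {q \<in> Q. \<Psi> q > 1}"
  obtains \<mu> C where "\<mu> \<in> prob_measures_on (E_set Q \<Psi> \<theta>)" "C > 0"
    "\<And>\<xi>. cmod (fourier_transform \<mu> \<xi>) \<le> C * (1 + infnorm \<xi>) powr (- t')"
proof -
  \<comment> \<open>The least decay that \<open>one_step\<close> admits; a starting measure of order
    \<open>M0\<close> >= D provides it.\<close>
  define D where "D = t' + real (2 * CARD('m) * CARD('n))"
  have D: "D \<ge> t' + real (2 * CARD('m) * CARD('n))" by (simp add: D_def)
  have tD: "t' \<le> D" by (simp add: D_def)
  define M0 where "M0 = nat \<lceil>D\<rceil>"
  have M0: "real M0 \<ge> D" unfolding M0_def by linarith
  have D0: "D \<ge> 0" using t by (simp add: D_def)
  define X :: "(real^'n^'m) set" where "X = cbox 0 (real M0 *\<^sub>R One)"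
  obtain \<mu>0 :: "(real^'n^'m) measure"
    where \<mu>0: "prob_space \<mu>0" "sets \<mu>0 = sets borel" "AE x in \<mu>0. x \<in> X"
      "\<And>\<xi>. norm (LINT x|\<mu>0. e_of (- (x \<bullet> \<xi>))) \<le> (2 / (1 + infnorm \<xi>)) ^ M0"
    using rapidly_decaying_measure[where M = M0] unfolding X_def by blast
  interpret m0: prob_space \<mu>0 by fact
  have mb: "h \<in> borel_measurable \<mu>0" if "continuous_on UNIV h" for h :: "real^'n^'m \<Rightarrow> 'z::{real_normed_vector, second_countable_topology}"
    using borel_measurable_continuous_onI[OF that] \<mu>0(2) measurable_cong_sets by blast
  define near where "near V x \<longleftrightarrow> (\<exists>q\<in>V. \<forall>i. \<exists>r::int. \<bar>(x *v real_vec q) $ i - \<theta> $ i - real_of_int r\<bar> \<le> \<Psi> q / 2)" for V :: "(int^'n) set" and x :: "real^'n^'m"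
  \<comment> \<open>The constant of the D-decay is existentially quantified: the next stage
    compensates for its size by a larger S.\<close>
  define ok where "ok s \<longleftrightarrow> (case s of (G, U) \<Rightarrow> continuous_on UNIV G \<and> (\<forall>x. 0 \<le> G x) \<and> (\<exists>B. \<forall>x. G x \<le> B) \<and> finite U \<and>
      (\<exists>C>0. \<forall>\<xi>. norm (ftw \<mu>0 G \<xi>) \<le> C * (1 + infnorm \<xi>) powr (- D)))"
    for s :: "(real^'n^'m \<Rightarrow> real) \<times> (int^'n) set"
  \<comment> \<open>The errors 2^(-k-2) add up to less than 1/2, which keeps at least half of the
    mass. A factor F supported near the new q makes the condition of a stage persist in all later
    products.\<close>
  define step where "step k s s' \<longleftrightarrow> (\<exists>F. snd s \<subseteq> snd s' \<and> snd s' \<subseteq> Q \<union> snd s \<and> (\<forall>q\<in>snd s' - snd s. 0 < \<Psi> q \<and> \<Psi> q \<le> 1) \<and>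
      fst s' = (\<lambda>x. fst s x * F x) \<and> (\<forall>x. F x \<noteq> 0 \<longrightarrow> near (snd s' - snd s) x) \<and>
      (\<forall>\<xi>. norm (ftw \<mu>0 (fst s') \<xi> - ftw \<mu>0 (fst s) \<xi>) \<le> (1/2) ^ (k + 2) * (1 + infnorm \<xi>) powr (- t')))"
    for k :: nat and s s' :: "(real^'n^'m \<Rightarrow> real) \<times> (int^'n) set"
  have ex_step: "\<exists>s'. ok s' \<and> step k s s'" if s: "ok s" for s k
  proof -
    obtain G U where GU: "s = (G, U)" by (cases s)
    obtain B C0 where G: "continuous_on UNIV G" "\<And>x. 0 \<le> G x" "\<And>x. G x \<le> B" "finite U"
      and C0: "C0 > 0" "\<And>\<xi>. norm (ftw \<mu>0 G \<xi>) \<le> C0 * (1 + infnorm \<xi>) powr (- D)"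
      using s unfolding ok_def GU by auto
    have Gb: "\<bar>G x\<bar> \<le> B" for x using G(2,3)[of x] by simp
    have e: "(1/2 :: real) ^ (k + 2) > 0" by simp
    obtain F V BF C where F: "continuous_on UNIV F" "\<And>x. 0 \<le> F x" "\<And>x. F x \<le> BF"
      and V: "finite V" "V \<subseteq> Q - U" "\<And>q. q \<in> V \<Longrightarrow> 0 < \<Psi> q \<and> \<Psi> q \<le> 1"
      and supp: "\<And>x. F x \<noteq> 0 \<Longrightarrow> \<exists>q\<in>V. \<forall>i. \<exists>r::int. \<bar>(x *v real_vec q) $ i - \<theta> $ i - real_of_int r\<bar> \<le> \<Psi> q / 2"
      and diff: "\<And>\<xi>. norm (ftw \<mu>0 (\<lambda>x. G x * F x) \<xi> - ftw \<mu>0 G \<xi>) \<le> (1/2) ^ (k + 2) * (1 + infnorm \<xi>) powr (- t')"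
      and C: "C > 0" "\<And>\<xi>. norm (ftw \<mu>0 (\<lambda>x. G x * F x) \<xi>) \<le> C * (1 + infnorm \<xi>) powr (- D)"
      by (rule one_step[OF \<mu>0(1,2) G(1) Gb C0 t D \<Psi> G(4) div fin e, where \<theta> = \<theta>]) (rule that)
    have GF: "G x * F x \<le> B * BF" for x
      using G(2,3)[of x] F(2,3)[of x] by (intro mult_mono) auto
    have UV: "U \<union> V - U = V" using V(2) by auto
    have "ok (\<lambda>x. G x * F x, U \<union> V)"
      unfolding ok_def prod.case
    proof (intro conjI)
      show "continuous_on UNIV (\<lambda>x. G x * F x)" by (intro continuous_on_mult G F)
      show "\<forall>x. 0 \<le> G x * F x" using G F by auto
      show "\<exists>B. \<forall>x. G x * F x \<le> B" using GF by blast
      show "finite (U \<union> V)" using G(4) V(1) by simp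
      show "\<exists>C>0. \<forall>\<xi>. norm (ftw \<mu>0 (\<lambda>x. G x * F x) \<xi>) \<le> C * (1 + infnorm \<xi>) powr (- D)" using C by blast
    qed
    moreover have "step k s (\<lambda>x. G x * F x, U \<union> V)"
      unfolding step_def GU fst_conv snd_conv UV
      by (rule exI[of _ F]) (use V diff supp in \<open>auto simp: near_def\<close>)
    ultimately show ?thesis by blast
  qed
  define s0 :: "(real^'n^'m \<Rightarrow> real) \<times> (int^'n) set" where "s0 = (\<lambda>_. 1, {})"
  have f0: "ftw \<mu>0 (\<lambda>_. 1) \<xi> = (LINT x|\<mu>0. e_of (- (x \<bullet> \<xi>)))" for \<xi> by (simp add: ftw_def)
  have dec0: "norm (ftw \<mu>0 (\<lambda>_. 1) \<xi>) \<le> 2 ^ M0 * (1 + infnorm \<xi>) powr (- D)" for \<xi>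
  proof -
    have ge: "1 + infnorm \<xi> \<ge> 1" by (simp add: infnorm_pos_le)
    have "norm (ftw \<mu>0 (\<lambda>_. 1) \<xi>) \<le> (2 / (1 + infnorm \<xi>)) ^ M0" unfolding f0 by (rule \<mu>0(4))
    also have "\<dots> = 2 ^ M0 * (1 + infnorm \<xi>) powr (- real M0)"
      using ge by (simp add: power_divide powr_minus powr_realpow divide_inverse power_inverse)
    also have "\<dots> \<le> 2 ^ M0 * (1 + infnorm \<xi>) powr (- D)" using ge M0 by (intro mult_left_mono powr_mono) auto
    finally show ?thesis .
  qed
  have ok0: "ok s0"
    unfolding ok_def s0_def prod.case
    by (intro conjI exI[of _ "2 ^ M0"] allI dec0) auto
  have "\<exists>f. \<forall>k. (ok (f k) \<and> (k = 0 \<longrightarrow> f k = s0)) \<and> step k (f k) (f (Suc k))"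
  proof (rule dependent_nat_choice)
    show "\<exists>s. ok s \<and> ((0::nat) = 0 \<longrightarrow> s = s0)" using ok0 by blast
    fix s and k :: nat assume "ok s \<and> (k = 0 \<longrightarrow> s = s0)"
    then have "ok s" by simp
    then obtain s' where "ok s'" "step k s s'" using ex_step by blast
    then show "\<exists>s'. (ok s' \<and> (Suc k = 0 \<longrightarrow> s' = s0)) \<and> step k s s'" by (intro exI[of _ s']) simp
  qed
  then obtain f where f': "\<forall>k. (ok (f k) \<and> (k = 0 \<longrightarrow> f k = s0)) \<and> step k (f k) (f (Suc k))" by (rule exE)
  have f: "ok (f k)" "f 0 = s0" "step k (f k) (f (Suc k))" for k using f' by blast+
  define G where "G k = fst (f k)" for k
  define V where "V k = snd (f (Suc k)) - snd (f k)" for k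
  have G: "continuous_on UNIV (G k)" "0 \<le> G k x" "\<exists>B. \<forall>x. G k x \<le> B" for k x
    using f(1)[of k] unfolding ok_def G_def by (auto split: prod.splits)
  have finU: "finite (snd (f k))" for k using f(1)[of k] unfolding ok_def by (auto split: prod.splits)
  have Umono: "snd (f k) \<subseteq> snd (f (Suc k))" for k using f(3)[of k] unfolding step_def by auto
  have UQ: "snd (f k) \<subseteq> Q" for k
  proof (induction k)
    case 0
    then show ?case by (simp add: f(2) s0_def)
  next
    case (Suc k)
    then show ?case using f(3)[of k] unfolding step_def by auto
  qed
  have V1: "finite (V k)" for k using finU[of "Suc k"] by (simp add: V_def)
  have V2: "V k \<subseteq> Q" for k using UQ[of "Suc k"] by (auto simp: V_def)
  have V3: "0 < \<Psi> q \<and> \<Psi> q \<le> 1" if "q \<in> V k" for k q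
    using f(3)[of k] that unfolding step_def V_def by blast
  note V = V1 V2 V3
  \<comment> \<open>Disjointness will make the solutions found at different stages distinct.\<close>
  have Vdisj: "V j \<inter> V k = {}" if "j < k" for j k
  proof -
    have "snd (f (Suc j)) \<subseteq> snd (f k)" 
      by (rule lift_Suc_mono_le[where f = "\<lambda>k. snd (f k)", OF Umono Suc_leI[OF that]])
    then show ?thesis by (auto simp: V_def)
  qed
  have diffk: "norm (ftw \<mu>0 (G (Suc k)) \<xi> - ftw \<mu>0 (G k) \<xi>) \<le> (1/2) ^ (k + 2) * (1 + infnorm \<xi>) powr (- t')" for k \<xi>
    using f(3)[of k] unfolding step_def G_def by blast
  have G0: "G 0 = (\<lambda>_. 1)" by (simp add: G_def f(2) s0_def)
  have Gsupp: "near (V k) x" if "j > k" "G j x \<noteq> 0" for j k x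
    using that
  proof (induction j)
    case 0
    then show ?case by simp
  next
    case (Suc j)
    obtain F where F: "G (Suc j) = (\<lambda>x. G j x * F x)" "\<forall>x. F x \<noteq> 0 \<longrightarrow> near (V j) x"
      using f(3)[of j] unfolding step_def G_def V_def by blast
    have "G j x \<noteq> 0" "F x \<noteq> 0" using Suc.prems(2) by (auto simp: F(1))
    then show ?case using Suc.IH F(2) Suc.prems(1) by (cases "k = j") auto
  qed
  have total: "norm (ftw \<mu>0 (G k) \<xi> - ftw \<mu>0 (G 0) \<xi>) \<le> (1/2 - (1/2) ^ (k + 1)) * (1 + infnorm \<xi>) powr (- t')" for k \<xi>
  proof (induction k)
    case 0
    then show ?case by simp
  next
    case (Suc k)
    have "norm (ftw \<mu>0 (G (Suc k)) \<xi> - ftw \<mu>0 (G 0) \<xi>) \<le> norm (ftw \<mu>0 (G (Suc k)) \<xi> - ftw \<mu>0 (G k) \<xi>) + norm (ftw \<mu>0 (G k) \<xi> - ftw \<mu>0 (G 0) \<xi>)"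
      using norm_triangle_ineq[of "ftw \<mu>0 (G (Suc k)) \<xi> - ftw \<mu>0 (G k) \<xi>" "ftw \<mu>0 (G k) \<xi> - ftw \<mu>0 (G 0) \<xi>"] by simp
    also have "\<dots> \<le> (1/2) ^ (k + 2) * (1 + infnorm \<xi>) powr (- t') + (1/2 - (1/2) ^ (k + 1)) * (1 + infnorm \<xi>) powr (- t')"
      by (intro add_mono diffk Suc.IH)
    also have "\<dots> = (1/2 - (1/2) ^ (Suc k + 1)) * (1 + infnorm \<xi>) powr (- t')"
      by (simp add: field_simps)
    finally show ?case .
  qed
  have total': "norm (ftw \<mu>0 (G k) \<xi> - ftw \<mu>0 (G 0) \<xi>) \<le> 1/2 * (1 + infnorm \<xi>) powr (- t')" for k \<xi>
    using total[of k \<xi>] by (elim order.trans) (intro mult_right_mono, auto)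
  define c where "c k = (LINT x|\<mu>0. G k x)" for k
  have ftw0: "ftw \<mu>0 (G k) 0 = complex_of_real (c k)" for k by (simp add: ftw_def c_def)
  \<comment> \<open>The error bound at \<open>\<xi>\<close> = 0 compares masses, and the initial
    mass is 1.\<close>
  have c: "c k \<ge> 1/2" for k
  proof -
    have "norm (complex_of_real (c k) - 1) \<le> 1/2"
      using total'[of k 0] m0.prob_space by (simp add: ftw0 infnorm_0 G0 ftw_def c_def)
    then have "\<bar>c k - 1\<bar> \<le> 1/2" by (metis norm_of_real of_real_1 of_real_diff)
    then show ?thesis by linarith
  qed
  have intG: "integrable \<mu>0 (G k)" for k
  proof -
    obtain B where B: "\<forall>x. G k x \<le> B" using G(3) by blast
    have "norm (G k x) \<le> B" for x using B G(2)[of k x] by simp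
    then show ?thesis by (intro m0.integrable_const_bound[of _ B] AE_I2 mb G(1))
  qed
  define \<nu> where "\<nu> k = density \<mu>0 (\<lambda>x. ennreal (G k x / c k))" for k
  have cpos: "c k > 0" for k using c[of k] by linarith
  have gm: "(\<lambda>x. G k x / c k) \<in> borel_measurable \<mu>0" for k
    using mb[OF G(1)] by simp
  have nn: "0 \<le> G k x / c k" for k x using G(2)[of k x] cpos[of k] by simp
  have \<nu>p: "prob_space (\<nu> k)" for k
  proof (rule prob_spaceI)
    have "emeasure (\<nu> k) (space (\<nu> k)) = (\<integral>\<^sup>+x. ennreal (G k x / c k) \<partial>\<mu>0)"
      unfolding \<nu>_def using gm[of k] by (simp add: emeasure_density cong: nn_integral_cong)
    also have "\<dots> = ennreal (LINT x|\<mu>0. G k x / c k)"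
      using intG nn by (intro nn_integral_eq_integral) auto
    also have "\<dots> = 1" using cpos[of k] by (simp add: c_def)
    finally show "emeasure (\<nu> k) (space (\<nu> k)) = 1" .
  qed
  have \<nu>s: "sets (\<nu> k) = sets borel" for k by (simp add: \<nu>_def \<mu>0(2))
  have \<nu>X: "AE x in \<nu> k. x \<in> X" for k
    unfolding \<nu>_def using \<mu>0(3) gm by (subst AE_density) auto
  have \<nu>int: "(LINT x|\<nu> k. h x) = (LINT x|\<mu>0. complex_of_real (G k x) * h x) / complex_of_real (c k)"
    if "continuous_on UNIV h" for h :: "real^'n^'m \<Rightarrow> complex" and k
  proof -
    have "(LINT x|\<nu> k. h x) = (LINT x|\<mu>0. (G k x / c k) *\<^sub>R h x)"
      unfolding \<nu>_def using nn by (intro integral_density mb[OF that] gm) auto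
    also have "\<dots> = (LINT x|\<mu>0. complex_of_real (G k x) * h x / complex_of_real (c k))"
      by (simp add: scaleR_conv_of_real)
    finally show ?thesis by simp
  qed
  obtain r \<mu> where r: "strict_mono r" and \<mu>: "prob_space \<mu>" "sets \<mu> = sets borel"
    and conv: "\<And>h :: real^'n^'m \<Rightarrow> complex. continuous_on UNIV h \<Longrightarrow> bounded (range h) \<Longrightarrow> (\<lambda>k. LINT x|\<nu> (r k). h x) \<longlonglongrightarrow> (LINT x|\<mu>. h x)"
    by (rule weakly_convergent_subsequence_on_compact[of X \<nu>, OF _ \<nu>p \<nu>s \<nu>X]) (auto simp: X_def compact_cbox)
  interpret mu: prob_space \<mu> by fact
  \<comment> \<open>Initial constant plus total error, divided by the least possible mass
    1/2.\<close>
  define C where "C = 2 * (2 ^ M0 + 1/2 :: real)"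
  have FT: "cmod (fourier_transform \<mu> \<xi>) \<le> C * (1 + infnorm \<xi>) powr (- t')" for \<xi>
  proof -
    have lim: "(\<lambda>k. LINT x|\<nu> (r k). e_of (- (x \<bullet> \<xi>))) \<longlonglongrightarrow> fourier_transform \<mu> \<xi>"
      unfolding fourier_transform_e_of by (intro conv continuous_intros) (auto intro!: boundedI[of _ 1])
    have "norm (LINT x|\<nu> k. e_of (- (x \<bullet> \<xi>))) \<le> C * (1 + infnorm \<xi>) powr (- t')" for k
    proof -
      have ge: "1 + infnorm \<xi> \<ge> 1" by (simp add: infnorm_pos_le)
      have "norm (ftw \<mu>0 (G k) \<xi>) \<le> norm (ftw \<mu>0 (G k) \<xi> - ftw \<mu>0 (G 0) \<xi>) + norm (ftw \<mu>0 (G 0) \<xi>)"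
        using norm_triangle_ineq[of "ftw \<mu>0 (G k) \<xi> - ftw \<mu>0 (G 0) \<xi>" "ftw \<mu>0 (G 0) \<xi>"] by simp
      also have "\<dots> \<le> 1/2 * (1 + infnorm \<xi>) powr (- t') + 2 ^ M0 * (1 + infnorm \<xi>) powr (- D)"
        using total'[of k \<xi>] dec0[of \<xi>] by (simp add: G0)
      also have "\<dots> \<le> 1/2 * (1 + infnorm \<xi>) powr (- t') + 2 ^ M0 * (1 + infnorm \<xi>) powr (- t')"
        using ge tD by (intro add_left_mono mult_left_mono powr_mono) auto
      also have "\<dots> = C / 2 * (1 + infnorm \<xi>) powr (- t')" by (simp add: C_def algebra_simps)
      finally have le: "norm (ftw \<mu>0 (G k) \<xi>) \<le> C / 2 * (1 + infnorm \<xi>) powr (- t')" .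
      have "(LINT x|\<nu> k. e_of (- (x \<bullet> \<xi>))) = ftw \<mu>0 (G k) \<xi> / complex_of_real (c k)"
        unfolding ftw_def by (intro \<nu>int continuous_intros)
      then have "norm (LINT x|\<nu> k. e_of (- (x \<bullet> \<xi>))) = norm (ftw \<mu>0 (G k) \<xi>) / c k"
        using cpos[of k] by (simp add: norm_divide)
      also have "\<dots> \<le> (C / 2 * (1 + infnorm \<xi>) powr (- t')) / (1/2)"
        using le c[of k] by (intro frac_le) (auto simp: C_def)
      finally show ?thesis by simp
    qed
    then show ?thesis by (intro Lim_bounded[OF tendsto_norm[OF lim]]) auto
  qed
  have supp: "near (V k) x" if x: "x \<in> closed_support \<mu>" for k x
  proof -
    \<comment> \<open>\<open>g q\<close> vanishes iff every coordinate of x q - theta is within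
      Psi(q)/2 of an integer, so the product over \<open>V k\<close> vanishes iff x is near for some
      q. The cosine criterion applies because Psi(q) <= 1 on \<open>V k\<close>; truncation by 1
      gives a bounded test function.\<close>
    define g where "g q x = (\<Sum>i\<in>UNIV. max 0 (cos (2 * pi * (\<Psi> q / 2)) - cos (2 * pi * ((x *v real_vec q) $ i - \<theta> $ i))))" for q and x :: "real^'n^'m"
    define h where "h x = min 1 (\<Prod>q\<in>V k. g q x)" for x
    have g0: "0 \<le> g q x" for q x unfolding g_def by (intro sum_nonneg) auto
    have h0: "0 \<le> h x" for x unfolding h_def using g0 by (simp add: prod_nonneg)
    have h1: "h x \<le> 1" for x by (simp add: h_def)
    have ch: "continuous_on UNIV h" unfolding h_def g_def by (intro continuous_intros)
    have near_h: "near (V k) x \<longleftrightarrow> h x = 0" for x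
    proof
      assume "near (V k) x"
      then obtain q where q: "q \<in> V k" "\<forall>i. \<exists>r::int. \<bar>(x *v real_vec q) $ i - \<theta> $ i - real_of_int r\<bar> \<le> \<Psi> q / 2"
        by (auto simp: near_def)
      have \<Psi>q: "0 \<le> \<Psi> q / 2" "\<Psi> q / 2 \<le> 1/2" using V(3)[OF q(1)] by auto
      have "cos (2 * pi * ((x *v real_vec q) $ i - \<theta> $ i)) \<ge> cos (2 * pi * (\<Psi> q / 2))" for i
        using q(2) near_integer_imp_cos_near_one[OF \<Psi>q] by blast
      then have "g q x = 0" unfolding g_def by (intro sum.neutral) auto
      then have "(\<Prod>q\<in>V k. g q x) = 0" using V(1) q(1) by auto
      then show "h x = 0" by (simp add: h_def)
    next
      assume "h x = 0"
      then have "(\<Prod>q\<in>V k. g q x) = 0" by (simp add: h_def min_def split: if_splits)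
      then obtain q where q: "q \<in> V k" "g q x = 0" using V(1) by auto
      have \<Psi>q: "0 \<le> \<Psi> q / 2" "\<Psi> q / 2 \<le> 1/2" using V(3)[OF q(1)] by auto
      have "max 0 (cos (2 * pi * (\<Psi> q / 2)) - cos (2 * pi * ((x *v real_vec q) $ i - \<theta> $ i))) = 0" for i
        using q(2) unfolding g_def by (subst (asm) sum_nonneg_eq_0_iff) auto
      then have "cos (2 * pi * ((x *v real_vec q) $ i - \<theta> $ i)) \<ge> cos (2 * pi * (\<Psi> q / 2))" for i
        by (smt (verit))
      then have "\<exists>r::int. \<bar>(x *v real_vec q) $ i - \<theta> $ i - real_of_int r\<bar> \<le> \<Psi> q / 2" for i
        using cos_near_one_imp_near_integer[OF \<Psi>q] by blast
      then show "near (V k) x" using q(1) by (auto simp: near_def)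
    qed
    have hc: "continuous_on UNIV (\<lambda>x. complex_of_real (h x))" using ch by (intro continuous_intros)
    have lim: "(\<lambda>j. LINT x|\<nu> (r j). complex_of_real (h x)) \<longlonglongrightarrow> (LINT x|\<mu>. complex_of_real (h x))"
      by (rule conv[OF hc]) (use h0 h1 in \<open>auto intro!: boundedI[of _ 1]\<close>)
    have z: "(LINT x|\<nu> (r j). complex_of_real (h x)) = 0" if "j > k" for j
    proof -
      \<comment> \<open>A strictly increasing r satisfies r j >= j, and densities of index above k
        vanish wherever \<open>near (V k)\<close> fails.\<close>
      have "r j > k" using that seq_suble[OF r, of j] by linarith
      then have z0: "complex_of_real (G (r j) x) * complex_of_real (h x) = 0" for x
        using Gsupp[of k "r j" x] near_h[of x] by auto
      show ?thesis unfolding \<nu>int[OF hc] z0 by simp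
    qed
    have "(\<lambda>j. LINT x|\<nu> (r j). complex_of_real (h x)) \<longlonglongrightarrow> 0"
      by (rule tendsto_eventually) (rule eventually_mono[OF eventually_gt_at_top[of k] z])
    then have "(LINT x|\<mu>. complex_of_real (h x)) = 0" using lim LIMSEQ_unique by blast
    then have i0: "(LINT x|\<mu>. h x) = 0" by simp
    have hm: "h \<in> borel_measurable \<mu>"
      using borel_measurable_continuous_onI[OF ch] \<mu>(2) measurable_cong_sets by blast
    have ih: "integrable \<mu> h" using h0 h1 hm by (intro mu.integrable_const_bound[of _ 1]) auto
    have AE0: "AE x in \<mu>. h x = 0"
      by (rule integral_nonneg_eq_0_iff_AE[THEN iffD1, OF ih _ i0]) (use h0 in auto)
    \<comment> \<open>The set where h > 0 is open and null, hence disjoint from the support.\<close>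
    show ?thesis
    proof (rule ccontr)
      assume "\<not> near (V k) x"
      then have "h x > 0" using near_h h0[of x] by (simp add: less_le)
      moreover have "open {x. h x > 0}" using open_Collect_less[OF continuous_on_const ch] .
      ultimately have "emeasure \<mu> {x. h x > 0} > 0" using x by (auto simp: closed_support_def)
      moreover have "emeasure \<mu> {x. h x > 0} = 0"
      proof -
        have "AE x in \<mu>. \<not> h x > 0" using AE0 by eventually_elim simp
        then have "emeasure \<mu> {x \<in> space \<mu>. h x > 0} = 0" by (rule emeasure_eq_0_AE)
        then show ?thesis using sets_eq_imp_space_eq[OF \<mu>(2)] by simp
      qed
      ultimately show False by simp
    qed
  qed
  have "closed_support \<mu> \<subseteq> E_set Q \<Psi> \<theta>"
  proof
    fix x assume x: "x \<in> closed_support \<mu>"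
    have "\<exists>p. snd p \<in> V k \<and> infnorm (x *v real_vec (snd p) - real_vec (fst p) - \<theta>) < \<Psi> (snd p)" for k
    proof -
      obtain q where q: "q \<in> V k" "\<forall>i. \<exists>r::int. \<bar>(x *v real_vec q) $ i - \<theta> $ i - real_of_int r\<bar> \<le> \<Psi> q / 2"
        using supp[OF x, of k] by (auto simp: near_def)
      then obtain r where r: "\<And>i. \<bar>(x *v real_vec q) $ i - \<theta> $ i - real_of_int (r i)\<bar> \<le> \<Psi> q / 2" by metis
      define R :: "int^'m" where "R = (\<chi> i. r i)"
      obtain i where "infnorm (x *v real_vec q - real_vec R - \<theta>) = \<bar>(x *v real_vec q - real_vec R - \<theta>) $ i\<bar>"
        using infnorm_vec_attained by blast
      also have "\<dots> \<le> \<Psi> q / 2" using r[of i] by (simp add: R_def algebra_simps)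
      also have "\<dots> < \<Psi> q" using V(3)[OF q(1)] by simp
      finally show ?thesis using q(1) by (intro exI[of _ "(R, q)"]) simp
    qed
    then obtain p where p: "\<And>k. snd (p k) \<in> V k" "\<And>k. infnorm (x *v real_vec (snd (p k)) - real_vec (fst (p k)) - \<theta>) < \<Psi> (snd (p k))"
      by metis
    have "inj p"
    proof (rule linorder_injI)
      fix j k :: nat assume "j < k"
      then show "p j \<noteq> p k" using Vdisj[of j k] p(1)[of j] p(1)[of k] by auto
    qed
    then have "infinite (range p)" by (simp add: range_inj_infinite)
    moreover have "range p \<subseteq> {(r, q). q \<in> Q \<and> infnorm (x *v real_vec q - real_vec r - \<theta>) < \<Psi> q}"
    proof
      fix z assume "z \<in> range p"
      then obtain k where z: "z = p k" by blast
      have "snd (p k) \<in> Q" using p(1)[of k] V2[of k] by blast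
      then show "z \<in> {(r, q). q \<in> Q \<and> infnorm (x *v real_vec q - real_vec r - \<theta>) < \<Psi> q}"
        using p(2)[of k] unfolding z by (cases "p k") simp
    qed
    ultimately show "x \<in> E_set Q \<Psi> \<theta>" unfolding E_set_def using infinite_super by blast
  qed
  then have "\<mu> \<in> prob_measures_on (E_set Q \<Psi> \<theta>)" using \<mu> by (simp add: prob_measures_on_def)
  moreover have "C > 0" by (simp add: C_def add_pos_pos)
  ultimately show thesis using FT that by blast
qed

section \<open>The dimension formula\<close>

theorem theorem1p4p1:
  fixes Q :: "(int^'n) set"
    and \<Psi> :: "int^'n \<Rightarrow> real"
    and \<theta> :: "real^'m"
  assumes "\<And>q. \<Psi> q \<ge> 0"
    and "(\<lambda>q. \<Psi> q ^ CARD('m)) summable_on Q"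
  shows "fourier_dim (E_set Q \<Psi> \<theta>) = min (2 * s_exponent Q \<Psi>) (real (CARD('m) * CARD('n)))"
proof -
  note \<Psi> = assms(1)
  define S where "S = {s. s \<ge> 0 \<and> (\<lambda>q. Psi_star \<Psi> q powr s) summable_on {q \<in> Q. q \<noteq> 0}}"
  define d where "d = real (CARD('m) * CARD('n))"
  let ?E = "E_set Q \<Psi> \<theta>"
  have s_eq: "s_exponent Q \<Psi> = Inf S" by (simp add: s_exponent_def S_def)
  have DIM: "real DIM(real^'n^'m) = d" by (simp add: d_def)
  have fin1: "finite {q \<in> Q. \<Psi> q > 1}"
  proof (rule finite_subset)
    show "finite {q \<in> Q. \<Psi> q ^ CARD('m) \<ge> 1}" using finite_large_terms[OF assms(2), of 1] \<Psi> by simp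
  qed (auto intro: one_le_power)
  have star0: "Psi_star \<Psi> q \<ge> 0" for q using \<Psi>[of q] by (simp add: Psi_star_def infnorm_pos_le)
  have star_le: "Psi_star \<Psi> q \<le> \<Psi> q" if "q \<noteq> 0" for q
    using \<Psi>[of q] infnorm_real_vec_ge_1[OF that] by (simp add: Psi_star_def divide_le_eq mult_le_cancel_left1)
  \<comment> \<open>Makes \<open>S\<close> nonempty, so that \<open>Inf S\<close> is a genuine
    infimum.\<close>
  have "real CARD('m) \<in> S"
  proof -
    have "(\<lambda>q. \<Psi> q ^ CARD('m)) summable_on {q \<in> Q. q \<noteq> 0}"
      by (rule summable_on_subset_banach[OF assms(2)]) auto
    then have "(\<lambda>q. Psi_star \<Psi> q powr real CARD('m)) summable_on {q \<in> Q. q \<noteq> 0}"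
    proof (rule summable_on_comparison_test)
      fix q assume q: "q \<in> {q \<in> Q. q \<noteq> 0}"
      have "Psi_star \<Psi> q powr real CARD('m) \<le> Psi_star \<Psi> q ^ CARD('m)"
        using star0[of q] by (cases "Psi_star \<Psi> q = 0") (auto simp: powr_realpow)
      also have "\<dots> \<le> \<Psi> q ^ CARD('m)" using star0[of q] star_le[of q] q by (intro power_mono) auto
      finally show "Psi_star \<Psi> q powr real CARD('m) \<le> \<Psi> q ^ CARD('m)" .
    qed simp
    then show ?thesis by (simp add: S_def)
  qed
  then have Sne: "S \<noteq> {}" by blast
  have Sbd: "bdd_below S" by (rule bdd_belowI[of _ 0]) (simp add: S_def)
  have s0: "Inf S \<ge> 0" using Sne by (intro cInf_greatest) (auto simp: S_def)
  \<comment> \<open>Apart from finitely many q one has Psi_*(q) <= 1, so raising the exponent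
    preserves summability.\<close>
  have upper_closed: "t \<in> S" if "t > Inf S" for t
  proof -
    obtain \<sigma> where \<sigma>: "\<sigma> \<in> S" "\<sigma> < t" using cInf_lessD[OF Sne \<open>t > Inf S\<close>] by blast
    let ?I = "{q \<in> Q. q \<noteq> 0}" and ?J = "{q \<in> Q. \<Psi> q > 1}"
    have "(\<lambda>q. Psi_star \<Psi> q powr \<sigma>) summable_on (?I - ?J)"
      using \<sigma>(1) by (auto simp: S_def intro: summable_on_subset_banach)
    then have "(\<lambda>q. Psi_star \<Psi> q powr t) summable_on (?I - ?J)"
    proof (rule summable_on_comparison_test)
      fix q assume q: "q \<in> ?I - ?J"
      then have "Psi_star \<Psi> q \<le> 1" using star_le[of q] by auto
      then show "Psi_star \<Psi> q powr t \<le> Psi_star \<Psi> q powr \<sigma>"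
        using \<sigma>(2) star0[of q] by (intro powr_mono') auto
    qed simp
    moreover have "(\<lambda>q. Psi_star \<Psi> q powr t) summable_on (?I \<inter> ?J)"
      using fin1 by (intro summable_on_finite finite_Int) auto
    ultimately have "(\<lambda>q. Psi_star \<Psi> q powr t) summable_on ((?I - ?J) \<union> (?I \<inter> ?J))"
      by (rule summable_on_Un_disjoint) auto
    then show ?thesis using that s0 by (simp add: S_def Un_Diff_Int)
  qed
  have upper: "\<beta> \<le> min (2 * Inf S) d" if \<beta>: "\<beta> \<in> fourier_exponents ?E" for \<beta>
  proof -
    obtain \<mu> C where \<mu>: "\<mu> \<in> prob_measures_on ?E" "C > 0"
        "\<And>\<xi>. \<xi> \<noteq> 0 \<Longrightarrow> cmod (fourier_transform \<mu> \<xi>) \<le> C * infnorm \<xi> powr (- \<beta> / 2)"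
      using \<beta> unfolding fourier_exponents_def by blast
    have "\<beta> \<le> d" using \<beta> DIM by (simp add: fourier_exponents_def)
    moreover have "\<beta> \<le> 2 * Inf S"
    proof (rule ccontr)
      assume "\<not> \<beta> \<le> 2 * Inf S"
      then have lt: "Inf S < \<beta> / 2" by simp
      \<comment> \<open>An open interval contains two points, and at least one of them differs from
        the exceptional exponent m.\<close>
      obtain t where t: "Inf S < t" "t < \<beta> / 2" "t \<noteq> real CARD('m)"
      proof -
        obtain t1 where t1: "Inf S < t1" "t1 < \<beta> / 2" using dense[OF lt] by blast
        obtain t2 where t2: "t1 < t2" "t2 < \<beta> / 2" using dense[OF t1(2)] by blast
        show thesis using that[of t1] that[of t2] t1 t2 by (cases "t1 = real CARD('m)") auto
      qed
      show False
      proof (rule no_measure_with_large_decay[OF assms \<mu>(1,2)])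
        show "t \<ge> 0" "t \<noteq> real CARD('m)" using t s0 by auto
        show "(\<lambda>q. Psi_star \<Psi> q powr t) summable_on {q \<in> Q. q \<noteq> 0}"
          using upper_closed[OF t(1)] by (simp add: S_def)
        fix \<xi> :: "real^'n^'m" assume \<xi>: "infnorm \<xi> \<ge> 1"
        then have "\<xi> \<noteq> 0" by (auto simp: infnorm_0)
        then have "cmod (fourier_transform \<mu> \<xi>) \<le> C * infnorm \<xi> powr (- \<beta> / 2)" by (rule \<mu>(3))
        also have "\<dots> \<le> C * infnorm \<xi> powr (- t)"
          using \<mu>(2) \<xi> t by (intro mult_left_mono powr_mono) auto
        finally show "cmod (fourier_transform \<mu> \<xi>) \<le> C * infnorm \<xi> powr (- t)" .
      qed
    qed
    ultimately show ?thesis by simp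
  qed
  \<comment> \<open>The decay rate is half the Fourier exponent. An exponent t between t' and
    \<open>Inf S\<close> lies outside \<open>S\<close>, which is the divergence that the
    construction consumes.\<close>
  have lower: "2 * t' \<in> fourier_exponents ?E" if t': "0 < t'" "2 * t' < min (2 * Inf S) d" for t'
  proof -
    have "t' < Inf S" using t' by simp
    then obtain t where t: "t' < t" "t < Inf S" using dense by blast
    have "t \<notin> S" using cInf_lower[OF _ Sbd, of t] t(2) by auto
    then have div: "\<not> (\<lambda>q. Psi_star \<Psi> q powr t) summable_on {q \<in> Q. q \<noteq> 0}"
      using t t' by (simp add: S_def)
    obtain \<mu> C where \<mu>: "\<mu> \<in> prob_measures_on ?E" "C > 0"
      "\<And>\<xi>. cmod (fourier_transform \<mu> \<xi>) \<le> C * (1 + infnorm \<xi>) powr (- t')"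
      using fourier_dimension_lower_construction[OF t'(1) t(1) \<Psi> div fin1] by blast
    have "cmod (fourier_transform \<mu> \<xi>) \<le> C * infnorm \<xi> powr (- (2 * t') / 2)" if "\<xi> \<noteq> 0" for \<xi>
    proof -
      have "infnorm \<xi> > 0" using that by (simp add: infnorm_pos_lt)
      then have "(1 + infnorm \<xi>) powr (- t') \<le> infnorm \<xi> powr (- t')"
        using t' by (intro powr_mono2') auto
      then have "C * (1 + infnorm \<xi>) powr (- t') \<le> C * infnorm \<xi> powr (- t')" using \<mu>(2) by (intro mult_left_mono) auto
      then show ?thesis using \<mu>(3)[of \<xi>] by simp
    qed
    then show ?thesis unfolding fourier_exponents_def using t' DIM \<mu>(1,2) by auto
  qed
  let ?m = "min (2 * Inf S) d"
  have m0: "?m \<ge> 0" using s0 by (simp add: d_def)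
  have bdd: "bdd_above (fourier_exponents ?E)" using upper by (rule bdd_aboveI)
  have "fourier_dim ?E = ?m"
  \<comment> \<open>In this case the exponents form the empty set or {0}, and both conventions give
    dimension 0.\<close>
  proof (cases "?m = 0")
    case True
    have "fourier_exponents ?E \<subseteq> {0}" using upper True by (force simp: fourier_exponents_def)
    then have "fourier_exponents ?E = {} \<or> fourier_exponents ?E = {0}" by blast
    then have "fourier_dim ?E = 0" unfolding fourier_dim_def by (elim disjE) simp_all
    then show ?thesis by (simp only: True)
  next
    case False
    then have pos: "?m > 0" using m0 by linarith
    then have "2 * (?m / 4) \<in> fourier_exponents ?E" by (intro lower) auto
    then have ne: "fourier_exponents ?E \<noteq> {}" by blast
    have "Sup (fourier_exponents ?E) = ?m"
    proof (rule antisym)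
      show "Sup (fourier_exponents ?E) \<le> ?m" using ne upper by (rule cSup_least)
      show "?m \<le> Sup (fourier_exponents ?E)"
      proof (rule dense_le_bounded[OF pos])
        fix w assume w: "0 < w" "w < ?m"
        then have "2 * (w / 2) \<in> fourier_exponents ?E" by (intro lower) auto
        then show "w \<le> Sup (fourier_exponents ?E)" using cSup_upper[OF _ bdd] by simp
      qed
    qed
    then show ?thesis using ne by (simp add: fourier_dim_def)
  qed
  then show ?thesis by (simp add: s_eq d_def)
qed

end
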